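(* Let $d\in\mathbb{N}$, let $\varrho_0,\varrho_1:\mathbb{R}^d\to\mathbb{R}_+$ be measurable, and let $\varrho:\mathbb{R}^d\to\mathbb{R}_+$ be a not necessarily normalized density with $\varrho=\varrho_0\,\varrho_1$ and $C:=\int_{\mathbb{R}^d}\varrho(x)\,dx\in(0,\infty)$. Let $\pi$ be the probability measure on $\mathbb{R}^d$ given by $\pi(A)=C^{-1}\int_A\varrho(x)\,dx$, and let $P_X^{(\pi)}$ be the transition kernel of slice sampling for $\pi$ based on $\varrho_0$ and $\varrho_1$. Then for every $k\in\mathbb{N}$ with $\ell_{\varrho_0,\varrho_1}\in\Lambda_k$ we have $$\mathrm{gap}_\pi\big(P_X^{(\pi)}\big)\ \ge\ \frac{1}{k+1}.$$
   Context: $\mathbb{R}_+=[0,\infty)$, $\mathbb{N}=\{1,2,\dots\}$; $\lambda$ is Lebesgue measure on $\mathbb{R}$. The factorization $\varrho=\varrho_0\varrho_1$ is only required to hold Lebesgue-almost everywhere. Super level sets: $L(t,\varrho_1):=\{z\in\mathbb{R}^d:\varrho_1(z)>t\}$ for $t>0$. Generalized level-set function: $\ell_{\varrho_0,\varrho_1}:(0,\infty)\to\mathbb{R}_+$, $\ell_{\varrho_0,\varrho_1}(t):=\int_{L(t,\varrho_1)}\varrho_0(x)\,dx$. Slice sampling kernels: for $x\in\mathbb{R}^d$ and Borel $A\subseteq(0,\infty)$, $U_T(x,A)=\lambda(A\cap(0,\varrho_1(x)))/\varrho_1(x)$; for $t>0$ and Borel $B\subseteq\mathbb{R}^d$, $U_X(t,B)=\int_{B\cap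 L(t,\varrho_1)}\varrho_0(x)\,dx\,/\,\int_{L(t,\varrho_1)}\varrho_0(x)\,dx$. Where a denominator vanishes, the kernel is set to an arbitrary fixed probability measure (this does not affect the induced $L_2$ operators). The transition kernel of slice sampling is $P_X^{(\pi)}=U_TU_X$, i.e. $P_X^{(\pi)}(x,B)=\int_{(0,\infty)}U_X(t,B)\,U_T(x,dt)$; it is reversible with respect to $\pi$. Spectral gap: for a kernel $P$ reversible w.r.t. a probability measure $\pi$, $P$ acts on $L_2(\pi)$ by $Pg(x)=\int g(y)P(x,dy)$, $\pi$ is viewed as the operator $g\mapsto\int g\,d\pi$ (constant function), and $\mathrm{gap}_\pi(P):=1-\|P-\pi\|_{L_2(\pi)\to L_2(\pi)}$ (operator norm). Class $\Lambda_k$ ($k\in\mathbb{N}$): the class of continuous functions $\ell:(0,\infty)\to\mathbb{R}_+$ such that (i) $\lim_{t\to\infty}\ell(t)=0$ and $\mathcal{L}:=\lim_{t\searrow0}\ell(t)\in(0,\infty]$; (ii) $\ell$ restricted to its open support $\mathrm{supp}(\ell):=(0,\sup\{t\in(0,\infty):\ell(t)>0\})$ is strictly decreasing; (iii) the function $g:(0,\mathcal{L}^{1/k})\to(0,\infty)$, $g(r)=\ell^{-1}(r^k)$, is log-concave, where $\ell^{-1}:(0,\mathcal{L})\to\mathrm{supp}(\ell)$ is the inverse of the bijection $\ell|_{\mathrm{supp}(\ell)}:\mathrm{supp}(\ell)\to(0,\mathcal{L})$ (and $\infty^{1/k}=\infty$). *)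

theory Defs
  imports "HOL-Probability.Probability"
begin

subsection \<open>Slice sampling\<close>

definition level_set :: "real \<Rightarrow> ('a \<Rightarrow> real) \<Rightarrow> 'a set" where
  "level_set t \<rho>1 = {z. \<rho>1 z > t}"

text \<open>
  For \<open>t > 0\<close> the integral is finite as soon as \<open>\<rho>0 * \<rho>1\<close> is integrable, because
  \<open>\<rho>0 \<le> \<rho>0 * \<rho>1 / t\<close> on the level set; only arguments \<open>t > 0\<close> are ever used.
\<close>

definition level_fun :: "('a::euclidean_space \<Rightarrow> real) \<Rightarrow> ('a \<Rightarrow> real) \<Rightarrow> real \<Rightarrow> real" where
  "level_fun \<rho>0 \<rho>1 t = (LINT x:level_set t \<rho>1|lborel. \<rho>0 x)"

definition target_measure :: "('a::euclidean_space \<Rightarrow> real) \<Rightarrow> 'a measure" where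
  "target_measure \<rho> = density lborel (\<lambda>x. ennreal (\<rho> x / (\<integral>y. \<rho> y \<partial>lborel)))"

abbreviation pos_borel :: "real measure" where
  "pos_borel \<equiv> restrict_space borel {0<..}"

text \<open>
  The measures \<open>\<nu>T\<close> and \<open>\<nu>X\<close> are the arbitrary fixed probability measures that are used
  where the denominator of the respective kernel vanishes.
\<close>

definition kernel_UT :: "real measure \<Rightarrow> ('a \<Rightarrow> real) \<Rightarrow> 'a \<Rightarrow> real measure" where
  "kernel_UT \<nu>T \<rho>1 x =
     (if \<rho>1 x = 0 then \<nu>T
      else uniform_measure (restrict_space lborel {0<..}) {0<..<\<rho>1 x})"

definition kernel_UX ::
    "'a measure \<Rightarrow> ('a::euclidean_space \<Rightarrow> real) \<Rightarrow> ('a \<Rightarrow> real) \<Rightarrow> real \<Rightarrow> 'a measure" where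
  "kernel_UX \<nu>X \<rho>0 \<rho>1 t =
     (if level_fun \<rho>0 \<rho>1 t = 0 then \<nu>X
      else uniform_measure (density lborel (\<lambda>x. ennreal (\<rho>0 x))) (level_set t \<rho>1))"

definition slice_kernel ::
    "real measure \<Rightarrow> 'a measure \<Rightarrow> ('a::euclidean_space \<Rightarrow> real) \<Rightarrow> ('a \<Rightarrow> real) \<Rightarrow> 'a \<Rightarrow> 'a measure" where
  "slice_kernel \<nu>T \<nu>X \<rho>0 \<rho>1 x = kernel_UT \<nu>T \<rho>1 x \<bind> kernel_UX \<nu>X \<rho>0 \<rho>1"


subsection \<open>Spectral gap\<close>

text \<open>
  Elements of \<open>L\<^sub>2\<close> are represented by measurable, square-integrable functions. The norm takes
  the value \<open>\<infinity>\<close> outside of \<open>L\<^sub>2\<close>, so that the operator norm below is \<open>\<infinity>\<close> (and the gap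
  \<open>-\<infinity>\<close>) unless the operator really is a bounded operator on \<open>L\<^sub>2\<close>.
\<close>

definition L2_space :: "'a measure \<Rightarrow> ('a \<Rightarrow> real) set" where
  "L2_space M = {f \<in> borel_measurable M. integrable M (\<lambda>x. (f x)\<^sup>2)}"

definition L2_norm :: "'a measure \<Rightarrow> ('a \<Rightarrow> real) \<Rightarrow> ereal" where
  "L2_norm M f = (if f \<in> L2_space M then ereal (sqrt (\<integral>x. (f x)\<^sup>2 \<partial>M)) else \<infinity>)"

definition L2_opnorm :: "'a measure \<Rightarrow> (('a \<Rightarrow> real) \<Rightarrow> 'a \<Rightarrow> real) \<Rightarrow> ereal" where
  "L2_opnorm M T = (SUP f\<in>{f \<in> L2_space M. L2_norm M f \<le> 1}. L2_norm M (T f))"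

definition kernel_op :: "('a \<Rightarrow> 'a measure) \<Rightarrow> ('a \<Rightarrow> real) \<Rightarrow> 'a \<Rightarrow> real" where
  "kernel_op P g x = (\<integral>y. g y \<partial>P x)"

definition mean_op :: "'a measure \<Rightarrow> ('a \<Rightarrow> real) \<Rightarrow> 'a \<Rightarrow> real" where
  "mean_op \<pi> g x = (\<integral>y. g y \<partial>\<pi>)"

definition spectral_gap :: "'a measure \<Rightarrow> ('a \<Rightarrow> 'a measure) \<Rightarrow> ereal" where
  "spectral_gap \<pi> P = 1 - L2_opnorm \<pi> (\<lambda>g x. kernel_op P g x - mean_op \<pi> g x)"


subsection \<open>The classes \<open>\<Lambda>\<^sub>k\<close>\<close>

text \<open>
  Functions on \<open>(0,\<infinity>)\<close> are represented by total functions whose values on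
  \<open>(-\<infinity>,0]\<close> are ignored.
\<close>

definition open_supp :: "(real \<Rightarrow> real) \<Rightarrow> real set" where
  "open_supp l = {t. 0 < t \<and> ereal t < (SUP s\<in>{s. 0 < s \<and> l s > 0}. ereal s)}"

definition eroot :: "nat \<Rightarrow> ereal \<Rightarrow> ereal" where
  "eroot k L = (if L = \<infinity> then \<infinity> else ereal (root k (real_of_ereal L)))"

definition log_concave_on :: "real set \<Rightarrow> (real \<Rightarrow> real) \<Rightarrow> bool" where
  "log_concave_on S g \<longleftrightarrow> (\<forall>r\<in>S. 0 < g r) \<and> concave_on S (\<lambda>r. ln (g r))"

definition Lambda_class :: "nat \<Rightarrow> (real \<Rightarrow> real) set" where
  "Lambda_class k = {l.
     (\<forall>t>0. 0 \<le> l t) \<and>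
     continuous_on {0<..} l \<and>
     (l \<longlongrightarrow> 0) at_top \<and>
     strict_antimono_on (open_supp l) l \<and>
     (\<exists>L::ereal. 0 < L \<and> ((\<lambda>t. ereal (l t)) \<longlongrightarrow> L) (at_right 0) \<and>
        log_concave_on {r. 0 < r \<and> ereal r < eroot k L}
          (\<lambda>r. the_inv_into (open_supp l) l (r ^ k)))}"


subsection \<open>The kernels are given by the expected formulas\<close>

lemma emeasure_kernel_UT:
  assumes "0 < \<rho>1 x" and A: "A \<in> sets pos_borel"
  shows "emeasure (kernel_UT \<nu>T \<rho>1 x) A = emeasure lborel (A \<inter> {0<..<\<rho>1 x}) / ennreal (\<rho>1 x)"
proof -
  have sub: "A \<subseteq> {0<..}" and AB: "A \<in> sets (restrict_space lborel {0<..})"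
    using A by (auto simp: sets_restrict_space)
  have I: "{0<..<\<rho>1 x} \<in> sets (restrict_space lborel {0<..})"
    by (auto simp: sets_restrict_space_iff)
  have "{0<..<\<rho>1 x} \<subseteq> {0<..}" by auto
  with sub \<open>0 < \<rho>1 x\<close> show ?thesis
    unfolding kernel_UT_def
    by (simp add: emeasure_uniform_measure[OF I AB] emeasure_restrict_space le_infI2
        Int_commute[of A])
qed

context
  fixes \<rho>0 \<rho>1 :: "'a::euclidean_space \<Rightarrow> real" and \<nu>X :: "'a measure" and \<nu>T :: "real measure"
  assumes meas [measurable]: "\<rho>0 \<in> borel_measurable borel" "\<rho>1 \<in> borel_measurable borel"
    and nonneg: "\<And>x. 0 \<le> \<rho>0 x" "\<And>x. 0 \<le> \<rho>1 x"
    and int: "integrable lborel (\<lambda>x. \<rho>0 x * \<rho>1 x)"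
    and nuX: "prob_space \<nu>X" "sets \<nu>X = sets borel"
    and nuT: "prob_space \<nu>T" "sets \<nu>T = sets pos_borel"
begin

lemma level_set_borel [measurable]: "level_set t \<rho>1 \<in> sets borel"
  unfolding level_set_def by measurable

lemma set_integrable_level_set:
  assumes "0 < t"
  shows "set_integrable lborel (level_set t \<rho>1) \<rho>0"
  unfolding set_integrable_def
proof (rule Bochner_Integration.integrable_bound)
  show "integrable lborel (\<lambda>x. \<rho>0 x * \<rho>1 x / t)"
    using int by simp
  have "indicator (level_set t \<rho>1) x * \<rho>0 x \<le> \<rho>0 x * \<rho>1 x / t" for x
  proof (cases "x \<in> level_set t \<rho>1")
    case True
    then have "\<rho>0 x * t \<le> \<rho>0 x * \<rho>1 x"
      using nonneg by (intro mult_left_mono) (auto simp: level_set_def)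
    with True assms show ?thesis by (simp add: field_simps)
  qed (use assms nonneg in auto)
  then show "AE x in lborel. norm (indicator (level_set t \<rho>1) x *\<^sub>R \<rho>0 x) \<le> norm (\<rho>0 x * \<rho>1 x / t)"
    using assms nonneg by (auto simp: abs_mult)
qed measurable

lemma nn_integral_level_set:
  assumes "0 < t"
  shows "(\<integral>\<^sup>+x\<in>level_set t \<rho>1. ennreal (\<rho>0 x) \<partial>lborel) = ennreal (level_fun \<rho>0 \<rho>1 t)"
proof -
  have "(\<integral>\<^sup>+x\<in>level_set t \<rho>1. ennreal (\<rho>0 x) \<partial>lborel)
      = (\<integral>\<^sup>+x. ennreal (indicator (level_set t \<rho>1) x *\<^sub>R \<rho>0 x) \<partial>lborel)"
    by (intro nn_integral_cong) (auto split: split_indicator)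
  also have "\<dots> = ennreal (level_fun \<rho>0 \<rho>1 t)"
    unfolding level_fun_def set_lebesgue_integral_def
    using set_integrable_level_set[OF assms] nonneg
    by (intro nn_integral_eq_integral) (auto simp: set_integrable_def)
  finally show ?thesis .
qed

lemma emeasure_kernel_UX:
  assumes "0 < t" "level_fun \<rho>0 \<rho>1 t \<noteq> 0" and [measurable]: "B \<in> sets borel"
  shows "emeasure (kernel_UX \<nu>X \<rho>0 \<rho>1 t) B =
    (\<integral>\<^sup>+x\<in>B \<inter> level_set t \<rho>1. ennreal (\<rho>0 x) \<partial>lborel) / ennreal (level_fun \<rho>0 \<rho>1 t)"
  using assms nn_integral_level_set[OF assms(1)]
  by (simp add: kernel_UX_def emeasure_density Int_commute)

lemma measurable_kernel_UX: "kernel_UX \<nu>X \<rho>0 \<rho>1 \<in> measurable pos_borel (prob_algebra borel)"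
proof -
  have prob: "prob_space (kernel_UX \<nu>X \<rho>0 \<rho>1 t)" if "0 < t" for t
  proof (cases "level_fun \<rho>0 \<rho>1 t = 0")
    case False
    have "0 \<le> level_fun \<rho>0 \<rho>1 t"
      unfolding level_fun_def set_lebesgue_integral_def using nonneg
      by (intro Bochner_Integration.integral_nonneg) auto
    with False show ?thesis
      using nn_integral_level_set[OF that]
      by (auto simp: kernel_UX_def emeasure_density intro!: prob_space_uniform_measure)
  qed (simp add: kernel_UX_def nuX)
  have sets: "sets (kernel_UX \<nu>X \<rho>0 \<rho>1 t) = sets borel" for t
    by (simp add: kernel_UX_def nuX)
  have [measurable]: "level_fun \<rho>0 \<rho>1 \<in> borel_measurable borel"
    unfolding level_fun_def set_lebesgue_integral_def level_set_def indicator_def of_bool_def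
    by measurable
  have "(\<lambda>t. emeasure (kernel_UX \<nu>X \<rho>0 \<rho>1 t) B) \<in> borel_measurable pos_borel"
    if [measurable]: "B \<in> sets borel" for B
  proof -
    have "(\<lambda>t. if level_fun \<rho>0 \<rho>1 t = 0 then emeasure \<nu>X B else
        (\<integral>\<^sup>+x. ennreal (\<rho>0 x) * (if x \<in> B \<and> \<rho>1 x > t then 1 else 0) \<partial>lborel) / ennreal (level_fun \<rho>0 \<rho>1 t))
        \<in> borel_measurable borel"
      by measurable
    then have "(\<lambda>t. if level_fun \<rho>0 \<rho>1 t = 0 then emeasure \<nu>X B else
        (\<integral>\<^sup>+x. ennreal (\<rho>0 x) * (if x \<in> B \<and> \<rho>1 x > t then 1 else 0) \<partial>lborel) / ennreal (level_fun \<rho>0 \<rho>1 t))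
        \<in> borel_measurable pos_borel"
      by (rule measurable_restrict_space1)
    then show ?thesis
    proof (rule measurable_cong[THEN iffD1, rotated], goal_cases)
      case (1 t)
      then have "0 < t" by (simp add: space_restrict_space)
      have "level_fun \<rho>0 \<rho>1 t = 0 \<Longrightarrow> emeasure (kernel_UX \<nu>X \<rho>0 \<rho>1 t) B = emeasure \<nu>X B"
        by (simp add: kernel_UX_def)
      then show ?case
        using emeasure_kernel_UX[OF \<open>0 < t\<close> _ that]
        by (auto intro!: arg_cong2[where f = "(/)"] nn_integral_cong
            simp: level_set_def split: split_indicator)
    qed
  qed
  then show ?thesis
    using prob sets
    by (auto intro!: measurable_prob_algebraI measurable_subprob_algebra
        simp: space_restrict_space prob_space_imp_subprob_space)
qed

lemma emeasure_slice_kernel: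
  assumes B: "B \<in> sets borel"
  shows "emeasure (slice_kernel \<nu>T \<nu>X \<rho>0 \<rho>1 x) B =
    (\<integral>\<^sup>+t. emeasure (kernel_UX \<nu>X \<rho>0 \<rho>1 t) B \<partial>kernel_UT \<nu>T \<rho>1 x)"
proof -
  have s: "sets (kernel_UT \<nu>T \<rho>1 x) = sets pos_borel"
    by (simp add: kernel_UT_def nuT sets_restrict_space)
  then have "space (kernel_UT \<nu>T \<rho>1 x) = {0<..}"
    by (metis sets_eq_imp_space_eq space_restrict_space space_borel Int_UNIV_right)
  then have ne: "space (kernel_UT \<nu>T \<rho>1 x) \<noteq> {}" by auto
  show ?thesis
    unfolding slice_kernel_def
    using measurable_prob_algebraD[OF measurable_kernel_UX] B ne
    by (intro emeasure_bind[where N = borel]) (simp_all add: measurable_cong_sets[OF s refl])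
qed

end

end

theory Submission
  imports Defs
begin

text \<open>
Write \<open>S = \<rho>1(X)\<close> with \<open>X\<close> distributed as \<open>\<pi>\<close>, and let the height \<open>T\<close> be uniform on \<open>(0, S)\<close>
given \<open>X\<close>. Given \<open>T = t\<close>, the law of \<open>X\<close> is \<open>\<rho>0\<close> restricted to the level set \<open>{\<rho>1 > t}\<close>,
and \<open>T\<close> has the density \<open>p(t) = E (1{S > t} / S)\<close> (\<open>height_pdf\<close>), which is the level-set function divided by its
integral. Hence slice sampling is \<open>U U*\<close>, where \<open>U h (x) = avg h (S x)\<close> averages a function
of the height over \<open>(0, S x)\<close> and \<open>U* g (t) = cond_mean g t\<close> is the conditional expectation of \<open>g(X)\<close>
given \<open>T = t\<close>. The norm of \<open>P - \<pi>\<close> is the squared norm of \<open>U\<close> on functions with mean zero, and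
\<open>U\<close> only sees the pair \<open>(S, T)\<close>. With \<open>r = k / (k + 1)\<close> everything comes down to
\<open>Var (avg h (S)) \<le> r Var (h(T))\<close>, which is the lemma \<open>variance_contraction\<close>.

Put \<open>F = avg h\<close>. Then \<open>(s F)' = h\<close>, that is, \<open>s F' = h - F\<close>, and
\<open>Var (h(T)) - Var (F(S)) = E ((h - F)(T)\<^sup>2)\<close>. So the claim is equivalent to the weighted Poincare
inequality \<open>Var (F(S)) \<le> k E ((T F'(T))\<^sup>2)\<close>.

The proof of that inequality uses \<open>\<lambda>(t) = p(t)\<^sup>1\<^sup>/\<^sup>k\<close> (\<open>radius\<close>), up to a constant the radius of
a \<open>k\<close>-dimensional ball with the volume of the slice at height \<open>t\<close>. Log-concavity of the inverse
says that moving down from height \<open>t\<close> to \<open>u t\<close> increases a large radius by at most as much as a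
small one: \<open>\<lambda>(u s) - \<lambda>(u t) \<le> \<lambda>(s) - \<lambda>(t)\<close> for \<open>s < t\<close> (\<open>Lambda_class_contraction\<close>).
Integrating over \<open>u\<close>, the difference \<open>\<delta> = avg \<lambda> - \<lambda>\<close> (\<open>excess\<close>) is increasing. Up to the factor \<open>r\<close>,
\<open>avg \<lambda>\<close> is the expected radius after one step of the chain of radii, so the monotonicity says that
this step contracts distances by the factor \<open>r\<close>.

This contraction is turned into the Poincare inequality without iterating the chain. By the
Cauchy-Schwarz inequality with weight \<open>\<delta>(s) / s = - (avg \<lambda>)'(s)\<close>,
\<open>(F(x) - F(y))\<^sup>2 \<le> (avg \<lambda> y - avg \<lambda> x) \<integral>\<^sub>y\<^sup>x (h - F)\<^sup>2 / (s \<delta>) ds\<close> for \<open>y < x\<close>. Integrating over two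
independent copies of \<open>S\<close> and exchanging integrals, what remains is to bound, for every \<open>z\<close>, the
mean of \<open>avg \<lambda> y - avg \<lambda> x\<close> over the pairs \<open>y \<le> z < x\<close> by \<open>k z p(z) \<delta>(z)\<close>
(\<open>crossing_bound\<close>). Two applications of Fubini give the identity
\<open>(k + 1) E (1{S > z} \<delta>(S)) = E (1{S > z} avg \<lambda> (S)) + k z p(z) \<delta>(z)\<close>, and with it the bound
is exactly the statement that \<open>S > z\<close> and the increasing function \<open>\<delta>(S)\<close> are positively correlated.
\<close>

section \<open>Averages over initial segments\<close>

definition avg :: "(real \<Rightarrow> real) \<Rightarrow> real \<Rightarrow> real" where
  "avg h s = (\<integral>t. indicator {0<..<s} t * h t \<partial>lborel) / s"

lemma avg_measurable [measurable]:
  assumes [measurable]: "h \<in> borel_measurable borel"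
  shows "avg h \<in> borel_measurable borel"
proof -
  have "(\<lambda>s. (\<integral>t. (if 0 < t \<and> t < s then 1 else 0) * h t \<partial>lborel) / s) \<in> borel_measurable borel"
    by measurable
  then show ?thesis
    by (simp add: avg_def[abs_def] indicator_def of_bool_def)
qed

text \<open>
Jensen's inequality; multiplied by \<open>s\<close> and stated for nonnegative integrals, so that it also
covers averages of functions whose square has an infinite integral.
\<close>

lemma avg_square_le:
  assumes [measurable]: "h \<in> borel_measurable borel" and s: "0 < s"
  shows "ennreal (s * (avg h s)\<^sup>2) \<le> (\<integral>\<^sup>+t. indicator {0<..<s} t * ennreal ((h t)\<^sup>2) \<partial>lborel)"
proof -
  let ?I = "\<integral>\<^sup>+t. indicator {0<..<s} t * ennreal ((h t)\<^sup>2) \<partial>lborel"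
  let ?A = "\<integral>\<^sup>+t. indicator {0<..<s} t * ennreal \<bar>h t\<bar> \<partial>lborel"
  have "ennreal \<bar>s * avg h s\<bar> = ennreal \<bar>\<integral>t. indicator {0<..<s} t * h t \<partial>lborel\<bar>"
    using s by (simp add: avg_def)
  also have "\<dots> \<le> (\<integral>\<^sup>+t. ennreal (norm (indicator {0<..<s} t * h t)) \<partial>lborel)"
    using integral_norm_bound_ennreal[of lborel "\<lambda>t. indicator {0<..<s} t * h t"]
    by (cases "integrable lborel (\<lambda>t. indicator {0<..<s} t * h t)")
       (auto simp: not_integrable_integral_eq)
  also have "\<dots> = ?A"
    by (intro nn_integral_cong) (auto simp: indicator_def)
  finally have 1: "ennreal \<bar>s * avg h s\<bar> \<le> ?A" .
  have "ennreal (s * (s * (avg h s)\<^sup>2)) = (ennreal \<bar>s * avg h s\<bar>)\<^sup>2"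
    by (subst ennreal_power) (auto simp: power2_eq_square ac_simps)
  also have "\<dots> \<le> ?A\<^sup>2"
    using 1 by (rule power_mono) simp
  also have "?A = (\<integral>\<^sup>+t. indicator {0<..<s} t * (indicator {0<..<s} t * ennreal \<bar>h t\<bar>) \<partial>lborel)"
    by (intro nn_integral_cong) (auto simp: indicator_def)
  also have "\<dots>\<^sup>2 \<le> (\<integral>\<^sup>+t. (indicator {0<..<s} t)\<^sup>2 \<partial>lborel)
      * (\<integral>\<^sup>+t. (indicator {0<..<s} t * ennreal \<bar>h t\<bar>)\<^sup>2 \<partial>lborel)"
    by (rule Cauchy_Schwarz_nn_integral) measurable
  also have "(\<integral>\<^sup>+t. (indicator {0<..<s} t)\<^sup>2 \<partial>lborel) = (\<integral>\<^sup>+t. indicator {0<..<s} t \<partial>lborel)"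
    by (intro nn_integral_cong) (auto simp: indicator_def)
  also have "\<dots> = ennreal s" using s by simp
  also have "(\<integral>\<^sup>+t. (indicator {0<..<s} t * ennreal \<bar>h t\<bar>)\<^sup>2 \<partial>lborel) = ?I"
    by (intro nn_integral_cong) (auto simp: indicator_def ennreal_power)
  finally have "ennreal s * ennreal (s * (avg h s)\<^sup>2) \<le> ennreal s * ?I"
    using s by (simp add: ennreal_mult)
  then show ?thesis
    using s by (subst (asm) ennreal_mult_le_mult_iff) auto
qed

text \<open>
This is \<open>(s F)' = h\<close> for \<open>F = avg h\<close>. Near \<open>0\<close> the function \<open>h\<close> may be unbounded, so the integral is
split at \<open>s / 2\<close> and only the part above is differentiated.
\<close>

lemma avg_has_derivative:
  assumes cont: "continuous_on {0<..} h"
    and int: "\<And>s. 0 < s \<Longrightarrow> integrable lborel (\<lambda>t. indicator {0<..<s} t * h t)"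
    and s: "0 < s"
  shows "(avg h has_real_derivative (h s - avg h s) / s) (at s)"
proof -
  define a b where "a = s / 2" and "b = 2 * s"
  have ab: "0 < a" "a < s" "s < b" using s by (auto simp: a_def b_def)
  define H where "H x = (\<integral>t. indicator {0<..<x} t * h t \<partial>lborel)" for x
  have cab: "continuous_on {a..b} h"
    using cont ab by (auto intro: continuous_on_subset)
  have H_eq: "H x = H a + integral {a..x} h" if "x \<in> {a<..<b}" for x
  proof -
    have c: "continuous_on {a..x} h" using cab that by (auto intro: continuous_on_subset)
    have si: "set_integrable lborel {a..x} h"
      using borel_integrable_compact[OF _ c] by (auto simp: set_integrable_def)
    have "H x = (\<integral>t. indicator {0<..<a} t * h t + indicator {a..x} t *\<^sub>R h t \<partial>lborel)"
      unfolding H_def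
    proof (rule integral_cong_AE)
      show "AE t in lborel. indicator {0<..<x} t * h t
          = indicator {0<..<a} t * h t + indicator {a..x} t *\<^sub>R h t"
        using AE_lborel_singleton[of x] by eventually_elim (use that ab in \<open>auto simp: indicator_def\<close>)
      show "(\<lambda>t. indicator {0<..<x} t * h t) \<in> borel_measurable lborel"
        using int[of x] that ab by auto
      show "(\<lambda>t. indicator {0<..<a} t * h t + indicator {a..x} t *\<^sub>R h t) \<in> borel_measurable lborel"
        using int[of a] si ab by (auto simp: set_integrable_def)
    qed
    also have "\<dots> = H a + (LINT t:{a..x}|lborel. h t)"
      unfolding H_def set_lebesgue_integral_def
      using int[of a] si ab by (intro Bochner_Integration.integral_add) (auto simp: set_integrable_def)
    also have "(LINT t:{a..x}|lborel. h t) = integral {a..x} h"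
      using si by (rule set_borel_integral_eq_integral)
    finally show ?thesis .
  qed
  have "((\<lambda>x. integral {a..x} h) has_real_derivative h s) (at s within {a..b})"
    using cab ab by (intro integral_has_real_derivative) auto
  then have "((\<lambda>x. H a + integral {a..x} h) has_real_derivative h s) (at s within {a..b})"
    by (auto intro!: derivative_eq_intros)
  moreover have "at s within {a..b} = at s"
    using ab by (intro at_within_interior) auto
  ultimately have "((\<lambda>x. H a + integral {a..x} h) has_real_derivative h s) (at s)"
    by simp
  then have "(H has_real_derivative h s) (at s)"
    by (rule has_field_derivative_transform_within_open[of _ _ _ "{a<..<b}"]) (use ab H_eq in auto)
  then have "((\<lambda>x. H x / x) has_real_derivative (h s * s - H s * 1) / (s * s)) (at s)"
    using s by (intro DERIV_divide) (auto intro!: derivative_eq_intros)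
  moreover have "(\<lambda>x. H x / x) = avg h" by (auto simp: H_def avg_def)
  moreover have "(h s * s - H s * 1) / (s * s) = (h s - avg h s) / s"
    using s by (simp add: H_def avg_def field_simps)
  ultimately show ?thesis by simp
qed

lemma avg_continuous_on:
  assumes "continuous_on {0<..} h"
    and "\<And>s. 0 < s \<Longrightarrow> integrable lborel (\<lambda>t. indicator {0<..<s} t * h t)"
  shows "continuous_on {0<..} (avg h)"
  using avg_has_derivative[OF assms] DERIV_isCont
  by (intro continuous_at_imp_continuous_on) blast

lemma avg_diff:
  assumes cont: "continuous_on {0<..} h"
    and int: "\<And>s. 0 < s \<Longrightarrow> integrable lborel (\<lambda>t. indicator {0<..<s} t * h t)"
    and xy: "0 < x" "x \<le> y"
  shows "has_bochner_integral lborel (\<lambda>s. indicator {x..y} s * ((h s - avg h s) / s)) (avg h y - avg h x)"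
proof -
  have "isCont (\<lambda>s. (h s - avg h s) / s) s" if "x \<le> s" for s
  proof -
    have "continuous_on {0<..} (\<lambda>s. (h s - avg h s) / s)"
      by (intro continuous_intros cont avg_continuous_on int) auto
    then show ?thesis using that xy by (simp add: continuous_on_eq_continuous_at)
  qed
  then have "has_bochner_integral lborel (\<lambda>s. (h s - avg h s) / s * indicator {x..y} s) (avg h y - avg h x)"
    using xy by (intro has_bochner_integral_FTC_Icc_real avg_has_derivative[OF cont int]) auto
  then show ?thesis by (simp add: mult.commute)
qed

text \<open>
In fact equality holds: \<open>(s F\<^sup>2)' = 2 h F - F\<^sup>2 = h\<^sup>2 - (h - F)\<^sup>2\<close>. Integrating from \<open>e > 0\<close> leaves the
boundary term \<open>e F(e)\<^sup>2\<close>, which Jensen's inequality absorbs into the part of the integral of \<open>h\<^sup>2\<close> below \<open>e\<close>;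
then \<open>e\<close> tends to \<open>0\<close>.
\<close>

lemma avg_variance_le:
  assumes cont: "continuous_on {0<..} h" and [measurable]: "h \<in> borel_measurable borel"
    and int: "\<And>s. 0 < s \<Longrightarrow> integrable lborel (\<lambda>t. indicator {0<..<s} t * h t)"
    and s: "0 < s"
  shows "(\<integral>\<^sup>+t. indicator {0<..<s} t * ennreal ((h t - avg h t)\<^sup>2) \<partial>lborel) + ennreal (s * (avg h s)\<^sup>2)
    \<le> (\<integral>\<^sup>+t. indicator {0<..<s} t * ennreal ((h t)\<^sup>2) \<partial>lborel)"
    (is "?D + _ \<le> ?I")
proof -
  have step: "(\<integral>\<^sup>+t. indicator {e..s} t * ennreal ((h t - avg h t)\<^sup>2) \<partial>lborel) + ennreal (s * (avg h s)\<^sup>2) \<le> ?I"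
    (is "?De + _ \<le> _") if e: "0 < e" "e \<le> s" for e
  proof -
    have cD: "continuous_on {0<..} (\<lambda>t. (h t - avg h t)\<^sup>2)"
      by (intro continuous_intros cont avg_continuous_on int)
    have ch: "continuous_on {0<..} (\<lambda>t. (h t)\<^sup>2)"
      by (intro continuous_intros cont)
    have fin: "(\<integral>\<^sup>+t. indicator {e..s} t * ennreal (f t) \<partial>lborel)
        = ennreal (\<integral>t. f t * indicator {e..s} t \<partial>lborel)"
      "integrable lborel (\<lambda>t. f t * indicator {e..s} t)"
      if "continuous_on {0<..} f" "\<And>t. 0 \<le> f t" for f :: "real \<Rightarrow> real"
    proof -
      have "continuous_on {e..s} f" using that(1) e by (auto intro: continuous_on_subset)
      from borel_integrable_compact[OF _ this]
      show i: "integrable lborel (\<lambda>t. f t * indicator {e..s} t)" by (simp add: mult.commute)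
      have "(\<integral>\<^sup>+t. indicator {e..s} t * ennreal (f t) \<partial>lborel)
          = (\<integral>\<^sup>+t. ennreal (f t * indicator {e..s} t) \<partial>lborel)"
        by (intro nn_integral_cong) (auto simp: indicator_def)
      also have "\<dots> = ennreal (\<integral>t. f t * indicator {e..s} t \<partial>lborel)"
        using that(2) by (intro nn_integral_eq_integral i) auto
      finally show "(\<integral>\<^sup>+t. indicator {e..s} t * ennreal (f t) \<partial>lborel)
          = ennreal (\<integral>t. f t * indicator {e..s} t \<partial>lborel)" .
    qed
    have "(\<integral>t. ((h t)\<^sup>2 - (h t - avg h t)\<^sup>2) * indicator {e..s} t \<partial>lborel) = s * (avg h s)\<^sup>2 - e * (avg h e)\<^sup>2"
    proof (rule integral_FTC_Icc_real[OF e(2)])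
      fix t assume t: "e \<le> t" "t \<le> s"
      then have t0: "0 < t" using e by simp
      have "((\<lambda>t. t * (avg h t)\<^sup>2) has_real_derivative
          1 * (avg h t)\<^sup>2 + t * (2 * avg h t * ((h t - avg h t) / t))) (at t)"
        using t0 by (auto intro!: derivative_eq_intros avg_has_derivative[OF cont int t0] simp: field_simps)
      moreover have "1 * (avg h t)\<^sup>2 + t * (2 * avg h t * ((h t - avg h t) / t)) = (h t)\<^sup>2 - (h t - avg h t)\<^sup>2"
      proof -
        have "t * (2 * avg h t * ((h t - avg h t) / t)) = 2 * avg h t * (h t - avg h t)"
          using t0 by simp
        then show ?thesis by (simp only:) (simp add: power2_eq_square algebra_simps)
      qed
      ultimately show "((\<lambda>t. t * (avg h t)\<^sup>2) has_real_derivative (h t)\<^sup>2 - (h t - avg h t)\<^sup>2) (at t)"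
        by simp
      have "continuous_on {0<..} (\<lambda>t. (h t)\<^sup>2 - (h t - avg h t)\<^sup>2)"
        by (intro continuous_intros cD ch)
      then show "isCont (\<lambda>t. (h t)\<^sup>2 - (h t - avg h t)\<^sup>2) t"
        using t0 by (simp add: continuous_on_eq_continuous_at)
    qed
    also have "(\<integral>t. ((h t)\<^sup>2 - (h t - avg h t)\<^sup>2) * indicator {e..s} t \<partial>lborel) =
      (\<integral>t. (h t)\<^sup>2 * indicator {e..s} t \<partial>lborel) - (\<integral>t. (h t - avg h t)\<^sup>2 * indicator {e..s} t \<partial>lborel)"
      by (simp only: left_diff_distrib) (intro Bochner_Integration.integral_diff fin(2) ch cD; simp)
    finally have eq: "(\<integral>t. (h t - avg h t)\<^sup>2 * indicator {e..s} t \<partial>lborel) + s * (avg h s)\<^sup>2 =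
       (\<integral>t. (h t)\<^sup>2 * indicator {e..s} t \<partial>lborel) + e * (avg h e)\<^sup>2" by simp
    have "?De + ennreal (s * (avg h s)\<^sup>2)
        = ennreal (\<integral>t. (h t - avg h t)\<^sup>2 * indicator {e..s} t \<partial>lborel) + ennreal (s * (avg h s)\<^sup>2)"
      by (subst fin(1)[OF cD]) auto
    also have "\<dots> = ennreal ((\<integral>t. (h t)\<^sup>2 * indicator {e..s} t \<partial>lborel) + e * (avg h e)\<^sup>2)"
      using s by (subst eq[symmetric], intro ennreal_plus[symmetric]) (auto intro!: integral_nonneg_AE)
    also have "\<dots> = (\<integral>\<^sup>+t. indicator {e..s} t * ennreal ((h t)\<^sup>2) \<partial>lborel) + ennreal (e * (avg h e)\<^sup>2)"
      using e by (subst fin(1)[OF ch], simp, intro ennreal_plus) (auto intro!: integral_nonneg_AE)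
    also have "\<dots> \<le> (\<integral>\<^sup>+t. indicator {e..s} t * ennreal ((h t)\<^sup>2) \<partial>lborel) +
        (\<integral>\<^sup>+t. indicator {0<..<e} t * ennreal ((h t)\<^sup>2) \<partial>lborel)"
      using e by (intro add_left_mono avg_square_le) auto
    also have "\<dots> = (\<integral>\<^sup>+t. indicator {e..s} t * ennreal ((h t)\<^sup>2)
        + indicator {0<..<e} t * ennreal ((h t)\<^sup>2) \<partial>lborel)"
      by (intro nn_integral_add[symmetric]) measurable
    also have "\<dots> = ?I"
    proof (rule nn_integral_cong_AE)
      show "AE t in lborel. indicator {e..s} t * ennreal ((h t)\<^sup>2) + indicator {0<..<e} t * ennreal ((h t)\<^sup>2)
          = indicator {0<..<s} t * ennreal ((h t)\<^sup>2)"
        using AE_lborel_singleton[of s] by eventually_elim (use e in \<open>auto simp: indicator_def\<close>)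
    qed
    finally show ?thesis .
  qed
  have "?D \<le> (SUP n. \<integral>\<^sup>+t. indicator {s / real (Suc n)..s} t * ennreal ((h t - avg h t)\<^sup>2) \<partial>lborel)"
  proof -
    have inc: "incseq (\<lambda>n t. indicator {s / real (Suc n)..s} t * ennreal ((h t - avg h t)\<^sup>2))"
    proof (intro incseq_SucI le_funI mult_right_mono)
      fix n t
      have "s / real (Suc (Suc n)) \<le> s / real (Suc n)" using s by (intro divide_left_mono) auto
      then show "indicator {s / real (Suc n)..s} t \<le> (indicator {s / real (Suc (Suc n))..s} t :: ennreal)"
        by (auto simp: indicator_def)
    qed simp
    have "?D \<le> (\<integral>\<^sup>+t. (SUP n. indicator {s / real (Suc n)..s} t * ennreal ((h t - avg h t)\<^sup>2)) \<partial>lborel)"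
    proof (intro nn_integral_mono)
      fix t
      show "indicator {0<..<s} t * ennreal ((h t - avg h t)\<^sup>2)
          \<le> (SUP n. indicator {s / real (Suc n)..s} t * ennreal ((h t - avg h t)\<^sup>2))"
      proof (cases "0 < t \<and> t < s")
        case True
        then obtain n where "inverse (real (Suc n)) < t / s"
          using reals_Archimedean[of "t / s"] s by auto
        then have "s / real (Suc n) \<le> t" using s by (simp add: field_simps)
        then show ?thesis using True by (intro SUP_upper2[of n]) auto
      qed auto
    qed
    also have "\<dots> = (SUP n. \<integral>\<^sup>+t. indicator {s / real (Suc n)..s} t * ennreal ((h t - avg h t)\<^sup>2) \<partial>lborel)"
      using inc by (intro nn_integral_monotone_convergence_SUP) measurable
    finally show ?thesis .
  qed
  then have "?D + ennreal (s * (avg h s)\<^sup>2) \<le>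
      (SUP n. \<integral>\<^sup>+t. indicator {s / real (Suc n)..s} t * ennreal ((h t - avg h t)\<^sup>2) \<partial>lborel) + ennreal (s * (avg h s)\<^sup>2)"
    by (rule add_right_mono)
  also have "\<dots> = (SUP n. (\<integral>\<^sup>+t. indicator {s / real (Suc n)..s} t * ennreal ((h t - avg h t)\<^sup>2) \<partial>lborel)
      + ennreal (s * (avg h s)\<^sup>2))"
    by (rule ennreal_SUP_add_left[symmetric]) simp
  also have "\<dots> \<le> ?I"
    using s by (intro SUP_least step) (auto simp: field_simps)
  finally show ?thesis .
qed

lemma avg_rescale:
  assumes "0 < s"
  shows "avg h s = (\<integral>u. indicator {0<..<1} u * h (u * s) \<partial>lborel)"
    and "integrable lborel (\<lambda>t. indicator {0<..<s} t * h t) \<longleftrightarrow>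
      integrable lborel (\<lambda>u. indicator {0<..<1} u * h (u * s))"
proof -
  have eq: "indicator {0<..<s} (0 + s * u) * h (0 + s * u) = indicator {0<..<1} u * h (u * s)" for u
    using assms by (auto simp: indicator_def mult.commute zero_less_mult_iff mult_less_cancel_left2)
  show "avg h s = (\<integral>u. indicator {0<..<1} u * h (u * s) \<partial>lborel)"
    using assms unfolding avg_def
    by (subst lborel_integral_real_affine[where c = s and t = 0]) (simp_all only: eq real_scaleR_def, simp)
  show "integrable lborel (\<lambda>t. indicator {0<..<s} t * h t) \<longleftrightarrow>
      integrable lborel (\<lambda>u. indicator {0<..<1} u * h (u * s))"
    using assms lborel_integrable_real_affine_iff[of s "\<lambda>t. indicator {0<..<s} t * h t" 0]
    by (simp only: eq)
qed

lemma avg_bounded: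
  assumes "\<And>t. \<bar>h t\<bar> \<le> K" "0 < s"
  shows "\<bar>avg h s\<bar> \<le> K"
proof -
  have "norm (\<integral>t. indicator {0<..<s} t * h t \<partial>lborel) \<le> (\<integral>t. indicator {0<..<s} t * K \<partial>lborel)"
  proof (cases "integrable lborel (\<lambda>t. indicator {0<..<s} t * h t)")
    case True
    have "norm (\<integral>t. indicator {0<..<s} t * h t \<partial>lborel) \<le> (\<integral>t. norm (indicator {0<..<s} t * h t) \<partial>lborel)"
      by (rule integral_norm_bound)
    also have "\<dots> \<le> (\<integral>t. indicator {0<..<s} t * K \<partial>lborel)"
    proof (rule integral_mono)
      show "integrable lborel (\<lambda>t. indicator {0<..<s} t * K)"
        using assms(2) by (intro integrable_mult_left integrable_real_indicator) auto
    qed (use True assms in \<open>auto simp: indicator_def intro!: integrable_norm\<close>)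
    finally show ?thesis .
  next
    case False
    have "0 \<le> K" using assms(1)[of 0] by simp
    then show ?thesis using False by (auto simp: not_integrable_integral_eq intro!: integral_nonneg_AE)
  qed
  then show ?thesis
    using assms(2) by (simp add: avg_def abs_divide pos_divide_le_eq mult.commute)
qed

lemma bounded_integrable_Ioo:
  assumes [measurable]: "h \<in> borel_measurable borel" and "\<And>t. \<bar>h t\<bar> \<le> (K::real)" "0 < (s::real)"
  shows "integrable lborel (\<lambda>t. indicator {0<..<s} t * h t)"
proof (rule Bochner_Integration.integrable_bound)
  show "integrable lborel (\<lambda>t. indicator {0<..<s} t * K)"
    using assms(3) by (intro integrable_mult_left integrable_real_indicator) auto
  show "AE t in lborel. norm (indicator {0<..<s} t * h t) \<le> norm (indicator {0<..<s} t * K)"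
    using assms(2) by (intro AE_I2) (auto simp: indicator_def intro: order_trans[OF _ abs_ge_self])
qed measurable

section \<open>A random variable and a uniform height below it\<close>

text \<open>
The joint law of \<open>(x, t)\<close>, with \<open>x\<close> from \<open>M\<close> and \<open>t\<close> uniform on \<open>(0, S x)\<close>, is never formed as a measure:
the lemmas \<open>joint_law\<close> and \<open>joint_law_real\<close> compute its integrals in both orders.
\<close>

locale slice_pair = prob_space M for M :: "'a measure" +
  fixes S :: "'a \<Rightarrow> real"
  assumes S_measurable [measurable]: "S \<in> borel_measurable M"
    and S_pos: "AE x in M. 0 < S x"
begin

text \<open>
The density of the height \<open>t\<close>. At \<open>t \<le> 0\<close> its value has no meaning, because \<open>1 / S\<close> need not be
integrable; integrals of \<open>height_pdf\<close> therefore carry the indicator of \<open>{0<..}\<close>.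
\<close>

definition height_pdf :: "real \<Rightarrow> real" where
  "height_pdf t = (\<integral>x. indicator {t<..} (S x) / S x \<partial>M)"

lemma height_pdf_measurable [measurable]: "height_pdf \<in> borel_measurable borel"
proof -
  have "(\<lambda>t. \<integral>x. (if t < S x then 1 else 0) / S x \<partial>M) \<in> borel_measurable borel"
    by measurable
  then show ?thesis
    by (simp add: height_pdf_def[abs_def] indicator_def of_bool_def)
qed

lemma height_pdf_nonneg: "0 \<le> height_pdf t"
  unfolding height_pdf_def using S_pos by (intro integral_nonneg_AE) (auto elim!: eventually_mono)

lemma integrable_height_pdf:
  assumes "0 < t"
  shows "integrable M (\<lambda>x. indicator {t<..} (S x) / S x)"
  using assms by (intro integrable_const_bound[where B = "1 / t"])
    (auto intro!: AE_I2 simp: indicator_def frac_le)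

lemma ennreal_height_pdf:
  assumes "0 < t"
  shows "ennreal (height_pdf t) = (\<integral>\<^sup>+x. indicator {t<..} (S x) * ennreal (1 / S x) \<partial>M)"
proof -
  have "ennreal (height_pdf t) = (\<integral>\<^sup>+x. ennreal (indicator {t<..} (S x) / S x) \<partial>M)"
    unfolding height_pdf_def using S_pos
    by (intro nn_integral_eq_integral[symmetric] integrable_height_pdf assms) (auto elim!: eventually_mono)
  also have "\<dots> = (\<integral>\<^sup>+x. indicator {t<..} (S x) * ennreal (1 / S x) \<partial>M)"
    by (intro nn_integral_cong) (auto simp: indicator_def)
  finally show ?thesis .
qed

lemma height_pdf_le: "0 < t \<Longrightarrow> height_pdf t \<le> 1 / t"
proof -
  assume t: "0 < t"
  have "height_pdf t \<le> (\<integral>x. 1 / t \<partial>M)"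
    unfolding height_pdf_def using t
    by (intro integral_mono integrable_height_pdf) (auto simp: indicator_def frac_le)
  then show ?thesis by (simp add: prob_space)
qed

lemma height_pdf_antimono:
  assumes "0 < s" "s \<le> t" shows "height_pdf t \<le> height_pdf s"
  unfolding height_pdf_def using assms S_pos
  by (intro integral_mono_AE integrable_height_pdf) (auto elim!: eventually_mono simp: indicator_def)

lemma height_pdf_diff:
  assumes "0 < s" "s \<le> t"
  shows "ennreal (height_pdf s - height_pdf t) = (\<integral>\<^sup>+x. indicator {s<..t} (S x) * ennreal (1 / S x) \<partial>M)"
proof -
  have "height_pdf s - height_pdf t = (\<integral>x. indicator {s<..} (S x) / S x - indicator {t<..} (S x) / S x \<partial>M)"
    unfolding height_pdf_def using integrable_height_pdf[of s] integrable_height_pdf[of t] assms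
    by (simp only: Bochner_Integration.integral_diff)
  also have "\<dots> = (\<integral>x. indicator {s<..t} (S x) / S x \<partial>M)"
    using assms by (intro Bochner_Integration.integral_cong) (auto simp: indicator_def)
  finally have "height_pdf s - height_pdf t = (\<integral>x. indicator {s<..t} (S x) / S x \<partial>M)" .
  moreover have "integrable M (\<lambda>x. indicator {s<..t} (S x) / S x)"
    using assms by (intro integrable_const_bound[where B = "1 / s"])
      (auto intro!: AE_I2 simp: indicator_def frac_le)
  ultimately have "ennreal (height_pdf s - height_pdf t) = (\<integral>\<^sup>+x. ennreal (indicator {s<..t} (S x) / S x) \<partial>M)"
    using S_pos by (simp add: nn_integral_eq_integral eventually_mono)
  also have "\<dots> = (\<integral>\<^sup>+x. indicator {s<..t} (S x) * ennreal (1 / S x) \<partial>M)"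
    by (intro nn_integral_cong) (auto simp: indicator_def)
  finally show ?thesis .
qed

text \<open>
Tonelli's theorem: on the left \<open>x\<close> is drawn first and then the height, on the right the height first.
\<close>

lemma joint_law:
  assumes [measurable]: "case_prod \<phi> \<in> borel_measurable (M \<Otimes>\<^sub>M borel)"
  shows "(\<integral>\<^sup>+x. (\<integral>\<^sup>+t. indicator {0<..<S x} t * \<phi> x t \<partial>lborel) * ennreal (1 / S x) \<partial>M) =
    (\<integral>\<^sup>+t. indicator {0<..} t * (\<integral>\<^sup>+x. indicator {t<..} (S x) * \<phi> x t * ennreal (1 / S x) \<partial>M) \<partial>lborel)"
proof -
  interpret P: pair_sigma_finite M lborel ..
  have m: "(\<lambda>(x,t). indicator {0<..<S x} t * \<phi> x t * ennreal (1 / S x)) \<in> borel_measurable (M \<Otimes>\<^sub>M lborel)"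
  proof -
    have "(\<lambda>(x,t). (if 0 < t \<and> t < S x then 1 else 0) * \<phi> x t * ennreal (1 / S x))
        \<in> borel_measurable (M \<Otimes>\<^sub>M borel)"
      by measurable
    then show ?thesis by (simp add: indicator_def of_bool_def)
  qed
  have "(\<integral>\<^sup>+x. (\<integral>\<^sup>+t. indicator {0<..<S x} t * \<phi> x t \<partial>lborel) * ennreal (1 / S x) \<partial>M) =
    (\<integral>\<^sup>+x. (\<integral>\<^sup>+t. indicator {0<..<S x} t * \<phi> x t * ennreal (1 / S x) \<partial>lborel) \<partial>M)"
    by (intro nn_integral_cong nn_integral_multc[symmetric]) measurable
  also have "\<dots> = (\<integral>\<^sup>+t. (\<integral>\<^sup>+x. indicator {0<..<S x} t * \<phi> x t * ennreal (1 / S x) \<partial>M) \<partial>lborel)"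
    using P.Fubini'[OF m] by simp
  also have "\<dots> = (\<integral>\<^sup>+t. indicator {0<..} t
      * (\<integral>\<^sup>+x. indicator {t<..} (S x) * \<phi> x t * ennreal (1 / S x) \<partial>M) \<partial>lborel)"
    by (intro nn_integral_cong) (auto simp: indicator_def intro!: nn_integral_cong)
  finally show ?thesis .
qed

lemma joint_law_real:
  fixes \<phi> :: "'a \<Rightarrow> real \<Rightarrow> real"
  assumes [measurable]: "case_prod \<phi> \<in> borel_measurable (M \<Otimes>\<^sub>M borel)"
    and fin: "(\<integral>\<^sup>+x. (\<integral>\<^sup>+t. indicator {0<..<S x} t * ennreal \<bar>\<phi> x t\<bar> \<partial>lborel) * ennreal (1 / S x) \<partial>M) < \<infinity>"
  shows "(\<integral>x. (\<integral>t. indicator {0<..<S x} t * \<phi> x t \<partial>lborel) / S x \<partial>M) =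
    (\<integral>t. indicator {0<..} t * (\<integral>x. indicator {t<..} (S x) * \<phi> x t / S x \<partial>M) \<partial>lborel)"
proof -
  interpret P: pair_sigma_finite M lborel ..
  define f where "f = (\<lambda>x t. indicator {0<..<S x} t * \<phi> x t / S x)"
  have f_eq: "f x t = (if 0 < t \<and> t < S x then \<phi> x t / S x else 0)" for x t
    by (simp add: f_def indicator_def)
  have m: "case_prod f \<in> borel_measurable (M \<Otimes>\<^sub>M lborel)"
  proof -
    have "(\<lambda>(x, t). if 0 < t \<and> t < S x then \<phi> x t / S x else 0) \<in> borel_measurable (M \<Otimes>\<^sub>M borel)"
      by measurable
    then show ?thesis by (simp add: f_eq[abs_def])
  qed
  have "(\<integral>\<^sup>+z. ennreal (norm (case_prod f z)) \<partial>(M \<Otimes>\<^sub>M lborel)) = (\<integral>\<^sup>+x. \<integral>\<^sup>+t. ennreal \<bar>f x t\<bar> \<partial>lborel \<partial>M)"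
    using m by (subst lborel.nn_integral_fst[symmetric]) (auto simp: split_beta')
  also have "\<dots> = (\<integral>\<^sup>+x. (\<integral>\<^sup>+t. indicator {0<..<S x} t * ennreal \<bar>\<phi> x t\<bar> \<partial>lborel) * ennreal (1 / S x) \<partial>M)"
  proof (intro nn_integral_cong)
    fix x assume [simp]: "x \<in> space M"
    have "(\<integral>\<^sup>+t. ennreal \<bar>f x t\<bar> \<partial>lborel)
        = (\<integral>\<^sup>+t. indicator {0<..<S x} t * ennreal \<bar>\<phi> x t\<bar> * ennreal (1 / S x) \<partial>lborel)"
      by (intro nn_integral_cong) (auto simp: f_eq indicator_def ennreal_mult[symmetric])
    then show "(\<integral>\<^sup>+t. ennreal \<bar>f x t\<bar> \<partial>lborel)
        = (\<integral>\<^sup>+t. indicator {0<..<S x} t * ennreal \<bar>\<phi> x t\<bar> \<partial>lborel) * ennreal (1 / S x)"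
      by (subst nn_integral_multc[symmetric]) auto
  qed
  finally have "integrable (M \<Otimes>\<^sub>M lborel) (case_prod f)"
    using m fin by (intro integrableI_bounded) auto
  then have "(\<integral>t. (\<integral>x. f x t \<partial>M) \<partial>lborel) = (\<integral>x. (\<integral>t. f x t \<partial>lborel) \<partial>M)"
    by (rule P.Fubini_integral)
  moreover have "(\<integral>x. f x t \<partial>M) = indicator {0<..} t * (\<integral>x. indicator {t<..} (S x) * \<phi> x t / S x \<partial>M)" for t
    by (cases "0 < t") (auto simp: f_eq indicator_def intro!: Bochner_Integration.integral_cong)
  moreover have "(\<integral>t. f x t \<partial>lborel) = (\<integral>t. indicator {0<..<S x} t * \<phi> x t \<partial>lborel) / S x" for x
    by (simp add: f_def)
  ultimately show ?thesis by simp
qed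

text \<open>
The indicator of \<open>S x > z\<close> turns the density at \<open>t\<close> into the one at \<open>max t z\<close>, since \<open>S x\<close> has to exceed both.
\<close>

lemma joint_law_height:
  assumes [measurable]: "\<phi> \<in> borel_measurable borel" and z: "0 \<le> z"
  shows "(\<integral>\<^sup>+x. indicator {z<..} (S x) * ((\<integral>\<^sup>+t. indicator {0<..<S x} t * \<phi> t \<partial>lborel) * ennreal (1 / S x)) \<partial>M) =
    (\<integral>\<^sup>+t. indicator {0<..} t * (\<phi> t * ennreal (height_pdf (max t z))) \<partial>lborel)"
proof -
  have "(\<integral>\<^sup>+x. indicator {z<..} (S x) * ((\<integral>\<^sup>+t. indicator {0<..<S x} t * \<phi> t \<partial>lborel) * ennreal (1 / S x)) \<partial>M) =
    (\<integral>\<^sup>+x. (\<integral>\<^sup>+t. indicator {0<..<S x} t * (indicator {z<..} (S x) * \<phi> t) \<partial>lborel) * ennreal (1 / S x) \<partial>M)"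
    by (intro nn_integral_cong) (auto simp: indicator_def)
  also have "\<dots> = (\<integral>\<^sup>+t. indicator {0<..} t
      * (\<integral>\<^sup>+x. indicator {t<..} (S x) * (indicator {z<..} (S x) * \<phi> t) * ennreal (1 / S x) \<partial>M) \<partial>lborel)"
    by (rule joint_law) measurable
  also have "\<dots> = (\<integral>\<^sup>+t. indicator {0<..} t * (\<phi> t * ennreal (height_pdf (max t z))) \<partial>lborel)"
  proof (rule nn_integral_cong)
    fix t :: real
    show "indicator {0<..} t * (\<integral>\<^sup>+x. indicator {t<..} (S x) * (indicator {z<..} (S x) * \<phi> t) * ennreal (1 / S x) \<partial>M)
      = indicator {0<..} t * (\<phi> t * ennreal (height_pdf (max t z)))"
    proof (cases "0 < t")
      case True
      then have "0 < max t z" by simp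
      then have "\<phi> t * ennreal (height_pdf (max t z))
          = (\<integral>\<^sup>+x. \<phi> t * (indicator {max t z<..} (S x) * ennreal (1 / S x)) \<partial>M)"
        by (subst nn_integral_cmult) (auto simp: ennreal_height_pdf)
      also have "\<dots> = (\<integral>\<^sup>+x. indicator {t<..} (S x) * (indicator {z<..} (S x) * \<phi> t) * ennreal (1 / S x) \<partial>M)"
        by (intro nn_integral_cong) (auto simp: indicator_def)
      finally show ?thesis by simp
    qed auto
  qed
  finally show ?thesis .
qed

lemma nn_integral_height_pdf: "(\<integral>\<^sup>+t. indicator {0<..} t * ennreal (height_pdf t) \<partial>lborel) = 1"
proof -
  have "(\<integral>\<^sup>+t. indicator {0<..} t * ennreal (height_pdf t) \<partial>lborel) =
     (\<integral>\<^sup>+t. indicator {0<..} t * (1 * ennreal (height_pdf (max t 0))) \<partial>lborel)"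
    by (intro nn_integral_cong) (auto simp: indicator_def max_def)
  also have "\<dots> = (\<integral>\<^sup>+x. indicator {0<..} (S x)
      * ((\<integral>\<^sup>+t. indicator {0<..<S x} t * 1 \<partial>lborel) * ennreal (1 / S x)) \<partial>M)"
    by (rule joint_law_height[symmetric]) auto
  also have "\<dots> = (\<integral>\<^sup>+x. 1 \<partial>M)"
    using S_pos by (intro nn_integral_cong_AE) (auto elim!: eventually_mono simp: ennreal_mult[symmetric])
  finally show ?thesis by (simp add: emeasure_space_1)
qed

lemma integrable_density: "integrable lborel (\<lambda>t. indicator {0<..} t * height_pdf t)"
  using nn_integral_height_pdf
  by (intro integrableI_nonneg) (auto simp: height_pdf_nonneg ennreal_mult ennreal_indicator)


definition height_law :: "real measure" where
  "height_law = density lborel (\<lambda>t. ennreal (indicator {0<..} t * height_pdf t))"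

lemma sets_height_law [measurable_cong, simp]: "sets height_law = sets borel"
  by (simp add: height_law_def)

lemma space_height_law [simp]: "space height_law = UNIV"
  by (simp add: height_law_def)

lemma nn_integral_height_law:
  assumes [measurable]: "f \<in> borel_measurable borel"
  shows "(\<integral>\<^sup>+t. f t \<partial>height_law) = (\<integral>\<^sup>+t. indicator {0<..} t * (f t * ennreal (height_pdf t)) \<partial>lborel)"
proof -
  have "(\<integral>\<^sup>+t. f t \<partial>height_law) = (\<integral>\<^sup>+t. ennreal (indicator {0<..} t * height_pdf t) * f t \<partial>lborel)"
    unfolding height_law_def by (rule nn_integral_density) measurable
  also have "\<dots> = (\<integral>\<^sup>+t. indicator {0<..} t * (f t * ennreal (height_pdf t)) \<partial>lborel)"
    by (intro nn_integral_cong) (auto simp: indicator_def mult.commute)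
  finally show ?thesis .
qed

lemma integral_height_law:
  fixes f :: "real \<Rightarrow> real"
  assumes [measurable]: "f \<in> borel_measurable borel"
  shows "(\<integral>t. f t \<partial>height_law) = (\<integral>t. indicator {0<..} t * (f t * height_pdf t) \<partial>lborel)"
proof -
  have "(\<integral>t. f t \<partial>height_law) = (\<integral>t. (indicator {0<..} t * height_pdf t) *\<^sub>R f t \<partial>lborel)"
    unfolding height_law_def using height_pdf_nonneg by (intro integral_density) auto
  then show ?thesis by (simp add: ac_simps)
qed

lemma prob_space_height_law: "prob_space height_law"
proof (rule prob_spaceI)
  have "emeasure height_law (space height_law) = (\<integral>\<^sup>+t. 1 \<partial>height_law)" by simp
  also have "\<dots> = 1"
    by (subst nn_integral_height_law) (simp_all add: nn_integral_height_pdf)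
  finally show "emeasure height_law (space height_law) = 1" .
qed

lemma measurable_segment_integral [measurable]:
  assumes [measurable]: "\<phi> \<in> borel_measurable borel"
  shows "(\<lambda>x. \<integral>\<^sup>+t. indicator {0<..<S x} t * (\<phi> t :: ennreal) \<partial>lborel) \<in> borel_measurable M"
proof -
  have "(\<lambda>x. \<integral>\<^sup>+t. (if 0 < t \<and> t < S x then 1 else 0) * \<phi> t \<partial>lborel) \<in> borel_measurable M"
    by measurable
  then show ?thesis by (simp add: indicator_def of_bool_def)
qed

lemma joint_law_height_law:
  assumes [measurable]: "\<phi> \<in> borel_measurable borel"
  shows "(\<integral>\<^sup>+x. (\<integral>\<^sup>+t. indicator {0<..<S x} t * \<phi> t \<partial>lborel) * ennreal (1 / S x) \<partial>M) = (\<integral>\<^sup>+t. \<phi> t \<partial>height_law)"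
proof -
  have "(\<integral>\<^sup>+x. (\<integral>\<^sup>+t. indicator {0<..<S x} t * \<phi> t \<partial>lborel) * ennreal (1 / S x) \<partial>M) =
    (\<integral>\<^sup>+x. indicator {0<..} (S x) * ((\<integral>\<^sup>+t. indicator {0<..<S x} t * \<phi> t \<partial>lborel) * ennreal (1 / S x)) \<partial>M)"
    using S_pos by (intro nn_integral_cong_AE) (auto elim!: eventually_mono)
  also have "\<dots> = (\<integral>\<^sup>+t. \<phi> t \<partial>height_law)"
    by (subst joint_law_height) (auto simp: nn_integral_height_law indicator_def max_def intro!: nn_integral_cong)
  finally show ?thesis .
qed

lemma AE_finite_average:
  assumes [measurable]: "h \<in> borel_measurable borel" and "integrable height_law h"
  shows "AE x in M. integrable lborel (\<lambda>t. indicator {0<..<S x} t * (h t :: real))"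
proof -
  have "(\<integral>\<^sup>+x. (\<integral>\<^sup>+t. indicator {0<..<S x} t * ennreal \<bar>h t\<bar> \<partial>lborel) * ennreal (1 / S x) \<partial>M) < \<infinity>"
    using assms by (subst joint_law_height_law) (auto simp: integrable_iff_bounded)
  then have "AE x in M. (\<integral>\<^sup>+t. indicator {0<..<S x} t * ennreal \<bar>h t\<bar> \<partial>lborel) * ennreal (1 / S x) \<noteq> \<infinity>"
    by (intro nn_integral_PInf_AE) auto
  with S_pos show ?thesis
  proof eventually_elim
    case (elim x)
    then have "(\<integral>\<^sup>+t. indicator {0<..<S x} t * ennreal \<bar>h t\<bar> \<partial>lborel) < \<infinity>"
      by (auto simp: ennreal_mult_eq_top_iff less_top)
    also have "(\<integral>\<^sup>+t. indicator {0<..<S x} t * ennreal \<bar>h t\<bar> \<partial>lborel)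
        = (\<integral>\<^sup>+t. ennreal (norm (indicator {0<..<S x} t * h t)) \<partial>lborel)"
      by (intro nn_integral_cong) (auto simp: indicator_def)
    finally show ?case by (intro integrableI_bounded) auto
  qed
qed

lemma mean_avg:
  assumes [measurable]: "h \<in> borel_measurable borel" and "integrable height_law h"
  shows "(\<integral>x. avg h (S x) \<partial>M) = (\<integral>t. h t \<partial>height_law)"
proof -
  have "(\<integral>x. avg h (S x) \<partial>M) = (\<integral>t. indicator {0<..} t * (\<integral>x. indicator {t<..} (S x) * h t / S x \<partial>M) \<partial>lborel)"
    unfolding avg_def
  proof (rule joint_law_real)
    show "(\<integral>\<^sup>+x. (\<integral>\<^sup>+t. indicator {0<..<S x} t * ennreal \<bar>h t\<bar> \<partial>lborel) * ennreal (1 / S x) \<partial>M) < \<infinity>"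
      using assms by (subst joint_law_height_law) (auto simp: integrable_iff_bounded)
  qed measurable
  also have "\<dots> = (\<integral>t. indicator {0<..} t * (h t * height_pdf t) \<partial>lborel)"
  proof (intro Bochner_Integration.integral_cong refl)
    fix t :: real
    have "(\<integral>x. indicator {t<..} (S x) * h t / S x \<partial>M) = (\<integral>x. h t * (indicator {t<..} (S x) / S x) \<partial>M)"
      by (rule Bochner_Integration.integral_cong) auto
    also have "\<dots> = h t * height_pdf t"
      unfolding height_pdf_def by (rule integral_mult_right_zero)
    finally show "indicator {0<..} t * (\<integral>x. indicator {t<..} (S x) * h t / S x \<partial>M)
        = indicator {0<..} t * (h t * height_pdf t)"
      by simp
  qed
  finally show ?thesis by (simp add: integral_height_law)
qed

text \<open>
The variance as half the mean squared difference of two independent copies; restricting to \<open>S y < S x\<close>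
halves the symmetric double integral, as pairs with \<open>S x = S y\<close> contribute nothing.
\<close>

lemma nn_integral_pairs_diff_square:
  fixes f :: "'a \<Rightarrow> real"
  assumes [measurable]: "f \<in> borel_measurable M" and bound: "AE x in M. \<bar>f x\<bar> \<le> K"
    and eq: "\<And>x y. S x = S y \<Longrightarrow> f x = f y"
  shows "ennreal ((\<integral>x. (f x)\<^sup>2 \<partial>M) - (\<integral>x. f x \<partial>M)\<^sup>2) =
    (\<integral>\<^sup>+x. \<integral>\<^sup>+y. (if S y < S x then ennreal ((f x - f y)\<^sup>2) else 0) \<partial>M \<partial>M)"
proof -
  interpret P: pair_sigma_finite M M ..
  define V where "V = (\<integral>\<^sup>+x. \<integral>\<^sup>+y. (if S y < S x then ennreal ((f x - f y)\<^sup>2) else 0) \<partial>M \<partial>M)"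
  define m where "m = (\<integral>x. f x \<partial>M)"
  define q where "q = (\<integral>x. (f x)\<^sup>2 \<partial>M)"
  have i: "integrable M f"
    using bound by (intro integrable_const_bound[where B = K]) auto
  have i2: "integrable M (\<lambda>x. (f x)\<^sup>2)"
  proof (rule integrable_const_bound[where B = "K\<^sup>2"])
    show "AE x in M. norm ((f x)\<^sup>2) \<le> K\<^sup>2"
      using bound by eventually_elim (simp add: abs_le_square_iff[symmetric])
  qed simp
  have inner: "(\<integral>\<^sup>+y. ennreal ((f x - f y)\<^sup>2) \<partial>M) = ennreal ((f x)\<^sup>2 - 2 * m * f x + q)" for x
  proof -
    have *: "(f x - f y)\<^sup>2 = (f x)\<^sup>2 - 2 * f x * f y + (f y)\<^sup>2" for y by (simp add: power2_diff)
    have "(\<integral>\<^sup>+y. ennreal ((f x - f y)\<^sup>2) \<partial>M) = ennreal (\<integral>y. (f x)\<^sup>2 - 2 * f x * f y + (f y)\<^sup>2 \<partial>M)"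
      unfolding *
    proof (rule nn_integral_eq_integral)
      show "AE y in M. 0 \<le> (f x)\<^sup>2 - 2 * f x * f y + (f y)\<^sup>2"
        unfolding *[symmetric] by simp
    qed (use i i2 in auto)
    also have "(\<integral>y. (f x)\<^sup>2 - 2 * f x * f y + (f y)\<^sup>2 \<partial>M) = (f x)\<^sup>2 - 2 * f x * m + q"
      using i i2 by (simp add: m_def q_def prob_space)
    finally show ?thesis by (simp add: ac_simps)
  qed
  have "(\<integral>\<^sup>+x. \<integral>\<^sup>+y. ennreal ((f x - f y)\<^sup>2) \<partial>M \<partial>M) = ennreal (\<integral>x. (f x)\<^sup>2 - 2 * m * f x + q \<partial>M)"
    unfolding inner
  proof (rule nn_integral_eq_integral)
    have "0 \<le> (f x - m)\<^sup>2 + (q - m\<^sup>2)" for x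
    proof -
      have "m\<^sup>2 \<le> q"
        using i i2 unfolding m_def q_def
        using variance_positive[of f] variance_eq[OF i i2] by simp
      then show ?thesis by simp
    qed
    then show "AE x in M. 0 \<le> (f x)\<^sup>2 - 2 * m * f x + q"
      by (simp add: power2_diff algebra_simps)
  qed (use i i2 in auto)
  also have "(\<integral>x. (f x)\<^sup>2 - 2 * m * f x + q \<partial>M) = 2 * (q - m\<^sup>2)"
  proof -
    have "(\<integral>x. (f x)\<^sup>2 - 2 * m * f x + q \<partial>M) = q - 2 * m * m + q"
      using i i2 by (simp add: m_def[symmetric] q_def[symmetric] prob_space)
    then show ?thesis by (simp add: power2_eq_square)
  qed
  finally have all: "(\<integral>\<^sup>+x. \<integral>\<^sup>+y. ennreal ((f x - f y)\<^sup>2) \<partial>M \<partial>M) = ennreal (2 * (q - m\<^sup>2))" .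
  have "(\<integral>\<^sup>+x. \<integral>\<^sup>+y. ennreal ((f x - f y)\<^sup>2) \<partial>M \<partial>M) =
    (\<integral>\<^sup>+x. (\<integral>\<^sup>+y. (if S y < S x then ennreal ((f x - f y)\<^sup>2) else 0) \<partial>M) +
        (\<integral>\<^sup>+y. (if S x < S y then ennreal ((f y - f x)\<^sup>2) else 0) \<partial>M) \<partial>M)"
  proof (rule nn_integral_cong)
    fix x assume [simp]: "x \<in> space M"
    have "(\<integral>\<^sup>+y. ennreal ((f x - f y)\<^sup>2) \<partial>M) =
      (\<integral>\<^sup>+y. (if S y < S x then ennreal ((f x - f y)\<^sup>2) else 0) + (if S x < S y then ennreal ((f y - f x)\<^sup>2) else 0) \<partial>M)"
    proof (rule nn_integral_cong)
      fix y
      show "ennreal ((f x - f y)\<^sup>2)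
          = (if S y < S x then ennreal ((f x - f y)\<^sup>2) else 0)
          + (if S x < S y then ennreal ((f y - f x)\<^sup>2) else 0)"
        using eq[of x y] by (cases "S x" "S y" rule: linorder_cases) (auto simp: power2_commute)
    qed
    also have "\<dots> = (\<integral>\<^sup>+y. (if S y < S x then ennreal ((f x - f y)\<^sup>2) else 0) \<partial>M) +
        (\<integral>\<^sup>+y. (if S x < S y then ennreal ((f y - f x)\<^sup>2) else 0) \<partial>M)"
      by (rule nn_integral_add) measurable
    finally show "(\<integral>\<^sup>+y. ennreal ((f x - f y)\<^sup>2) \<partial>M) = \<dots>" .
  qed
  also have "\<dots> = V + (\<integral>\<^sup>+x. \<integral>\<^sup>+y. (if S x < S y then ennreal ((f y - f x)\<^sup>2) else 0) \<partial>M \<partial>M)"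
    unfolding V_def by (rule nn_integral_add) measurable
  also have "(\<integral>\<^sup>+x. \<integral>\<^sup>+y. (if S x < S y then ennreal ((f y - f x)\<^sup>2) else 0) \<partial>M \<partial>M) = V"
  proof -
    have "(\<lambda>(x, y). (if S x < S y then ennreal ((f y - f x)\<^sup>2) else 0)) \<in> borel_measurable (M \<Otimes>\<^sub>M M)"
      by measurable
    from P.Fubini'[OF this] show ?thesis by (simp add: V_def)
  qed
  finally have VV: "ennreal (2 * (q - m\<^sup>2)) = V + V" unfolding all .
  then have "V \<noteq> top" by auto
  then obtain v where v: "V = ennreal v" "0 \<le> v" by (metis ennreal_cases)
  then have "2 * v = 2 * (q - m\<^sup>2) \<or> (v = 0 \<and> q - m\<^sup>2 \<le> 0)"
    using VV by (cases "0 \<le> q - m\<^sup>2") (auto simp: ennreal_plus[symmetric] ennreal_neg simp del: ennreal_plus)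
  then have "ennreal (q - m\<^sup>2) = V"
    using v by (auto simp: ennreal_neg)
  then show ?thesis by (simp add: V_def m_def q_def)
qed

text \<open>
The conditional expectation of \<open>g\<close> given the height \<open>t\<close>, for which \<open>x\<close> has the density proportional to
\<open>1{S x > t} / S x\<close> with respect to \<open>M\<close>.
\<close>

definition cond_mean :: "('a \<Rightarrow> real) \<Rightarrow> real \<Rightarrow> real" where
  "cond_mean g t = (\<integral>x. indicator {t<..} (S x) * g x / S x \<partial>M) / height_pdf t"

lemma cond_mean_measurable [measurable]:
  assumes [measurable]: "g \<in> borel_measurable M"
  shows "cond_mean g \<in> borel_measurable borel"
proof -
  have "(\<lambda>t. (\<integral>x. (if t < S x then 1 else 0) * g x / S x \<partial>M) / height_pdf t) \<in> borel_measurable borel"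
    by measurable
  then show ?thesis
    by (simp add: cond_mean_def[abs_def] indicator_def of_bool_def)
qed

lemma height_pdf_eq_0_imp_AE:
  assumes "0 < t" "height_pdf t = 0"
  shows "AE x in M. S x \<le> t"
proof -
  have "(\<integral>\<^sup>+x. indicator {t<..} (S x) * ennreal (1 / S x) \<partial>M) = 0"
    using ennreal_height_pdf[OF assms(1)] assms(2) by simp
  then have "AE x in M. indicator {t<..} (S x) * ennreal (1 / S x) = 0"
    by (subst (asm) nn_integral_0_iff_AE) auto
  then show ?thesis
    using S_pos by eventually_elim (auto simp: indicator_def ennreal_eq_0_iff split: if_splits)
qed

lemma cond_mean_times_height_pdf:
  assumes "0 < t" and [measurable]: "g \<in> borel_measurable M"
  shows "cond_mean g t * height_pdf t = (\<integral>x. indicator {t<..} (S x) * g x / S x \<partial>M)"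
proof (cases "height_pdf t = 0")
  case True
  have "(\<integral>x. indicator {t<..} (S x) * g x / S x \<partial>M) = (\<integral>x. 0 \<partial>M)"
  proof (rule integral_cong_AE)
    show "AE x in M. indicator {t<..} (S x) * g x / S x = 0"
      using height_pdf_eq_0_imp_AE[OF assms(1) True] by eventually_elim simp
  qed auto
  then show ?thesis using True by simp
qed (simp add: cond_mean_def)

lemma cond_mean_square_le:
  assumes "0 < t" and [measurable]: "g \<in> borel_measurable M"
  shows "ennreal ((cond_mean g t)\<^sup>2) * ennreal (height_pdf t)
      \<le> (\<integral>\<^sup>+x. indicator {t<..} (S x) * ennreal ((g x)\<^sup>2) * ennreal (1 / S x) \<partial>M)"
    (is "_ \<le> ?R")
proof (cases "height_pdf t = 0")
  case False
  then have pt: "0 < height_pdf t" using height_pdf_nonneg[of t] by simp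
  let ?i = "\<lambda>x. indicator {t<..} (S x) * ennreal (sqrt (1 / S x))"
  have "ennreal \<bar>\<integral>x. indicator {t<..} (S x) * g x / S x \<partial>M\<bar>
      \<le> (\<integral>\<^sup>+x. ennreal (norm (indicator {t<..} (S x) * g x / S x)) \<partial>M)"
    using integral_norm_bound_ennreal[of M "\<lambda>x. indicator {t<..} (S x) * g x / S x"]
    by (cases "integrable M (\<lambda>x. indicator {t<..} (S x) * g x / S x)") (auto simp: not_integrable_integral_eq)
  also have "\<dots> = (\<integral>\<^sup>+x. ?i x * (?i x * ennreal \<bar>g x\<bar>) \<partial>M)"
  proof (intro nn_integral_cong)
    fix x
    have "ennreal (\<bar>g x\<bar> / S x)
        = ennreal (sqrt (1 / S x)) * (ennreal (sqrt (1 / S x)) * ennreal \<bar>g x\<bar>)" if "t < S x"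
    proof -
      have "sqrt (1 / S x) * (sqrt (1 / S x) * \<bar>g x\<bar>) = \<bar>g x\<bar> / S x"
        using that assms(1) by (simp flip: mult.assoc)
      then show ?thesis using that assms(1) by (simp add: ennreal_mult[symmetric])
    qed
    then show "ennreal (norm (indicator {t<..} (S x) * g x / S x)) = ?i x * (?i x * ennreal \<bar>g x\<bar>)"
      using assms(1) by (auto simp: indicator_def)
  qed
  finally have "(ennreal \<bar>\<integral>x. indicator {t<..} (S x) * g x / S x \<partial>M\<bar>)\<^sup>2
      \<le> (\<integral>\<^sup>+x. ?i x * (?i x * ennreal \<bar>g x\<bar>) \<partial>M)\<^sup>2"
    by (rule power_mono) simp
  also have "\<dots> \<le> (\<integral>\<^sup>+x. (?i x)\<^sup>2 \<partial>M) * (\<integral>\<^sup>+x. (?i x * ennreal \<bar>g x\<bar>)\<^sup>2 \<partial>M)"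
    by (rule Cauchy_Schwarz_nn_integral) measurable
  also have "(\<integral>\<^sup>+x. (?i x)\<^sup>2 \<partial>M) = ennreal (height_pdf t)"
    unfolding ennreal_height_pdf[OF assms(1)]
    using assms(1) by (intro nn_integral_cong) (auto simp: indicator_def ennreal_power real_sqrt_pow2)
  also have "(\<integral>\<^sup>+x. (?i x * ennreal \<bar>g x\<bar>)\<^sup>2 \<partial>M) = ?R"
    using assms(1) by (intro nn_integral_cong)
      (auto simp: indicator_def ennreal_mult[symmetric] ennreal_power power_mult_distrib real_sqrt_pow2 mult.commute)
  finally have le: "ennreal ((\<integral>x. indicator {t<..} (S x) * g x / S x \<partial>M)\<^sup>2) \<le> ennreal (height_pdf t) * ?R"
    by (simp add: ennreal_power)
  have "ennreal (height_pdf t) * (ennreal ((cond_mean g t)\<^sup>2) * ennreal (height_pdf t))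
      = ennreal ((\<integral>x. indicator {t<..} (S x) * g x / S x \<partial>M)\<^sup>2)"
    using pt unfolding cond_mean_times_height_pdf[OF assms, symmetric]
    by (simp add: ennreal_mult[symmetric] power2_eq_square ac_simps)
  with le have "ennreal (height_pdf t) * (ennreal ((cond_mean g t)\<^sup>2) * ennreal (height_pdf t))
      \<le> ennreal (height_pdf t) * ?R"
    by simp
  then show ?thesis using pt by (subst (asm) ennreal_mult_le_mult_iff) auto
qed simp

lemma cond_mean_contracts:
  assumes [measurable]: "g \<in> borel_measurable M"
  shows "(\<integral>\<^sup>+t. ennreal ((cond_mean g t)\<^sup>2) \<partial>height_law) \<le> (\<integral>\<^sup>+x. ennreal ((g x)\<^sup>2) \<partial>M)"
proof -
  have "(\<integral>\<^sup>+t. ennreal ((cond_mean g t)\<^sup>2) \<partial>height_law) \<le>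
    (\<integral>\<^sup>+t. indicator {0<..} t * (\<integral>\<^sup>+x. indicator {t<..} (S x) * ennreal ((g x)\<^sup>2) * ennreal (1 / S x) \<partial>M) \<partial>lborel)"
  proof (subst nn_integral_height_law)
    show "(\<integral>\<^sup>+t. indicator {0<..} t * (ennreal ((cond_mean g t)\<^sup>2) * ennreal (height_pdf t)) \<partial>lborel) \<le>
      (\<integral>\<^sup>+t. indicator {0<..} t * (\<integral>\<^sup>+x. indicator {t<..} (S x) * ennreal ((g x)\<^sup>2) * ennreal (1 / S x) \<partial>M) \<partial>lborel)"
    proof (rule nn_integral_mono)
      fix t :: real
      show "indicator {0<..} t * (ennreal ((cond_mean g t)\<^sup>2) * ennreal (height_pdf t)) \<le>
        indicator {0<..} t * (\<integral>\<^sup>+x. indicator {t<..} (S x) * ennreal ((g x)\<^sup>2) * ennreal (1 / S x) \<partial>M)"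
        using cond_mean_square_le[of t g] by (cases "0 < t") (auto intro: mult_left_mono)
    qed
  qed measurable
  also have "\<dots> = (\<integral>\<^sup>+x. (\<integral>\<^sup>+t. indicator {0<..<S x} t * ennreal ((g x)\<^sup>2) \<partial>lborel) * ennreal (1 / S x) \<partial>M)"
    by (rule joint_law[symmetric]) measurable
  also have "\<dots> = (\<integral>\<^sup>+x. ennreal ((g x)\<^sup>2) \<partial>M)"
  proof (rule nn_integral_cong_AE)
    show "AE x in M. (\<integral>\<^sup>+t. indicator {0<..<S x} t * ennreal ((g x)\<^sup>2) \<partial>lborel) * ennreal (1 / S x)
        = ennreal ((g x)\<^sup>2)"
      using S_pos by eventually_elim (simp add: nn_integral_multc ennreal_mult[symmetric])
  qed
  finally show ?thesis .
qed

text \<open>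
The averaging operator and the conditional expectation are adjoint to each other: both sides are the
mean of \<open>g x * f t\<close> under the joint law.
\<close>

lemma cond_mean_adjoint:
  assumes [measurable]: "g \<in> borel_measurable M" "f \<in> borel_measurable borel"
    and g2: "integrable M (\<lambda>x. (g x)\<^sup>2)" and f2: "integrable height_law (\<lambda>t. (f t)\<^sup>2)"
  shows "(\<integral>x. g x * avg f (S x) \<partial>M) = (\<integral>t. f t * cond_mean g t \<partial>height_law)"
proof -
  have "(\<integral>x. g x * avg f (S x) \<partial>M) = (\<integral>x. (\<integral>t. indicator {0<..<S x} t * (g x * f t) \<partial>lborel) / S x \<partial>M)"
  proof (intro Bochner_Integration.integral_cong refl)
    fix x
    have "(\<integral>t. indicator {0<..<S x} t * (g x * f t) \<partial>lborel)
        = (\<integral>t. g x * (indicator {0<..<S x} t * f t) \<partial>lborel)"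
      by (simp add: ac_simps)
    also have "\<dots> = g x * (\<integral>t. indicator {0<..<S x} t * f t \<partial>lborel)"
      by (rule integral_mult_right_zero)
    finally show "g x * avg f (S x) = (\<integral>t. indicator {0<..<S x} t * (g x * f t) \<partial>lborel) / S x"
      by (simp add: avg_def)
  qed
  also have "\<dots> = (\<integral>t. indicator {0<..} t * (\<integral>x. indicator {t<..} (S x) * (g x * f t) / S x \<partial>M) \<partial>lborel)"
  proof (rule joint_law_real)
    have "(\<integral>\<^sup>+x. (\<integral>\<^sup>+t. indicator {0<..<S x} t * ennreal \<bar>g x * f t\<bar> \<partial>lborel) * ennreal (1 / S x) \<partial>M)
      \<le> (\<integral>\<^sup>+x. ennreal ((g x)\<^sup>2) + (\<integral>\<^sup>+t. indicator {0<..<S x} t * ennreal ((f t)\<^sup>2) \<partial>lborel) * ennreal (1 / S x) \<partial>M)"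
    proof (rule nn_integral_mono_AE)
      show "AE x in M. (\<integral>\<^sup>+t. indicator {0<..<S x} t * ennreal \<bar>g x * f t\<bar> \<partial>lborel) * ennreal (1 / S x)
        \<le> ennreal ((g x)\<^sup>2) + (\<integral>\<^sup>+t. indicator {0<..<S x} t * ennreal ((f t)\<^sup>2) \<partial>lborel) * ennreal (1 / S x)"
        using S_pos
      proof eventually_elim
        case (elim x)
        have "(\<integral>\<^sup>+t. indicator {0<..<S x} t * ennreal \<bar>g x * f t\<bar> \<partial>lborel)
          \<le> (\<integral>\<^sup>+t. indicator {0<..<S x} t * ennreal ((g x)\<^sup>2) + indicator {0<..<S x} t * ennreal ((f t)\<^sup>2) \<partial>lborel)"
        proof (intro nn_integral_mono)
          fix t
          have "0 \<le> (\<bar>g x\<bar> - \<bar>f t\<bar>)\<^sup>2" by simp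
          then have "2 * \<bar>g x * f t\<bar> \<le> (g x)\<^sup>2 + (f t)\<^sup>2" by (simp add: power2_diff abs_mult)
          then have "\<bar>g x * f t\<bar> \<le> (g x)\<^sup>2 + (f t)\<^sup>2" by linarith
          then show "indicator {0<..<S x} t * ennreal \<bar>g x * f t\<bar>
              \<le> indicator {0<..<S x} t * ennreal ((g x)\<^sup>2) + indicator {0<..<S x} t * ennreal ((f t)\<^sup>2)"
            by (auto simp: indicator_def ennreal_plus[symmetric] simp del: ennreal_plus intro: ennreal_leI)
        qed
        also have "\<dots> = ennreal (S x) * ennreal ((g x)\<^sup>2)
            + (\<integral>\<^sup>+t. indicator {0<..<S x} t * ennreal ((f t)\<^sup>2) \<partial>lborel)"
          using elim by (simp add: nn_integral_add nn_integral_multc)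
        finally have "(\<integral>\<^sup>+t. indicator {0<..<S x} t * ennreal \<bar>g x * f t\<bar> \<partial>lborel) * ennreal (1 / S x)
          \<le> (ennreal (S x) * ennreal ((g x)\<^sup>2) + (\<integral>\<^sup>+t. indicator {0<..<S x} t * ennreal ((f t)\<^sup>2) \<partial>lborel)) * ennreal (1 / S x)"
          by (rule mult_right_mono) simp
        also have "\<dots> = ennreal ((g x)\<^sup>2)
            + (\<integral>\<^sup>+t. indicator {0<..<S x} t * ennreal ((f t)\<^sup>2) \<partial>lborel) * ennreal (1 / S x)"
          using elim by (simp add: distrib_right ennreal_mult[symmetric])
        finally show ?case .
      qed
    qed
    also have "\<dots> = (\<integral>\<^sup>+x. ennreal ((g x)\<^sup>2) \<partial>M) + (\<integral>\<^sup>+t. ennreal ((f t)\<^sup>2) \<partial>height_law)"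
      by (subst nn_integral_add) (auto simp: joint_law_height_law)
    also have "\<dots> < \<infinity>"
      using g2 f2 by (simp add: integrable_iff_bounded)
    finally show "(\<integral>\<^sup>+x. (\<integral>\<^sup>+t. indicator {0<..<S x} t * ennreal \<bar>g x * f t\<bar> \<partial>lborel)
        * ennreal (1 / S x) \<partial>M) < \<infinity>" .
  qed measurable
  also have "\<dots> = (\<integral>t. indicator {0<..} t * (f t * cond_mean g t * height_pdf t) \<partial>lborel)"
  proof (intro Bochner_Integration.integral_cong refl)
    fix t :: real
    have "(\<integral>x. indicator {t<..} (S x) * (g x * f t) / S x \<partial>M)
        = (\<integral>x. f t * (indicator {t<..} (S x) * g x / S x) \<partial>M)"
      by (simp add: ac_simps)
    also have "\<dots> = f t * (\<integral>x. indicator {t<..} (S x) * g x / S x \<partial>M)"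
      by (rule integral_mult_right_zero)
    finally show "indicator {0<..} t * (\<integral>x. indicator {t<..} (S x) * (g x * f t) / S x \<partial>M)
        = indicator {0<..} t * (f t * cond_mean g t * height_pdf t)"
      by (cases "0 < t") (simp_all add: cond_mean_times_height_pdf mult.assoc)
  qed
  finally show ?thesis by (subst integral_height_law) auto
qed

end

lemma AE_lborel_of_negligible:
  assumes "negligible N" shows "AE x in lborel. x \<notin> N"
proof -
  have "AE x in lebesgue. x \<notin> N"
    using assms by (simp add: negligible_iff_null_sets AE_not_in)
  then show ?thesis by (simp add: AE_completion_iff)
qed

text \<open>
Lusin-type approximation: a measurable function is an almost everywhere limit of continuous functions,
and truncating these at \<open>K\<close> keeps the limit.
\<close>

lemma bounded_limit_of_continuous:
  fixes h :: "real \<Rightarrow> real"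
  assumes "h \<in> borel_measurable borel" and K: "\<And>t. \<bar>h t\<bar> \<le> K"
  obtains g :: "nat \<Rightarrow> real \<Rightarrow> real" where
    "\<And>n. continuous_on UNIV (g n)" "\<And>n t. \<bar>g n t\<bar> \<le> K" "AE t in lborel. (\<lambda>n. g n t) \<longlonglongrightarrow> h t"
proof -
  have "h measurable_on UNIV"
    using assms(1) by (intro lebesgue_measurable_imp_measurable_on_real) (auto intro: measurable_completion)
  then obtain N f where N: "negligible N" and f: "\<And>n. continuous_on UNIV (f n)"
    "\<And>t. t \<notin> N \<Longrightarrow> (\<lambda>n. f n t) \<longlonglongrightarrow> h t"
    unfolding measurable_on_def by auto
  show ?thesis
  proof
    show "continuous_on UNIV (\<lambda>t. max (- K) (min K (f n t)))" for n
      by (intro continuous_intros f)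
    show "\<bar>max (- K) (min K (f n t))\<bar> \<le> K" for n t
      using order_trans[OF abs_ge_zero K[of t]] by (auto simp: max_def min_def abs_if)
    show "AE t in lborel. (\<lambda>n. max (- K) (min K (f n t))) \<longlonglongrightarrow> h t"
      using AE_lborel_of_negligible[OF N]
    proof eventually_elim
      case (elim t)
      have "(\<lambda>n. max (- K) (min K (f n t))) \<longlonglongrightarrow> max (- K) (min K (h t))"
        by (intro tendsto_intros f elim)
      moreover have "max (- K) (min K (h t)) = h t" using K[of t] by (auto simp: abs_le_iff)
      ultimately show ?case by simp
    qed
  qed
qed

section \<open>The radius of a slice and its excess\<close>

text \<open>
The last assumption is the form in which log-concavity enters. It is required only where the larger height
\<open>t\<close> has positive density, since beyond the support the radius is \<open>0\<close> and the inequality can fail.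
\<close>

locale contractive_slice = slice_pair M S for M :: "'a measure" and S :: "'a \<Rightarrow> real" +
  fixes k :: nat
  assumes k: "1 \<le> k"
    and height_pdf_cont: "continuous_on {0<..} height_pdf"
    and height_pdf_strict: "\<And>s t. 0 < s \<Longrightarrow> s < t \<Longrightarrow> 0 < height_pdf s \<Longrightarrow> height_pdf t < height_pdf s"
    and contraction: "\<And>u s t. 0 < u \<Longrightarrow> u < 1 \<Longrightarrow> 0 < s \<Longrightarrow> s < t \<Longrightarrow> 0 < height_pdf t \<Longrightarrow>
      root k (height_pdf (u * s)) - root k (height_pdf (u * t)) \<le> root k (height_pdf s) - root k (height_pdf t)"
begin

text \<open>
Up to a constant factor this is the radius of a \<open>k\<close>-dimensional ball with the volume of the slice at height \<open>t\<close>.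
\<close>

definition radius :: "real \<Rightarrow> real" where
  "radius t = root k (height_pdf t)"

text \<open>
The mean gain in radius when the height \<open>s\<close> is replaced by a uniform height below \<open>s\<close>.
\<close>

definition excess :: "real \<Rightarrow> real" where
  "excess s = avg radius s - radius s"

lemma radius_measurable [measurable]: "radius \<in> borel_measurable borel"
  unfolding radius_def[abs_def] by measurable

lemma excess_measurable [measurable]: "excess \<in> borel_measurable borel"
  unfolding excess_def[abs_def] by measurable

lemma radius_nonneg: "0 \<le> radius t"
  using k height_pdf_nonneg by (simp add: radius_def)

lemma radius_power: "radius t ^ k = height_pdf t"
  using k height_pdf_nonneg by (simp add: radius_def)

lemma radius_cont: "continuous_on {0<..} radius"
  unfolding radius_def by (intro continuous_intros height_pdf_cont)

lemma radius_antimono: "0 < s \<Longrightarrow> s \<le> t \<Longrightarrow> radius t \<le> radius s"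
  using k height_pdf_antimono by (simp add: radius_def)

lemma radius_strict: "0 < s \<Longrightarrow> s < t \<Longrightarrow> 0 < height_pdf s \<Longrightarrow> radius t < radius s"
  using k height_pdf_strict by (simp add: radius_def)

lemma radius_le: "radius t \<le> 1 + height_pdf t"
proof (cases "radius t \<le> 1")
  case False
  then have "radius t ^ 1 \<le> radius t ^ k" using k by (intro power_increasing) auto
  then show ?thesis by (simp add: radius_power)
qed (use height_pdf_nonneg[of t] in simp)

lemma radius_integrable: "integrable lborel (\<lambda>t. indicator {0<..<s} t * radius t)"
proof (rule Bochner_Integration.integrable_bound)
  show "integrable lborel (\<lambda>t. indicator {0<..<s} t + indicator {0<..} t * height_pdf t)"
    by (intro Bochner_Integration.integrable_add integrable_density integrable_real_indicator
        emeasure_bounded_finite) auto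
  show "AE t in lborel. norm (indicator {0<..<s} t * radius t)
      \<le> norm (indicator {0<..<s} t + indicator {0<..} t * height_pdf t)"
    using radius_le radius_nonneg height_pdf_nonneg by (auto simp: indicator_def)
qed measurable

lemma avg_radius_nonneg: "0 < s \<Longrightarrow> 0 \<le> avg radius s"
  unfolding avg_def using radius_nonneg by (auto intro!: divide_nonneg_pos integral_nonneg_AE)

lemma excess_pos:
  assumes s: "0 < s" "0 < height_pdf s"
  shows "0 < excess s"
proof -
  have "height_pdf s \<le> height_pdf (s / 2)" using s by (intro height_pdf_antimono) auto
  then have lt: "radius s < radius (s / 2)" using s by (intro radius_strict) auto
  let ?f = "\<lambda>t. indicator {0<..<s / 2} t * radius (s / 2) + indicator {s / 2..<s} t * radius s"
  have i: "integrable lborel (\<lambda>t. indicator {0<..<s / 2} t * radius (s / 2))"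
    "integrable lborel (\<lambda>t. indicator {s / 2..<s} t * radius s)"
    using s by auto
  have "(s / 2) * radius (s / 2) + (s / 2) * radius s = integral\<^sup>L lborel ?f"
    using s by (subst Bochner_Integration.integral_add[OF i]) simp
  also have "\<dots> \<le> (\<integral>t. indicator {0<..<s} t * radius t \<partial>lborel)"
    using i radius_integrable s radius_antimono
    by (intro integral_mono) (auto simp: indicator_def intro!: radius_antimono)
  finally have "((s / 2) * radius (s / 2) + (s / 2) * radius s) / s \<le> avg radius s"
    unfolding avg_def using s by (intro divide_right_mono) auto
  also have "((s / 2) * radius (s / 2) + (s / 2) * radius s) / s = radius (s / 2) / 2 + radius s / 2"
    using s by (simp add: field_simps)
  finally show ?thesis using lt by (simp add: excess_def)
qed

lemma excess_mono:
  assumes "0 < s" "s \<le> t" "0 < height_pdf t"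
  shows "excess s \<le> excess t"
proof (cases "s = t")
  case False
  then have st: "0 < s" "s < t" "0 < t" using assms by auto
  have int_s: "integrable lborel (\<lambda>u. indicator {0<..<1} u * radius (u * s))"
    and int_t: "integrable lborel (\<lambda>u. indicator {0<..<1} u * radius (u * t))"
    using radius_integrable st by (blast intro: avg_rescale(2)[THEN iffD1])+
  have "avg radius s - avg radius t
      = (\<integral>u. indicator {0<..<1} u * radius (u * s) - indicator {0<..<1} u * radius (u * t) \<partial>lborel)"
    unfolding avg_rescale(1)[OF st(1)] avg_rescale(1)[OF st(3)]
    by (rule Bochner_Integration.integral_diff[symmetric, OF int_s int_t])
  also have "\<dots> \<le> (\<integral>u. indicator {0<..<1::real} u * (radius s - radius t) \<partial>lborel)"
  proof (rule integral_mono)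
    show "integrable lborel (\<lambda>u. indicator {0<..<1} u * radius (u * s) - indicator {0<..<1} u * radius (u * t))"
      by (rule Bochner_Integration.integrable_diff[OF int_s int_t])
    show "integrable lborel (\<lambda>u. indicator {0<..<1::real} u * (radius s - radius t))" by simp
    show "indicator {0<..<1} u * radius (u * s) - indicator {0<..<1} u * radius (u * t)
        \<le> indicator {0<..<1} u * (radius s - radius t)" for u
      using contraction[of u s t] st assms(3) by (auto simp: indicator_def radius_def)
  qed
  also have "\<dots> = radius s - radius t" by simp
  finally show ?thesis by (simp add: excess_def)
qed simp

text \<open>
Let \<open>x0\<close> be the first zero of the density \<open>p\<close> of heights. As \<open>p(x0) = 0\<close>, the law of \<open>S\<close> has no mass
beyond \<open>x0\<close>, and continuity of \<open>p\<close> at \<open>x0\<close> excludes an atom there.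
\<close>

lemma AE_height_pdf_pos: "AE x in M. 0 < height_pdf (S x)"
proof (cases "\<exists>s>0. height_pdf s = 0")
  case False
  then have "0 < height_pdf s" if "0 < s" for s
    using height_pdf_nonneg[of s] that by (metis less_eq_real_def)
  then show ?thesis using S_pos by (auto elim!: eventually_mono)
next
  case True
  define E where "E = {s. 0 < s \<and> height_pdf s = 0}"
  define x0 where "x0 = Inf E"
  have ne: "E \<noteq> {}" and bd: "bdd_below E"
    using True by (auto simp: E_def intro!: bdd_belowI[of _ 0])
  have pos_below: "0 < height_pdf s" if "0 < s" "s < x0" for s
    using that cInf_lower[OF _ bd, of s] height_pdf_nonneg[of s]
    by (force simp: E_def x0_def less_eq_real_def)
  obtain s0 where s0: "0 < s0" "0 < height_pdf s0"
  proof -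
    have "\<exists>t>0. 0 < height_pdf t"
    proof (rule ccontr)
      assume "\<not> ?thesis"
      then have "height_pdf t = 0" if "0 < t" for t using height_pdf_nonneg[of t] that by (force simp: less_eq_real_def)
      then have "(\<integral>\<^sup>+t. indicator {0<..} t * ennreal (height_pdf t) \<partial>lborel)
          = (\<integral>\<^sup>+t. 0 \<partial>(lborel :: real measure))"
        by (intro nn_integral_cong) (auto simp: indicator_def)
      then show False using nn_integral_height_pdf by simp
    qed
    then show ?thesis using that by blast
  qed
  have "s0 \<le> x0"
    unfolding x0_def
  proof (rule cInf_greatest[OF ne])
    fix x assume "x \<in> E"
    then show "s0 \<le> x" using height_pdf_antimono[of x s0] s0 height_pdf_nonneg[of s0] by (cases "s0
        \<le> x") (auto simp: E_def)
  qed
  with s0 have x0: "0 < x0" by simp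
  have lim: "(height_pdf \<longlongrightarrow> height_pdf x0) (at x0)"
    using height_pdf_cont x0 by (auto simp: continuous_on_eq_continuous_at isCont_def)
  have p0: "height_pdf x = 0" if x: "x0 < x" for x
  proof -
    obtain e where "e \<in> E" "e < x" using cInf_lessD[OF ne, of x] x unfolding x0_def by blast
    then show ?thesis using height_pdf_antimono[of e x] height_pdf_nonneg[of x] x by (auto simp: E_def)
  qed
  have px0: "height_pdf x0 = 0"
  proof (rule tendsto_unique[of "at_right x0"])
    show "(height_pdf \<longlongrightarrow> height_pdf x0) (at_right x0)" using lim by (rule filterlim_mono) (auto simp: at_le)
    show "(height_pdf \<longlongrightarrow> 0) (at_right x0)"
      by (rule tendsto_eventually) (auto simp: eventually_at_filter p0)
  qed simp
  have null: "(\<integral>\<^sup>+x. indicator {x0..} (S x) * ennreal (1 / S x) \<partial>M) = 0"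
  proof -
    have "(\<integral>\<^sup>+x. indicator {x0..} (S x) * ennreal (1 / S x) \<partial>M)
        \<le> ennreal (height_pdf s)" if "0 < s" "s < x0" for s
      unfolding ennreal_height_pdf[OF that(1)] using that by (intro nn_integral_mono) (auto simp: indicator_def)
    moreover have "((\<lambda>s. ennreal (height_pdf s)) \<longlongrightarrow> ennreal 0) (at_left x0)"
      using filterlim_mono[OF lim order_refl at_le[of "{..<x0}" UNIV x0]] px0 by (intro tendsto_ennrealI) auto
    moreover have "eventually (\<lambda>s. 0 < s \<and> s < x0) (at_left x0)"
      using x0 eventually_at_left_real[of 0 x0] by (auto elim!: eventually_mono)
    ultimately have "(\<integral>\<^sup>+x. indicator {x0..} (S x) * ennreal (1 / S x) \<partial>M) \<le> ennreal 0"
      by (intro tendsto_lowerbound[of _ _ "at_left x0"]) (auto elim!: eventually_mono)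
    then show ?thesis by simp
  qed
  then have "AE x in M. indicator {x0..} (S x) * ennreal (1 / S x) = 0"
    by (subst (asm) nn_integral_0_iff_AE) auto
  with S_pos show ?thesis
  proof eventually_elim
    case (elim x)
    then have "S x < x0" by (cases "x0 \<le> S x") (auto simp: ennreal_eq_0_iff)
    then show ?case using elim pos_below by auto
  qed
qed

text \<open>
Under the measure with density \<open>1 / S\<close> the set \<open>{s < S \<le> t}\<close> has mass \<open>p(s) - p(t)\<close>, so \<open>p(S)\<close> is uniformly
distributed on \<open>(0, p(z))\<close> given \<open>S > z\<close>. Hence the radius is distributed as the norm of a uniform point in
a \<open>k\<close>-dimensional ball of radius \<open>\<lambda>(z)\<close>, with mean \<open>k / (k + 1) \<lambda>(z)\<close>.
The proof writes \<open>\<lambda>(S)\<close> as the length of \<open>(0, \<lambda>(S)]\<close> and exchanges integrals.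
\<close>

lemma radius_tail:
  assumes z: "0 < z"
  shows "(\<integral>\<^sup>+x. indicator {z<..} (S x) * (ennreal (radius (S x)) * ennreal (1 / S x)) \<partial>M)
    = ennreal (real k / (real k + 1) * (radius z * height_pdf z))"
proof -
  interpret P: pair_sigma_finite M lborel ..
  have m: "(\<lambda>(x, r). indicator {0<..radius (S x)} r * (indicator {z<..} (S x) * ennreal (1 / S x)))
      \<in> borel_measurable (M \<Otimes>\<^sub>M lborel)"
  proof -
    have "(\<lambda>(x, r). (if 0 < r \<and> r \<le> radius (S x) then 1 else 0) * ((if z < S x then 1 else 0) * ennreal (1 / S x)))
      \<in> borel_measurable (M \<Otimes>\<^sub>M borel)"
      by measurable
    then show ?thesis by (simp add: indicator_def of_bool_def)
  qed
  have inner: "(\<integral>\<^sup>+x. indicator {0<..radius (S x)} r * (indicator {z<..} (S x) * ennreal (1 / S x)) \<partial>M)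
     = ennreal (height_pdf z - r ^ k) * indicator {0..radius z} r" if r: "r \<noteq> 0" "r \<noteq> radius z" for r
  proof (cases "0 < r \<and> r < radius z")
    case True
    have pz: "r ^ k < height_pdf z"
      using True k by (subst radius_power[of z, symmetric]) (intro power_strict_mono, auto)
    \<comment> \<open>A height where the density is at most \<open>r ^ k\<close>, so that the intermediate value theorem applies on \<open>{z..b}\<close>.\<close>
    define b where "b = max z (1 / r ^ k)"
    have b: "z \<le> b" "height_pdf b \<le> r ^ k"
    proof -
      have "0 < b" using z by (simp add: b_def)
      then have "height_pdf b \<le> 1 / b" by (rule height_pdf_le)
      also have "\<dots> \<le> r ^ k"
      proof -
        have "1 / r ^ k \<le> b" by (simp add: b_def)
        then show ?thesis using True \<open>0 < b\<close> by (simp add: field_simps)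
      qed
      finally show "height_pdf b \<le> r ^ k" by simp
    qed (simp add: b_def)
    have "continuous_on {z..b} height_pdf" using height_pdf_cont z by (auto intro: continuous_on_subset)
    then obtain y where y: "z \<le> y" "y \<le> b" "height_pdf y = r ^ k"
      using IVT2'[of height_pdf b "r ^ k" z] b pz by auto
    have "(\<integral>\<^sup>+x. indicator {0<..radius (S x)} r * (indicator {z<..} (S x) * ennreal (1 / S x)) \<partial>M)
       = (\<integral>\<^sup>+x. indicator {z<..y} (S x) * ennreal (1 / S x) \<partial>M)"
    proof (intro nn_integral_cong)
      fix x
      have "r \<le> radius (S x) \<longleftrightarrow> S x \<le> y" if "z < S x"
      proof -
        have ly: "radius y = r" unfolding radius_def y using True k by (simp add: real_root_power_cancel)
        show ?thesis
          using radius_antimono[of "S x" y] radius_strict[of y "S x"] that z y True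
          by (force simp: ly)
      qed
      then show "indicator {0<..radius (S x)} r * (indicator {z<..} (S x) * ennreal (1 / S x))
          = indicator {z<..y} (S x) * ennreal (1 / S x)"
        using True by (auto simp: indicator_def)
    qed
    also have "\<dots> = ennreal (height_pdf z - r ^ k)"
      using height_pdf_diff[of z y] z y by simp
    finally show ?thesis using True by simp
  next
    case False
    then consider "r < 0" | "radius z < r" using r by linarith
    then show ?thesis
    proof cases
      case 2
      then have "radius (S x) < r" if "z < S x" for x
        using radius_antimono[of z "S x"] z that by auto
      then have zero: "indicator {0<..radius (S x)} r * (indicator {z<..} (S x) * ennreal (1 / S x)) = 0" for x
        by (force simp: indicator_def)
      show ?thesis unfolding zero using 2 by simp
    qed auto
  qed
  have "(\<integral>\<^sup>+x. indicator {z<..} (S x) * (ennreal (radius (S x)) * ennreal (1 / S x)) \<partial>M)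
    = (\<integral>\<^sup>+x. (\<integral>\<^sup>+r. indicator {0<..radius (S x)} r * (indicator {z<..} (S x) * ennreal (1 / S x)) \<partial>lborel) \<partial>M)"
    using radius_nonneg by (subst nn_integral_multc) (auto simp: ac_simps)
  also have "\<dots> = (\<integral>\<^sup>+r. (\<integral>\<^sup>+x. indicator {0<..radius (S x)} r
      * (indicator {z<..} (S x) * ennreal (1 / S x)) \<partial>M) \<partial>lborel)"
    using P.Fubini'[OF m] by simp
  also have "\<dots> = (\<integral>\<^sup>+r. ennreal (height_pdf z - r ^ k) * indicator {0..radius z} r \<partial>lborel)"
  proof (rule nn_integral_cong_AE)
    show "AE r in lborel. (\<integral>\<^sup>+x. indicator {0<..radius (S x)} r * (indicator {z<..} (S x) * ennreal (1 / S x)) \<partial>M)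
     = ennreal (height_pdf z - r ^ k) * indicator {0..radius z} r"
      using AE_lborel_singleton[of 0] AE_lborel_singleton[of "radius z"]
      by eventually_elim (rule inner)
  qed
  also have "\<dots> = ennreal ((height_pdf z * radius z - radius z ^ (k + 1) / real (k + 1))
      - (height_pdf z * 0 - 0 ^ (k + 1) / real (k + 1)))"
  proof (rule nn_integral_FTC_Icc)
    show "((\<lambda>r. height_pdf z * r - r ^ (k + 1) / real (k + 1)) has_real_derivative height_pdf z
        - r ^ k) (at r)" for r
    proof -
      have "((\<lambda>r. r ^ (k + 1)) has_real_derivative real (k + 1) * r ^ k) (at r)"
        using DERIV_pow[of "k + 1" r UNIV] by (simp del: of_nat_add)
      from DERIV_cdivide[OF this, of "real (k + 1)"]
      have "((\<lambda>r. r ^ (k + 1) / real (k + 1)) has_real_derivative r ^ k) (at r)"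
        by (simp del: of_nat_add)
      from DERIV_diff[OF DERIV_cmult[OF DERIV_ident, of "height_pdf z"] this] show ?thesis by simp
    qed
    show "0 \<le> height_pdf z - r ^ k" if "r \<in> {0..radius z}" for r
      using power_mono[of r "radius z" k] that by (simp add: radius_power)
  qed (auto simp: radius_nonneg)
  also have "(height_pdf z * radius z - radius z ^ (k + 1) / real (k + 1)) - (height_pdf z * 0 - 0 ^ (k + 1) / real (k + 1))
      = real k / (real k + 1) * (radius z * height_pdf z)"
    by (simp add: radius_power field_simps)
  finally show ?thesis .
qed

text \<open>
A factor \<open>1 = (\<integral>\<^sub>0\<^sup>S dt) / S\<close> is inserted under the mean, so that \<open>radius_tail\<close> applies at the level \<open>max t z\<close>.
\<close>

lemma radius_mean_tail:
  assumes z: "0 \<le> z"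
  shows "(\<integral>\<^sup>+x. indicator {z<..} (S x) * ennreal (radius (S x)) \<partial>M)
    = ennreal (real k / (real k + 1)) * (\<integral>\<^sup>+t. indicator {0<..} t * ennreal (radius (max t z) * height_pdf (max t z)) \<partial>lborel)"
proof -
  have "(\<integral>\<^sup>+x. indicator {z<..} (S x) * ennreal (radius (S x)) \<partial>M) =
    (\<integral>\<^sup>+x. (\<integral>\<^sup>+t. indicator {0<..<S x} t * (indicator {z<..} (S x) * ennreal (radius (S x))) \<partial>lborel) * ennreal (1 / S x) \<partial>M)"
  proof (rule nn_integral_cong_AE)
    show "AE x in M. indicator {z<..} (S x) * ennreal (radius (S x)) = 
      (\<integral>\<^sup>+t. indicator {0<..<S x} t * (indicator {z<..} (S x) * ennreal (radius (S x))) \<partial>lborel) * ennreal (1 / S x)"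
      using S_pos
    proof eventually_elim
      case (elim x)
      have "ennreal (S x) * ennreal (1 / S x) = 1"
        using elim by (simp add: ennreal_mult[symmetric])
      then show ?case
        using elim by (subst nn_integral_multc)
          (auto simp: mult.assoc mult.left_commute[of "ennreal (S x)"] indicator_def)
    qed
  qed
  also have "\<dots> = (\<integral>\<^sup>+t. indicator {0<..} t
      * (\<integral>\<^sup>+x. indicator {t<..} (S x) * (indicator {z<..} (S x) * ennreal (radius (S x)))
      * ennreal (1 / S x) \<partial>M) \<partial>lborel)"
    by (rule joint_law) measurable
  also have "\<dots> = (\<integral>\<^sup>+t. indicator {0<..} t
      * ennreal (real k / (real k + 1) * (radius (max t z) * height_pdf (max t z))) \<partial>lborel)"
  proof (rule nn_integral_cong)
    fix t
    show "indicator {0<..} t * (\<integral>\<^sup>+x. indicator {t<..} (S x) * (indicator {z<..} (S x) * ennreal (radius (S x))) * ennreal (1 / S x) \<partial>M)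
      = indicator {0<..} t * ennreal (real k / (real k + 1) * (radius (max t z) * height_pdf (max t z)))"
    proof (cases "0 < t")
      case True
      have "(\<integral>\<^sup>+x. indicator {t<..} (S x) * (indicator {z<..} (S x) * ennreal (radius (S x))) * ennreal (1 / S x) \<partial>M)
        = (\<integral>\<^sup>+x. indicator {max t z<..} (S x) * (ennreal (radius (S x)) * ennreal (1 / S x)) \<partial>M)"
        by (intro nn_integral_cong) (auto simp: indicator_def)
      then show ?thesis using radius_tail[of "max t z"] True by simp
    qed simp
  qed
  also have "\<dots> = (\<integral>\<^sup>+t. ennreal (real k / (real k + 1))
      * (indicator {0<..} t * ennreal (radius (max t z) * height_pdf (max t z))) \<partial>lborel)"
    by (subst ennreal_mult') (simp_all add: mult.left_commute)
  also have "\<dots> = ennreal (real k / (real k + 1))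
      * (\<integral>\<^sup>+t. indicator {0<..} t * ennreal (radius (max t z) * height_pdf (max t z)) \<partial>lborel)"
    by (rule nn_integral_cmult) measurable
  finally show ?thesis .
qed

lemma ennreal_avg_radius:
  assumes "0 < s"
  shows "ennreal (avg radius s) = (\<integral>\<^sup>+t. indicator {0<..<s} t * ennreal (radius t) \<partial>lborel) * ennreal (1 / s)"
proof -
  have "(\<integral>\<^sup>+t. indicator {0<..<s} t * ennreal (radius t) \<partial>lborel)
      = (\<integral>\<^sup>+t. ennreal (indicator {0<..<s} t * radius t) \<partial>lborel)"
    by (intro nn_integral_cong) (auto simp: indicator_def)
  also have "\<dots> = ennreal (\<integral>t. indicator {0<..<s} t * radius t \<partial>lborel)"
    using radius_integrable radius_nonneg by (intro nn_integral_eq_integral) auto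
  finally show ?thesis
    using assms by (simp add: avg_def ennreal_mult''[symmetric])
qed

lemma avg_radius_mean_tail:
  assumes z: "0 \<le> z"
  shows "(\<integral>\<^sup>+x. indicator {z<..} (S x) * ennreal (avg radius (S x)) \<partial>M)
    = (\<integral>\<^sup>+t. indicator {0<..} t * ennreal (radius t * height_pdf (max t z)) \<partial>lborel)"
proof -
  have "(\<integral>\<^sup>+x. indicator {z<..} (S x) * ennreal (avg radius (S x)) \<partial>M)
    = (\<integral>\<^sup>+x. indicator {z<..} (S x) * ((\<integral>\<^sup>+t. indicator {0<..<S x} t * ennreal (radius t) \<partial>lborel) * ennreal (1 / S x)) \<partial>M)"
    using z ennreal_avg_radius by (intro nn_integral_cong) (auto simp: indicator_def)
  also have "\<dots> = (\<integral>\<^sup>+t. indicator {0<..} t * (ennreal (radius t) * ennreal (height_pdf (max t z))) \<partial>lborel)"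
    by (rule joint_law_height[OF _ z]) measurable
  finally show ?thesis by (simp add: ennreal_mult radius_nonneg height_pdf_nonneg)
qed

lemma excess_nonneg:
  assumes "0 < s" shows "0 \<le> excess s"
proof (cases "height_pdf s = 0")
  case True
  then show ?thesis using avg_radius_nonneg[OF assms] k by (simp add: excess_def radius_def)
qed (use excess_pos[OF assms] height_pdf_nonneg[of s] in auto)

text \<open>
The integrands differ only for \<open>t < z\<close>, where the difference \<open>(\<lambda>(t) - \<lambda>(z)) p(z)\<close> integrates to
\<open>z p(z) \<delta>(z)\<close> by definition of the excess.
\<close>

lemma avg_radius_diff_mean:
  assumes z: "0 < z"
  shows "(\<integral>\<^sup>+t. indicator {0<..} t * ennreal (radius t * height_pdf (max t z)) \<partial>lborel)
    = (\<integral>\<^sup>+t. indicator {0<..} t * ennreal (radius (max t z) * height_pdf (max t z)) \<partial>lborel) + ennreal (z * height_pdf z * excess z)"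
proof -
  have i: "integrable lborel (\<lambda>t. indicator {0<..<z} t * (radius t - radius z))"
  proof -
    have "integrable lborel (\<lambda>t. indicator {0<..<z} t * radius t - indicator {0<..<z} t * radius z)"
      using radius_integrable z by (intro Bochner_Integration.integrable_diff) auto
    then show ?thesis by (simp add: algebra_simps)
  qed
  have "(\<integral>\<^sup>+t. indicator {0<..} t * ennreal (radius t * height_pdf (max t z)) \<partial>lborel) =
    (\<integral>\<^sup>+t. indicator {0<..} t * ennreal (radius (max t z) * height_pdf (max t z)) +
       ennreal (height_pdf z) * ennreal (indicator {0<..<z} t * (radius t - radius z)) \<partial>lborel)"
  proof (rule nn_integral_cong)
    fix t :: real
    have "0 \<le> radius t - radius z" if "0 < t" "t < z" using radius_antimono[of t z] that by simp
    moreover have "ennreal (radius t * height_pdf z)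
        = ennreal (radius z * height_pdf z) + ennreal (height_pdf z * (radius t - radius z))" if "0
        \<le> radius t - radius z"
      using that height_pdf_nonneg[of z] radius_nonneg[of z]
      by (subst ennreal_plus[symmetric]) (auto simp: algebra_simps mult_left_mono)
    ultimately show "indicator {0<..} t * ennreal (radius t * height_pdf (max t z)) = indicator {0<..} t * ennreal (radius (max t z) * height_pdf (max t z)) +
       ennreal (height_pdf z) * ennreal (indicator {0<..<z} t * (radius t - radius z))"
      using height_pdf_nonneg[of z] by (auto simp: indicator_def max_def ennreal_mult)
  qed
  also have "\<dots> = (\<integral>\<^sup>+t. indicator {0<..} t * ennreal (radius (max t z) * height_pdf (max t z)) \<partial>lborel) + 
     ennreal (height_pdf z) * (\<integral>\<^sup>+t. ennreal (indicator {0<..<z} t * (radius t - radius z)) \<partial>lborel)"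
    by (simp add: nn_integral_add nn_integral_cmult)
  also have "(\<integral>\<^sup>+t. ennreal (indicator {0<..<z} t * (radius t - radius z)) \<partial>lborel)
      = ennreal (\<integral>t. indicator {0<..<z} t * (radius t - radius z) \<partial>lborel)"
    using radius_antimono by (intro nn_integral_eq_integral i) (auto simp: indicator_def)
  also have "(\<integral>t. indicator {0<..<z} t * (radius t - radius z) \<partial>lborel) = z * excess z"
  proof -
    have "(\<integral>t. indicator {0<..<z} t * (radius t - radius z) \<partial>lborel)
        = (\<integral>t. indicator {0<..<z} t * radius t - indicator {0<..<z} t * radius z \<partial>lborel)"
      by (simp add: algebra_simps)
    also have "\<dots> = (\<integral>t. indicator {0<..<z} t * radius t \<partial>lborel) - z * radius z"
      using radius_integrable z by (subst Bochner_Integration.integral_diff) auto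
    also have "\<dots> = z * excess z"
      using z by (simp add: excess_def avg_def right_diff_distrib)
    finally show ?thesis .
  qed
  finally show ?thesis
    using height_pdf_nonneg by (simp add: ennreal_mult'[symmetric] ac_simps)
qed

lemma avg_radius_antimono:
  assumes "0 < s" "s \<le> t"
  shows "avg radius t \<le> avg radius s"
proof -
  have st: "0 < s" "0 < t" using assms by auto
  have "integrable lborel (\<lambda>u. indicator {0<..<1} u * radius (u * s))"
    and "integrable lborel (\<lambda>u. indicator {0<..<1} u * radius (u * t))"
    using radius_integrable st by (blast intro: avg_rescale(2)[THEN iffD1])+
  then show ?thesis
    unfolding avg_rescale(1)[OF st(1)] avg_rescale(1)[OF st(2)] using assms
    by (intro integral_mono) (auto simp: indicator_def intro!: radius_antimono)
qed

lemma avg_radius_tail_le: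
  assumes "0 < z"
  shows "(\<integral>\<^sup>+x. indicator {z<..} (S x) * ennreal (avg radius (S x)) \<partial>M) \<le> ennreal (avg radius z)"
proof -
  have "(\<integral>\<^sup>+x. indicator {z<..} (S x) * ennreal (avg radius (S x)) \<partial>M) \<le> (\<integral>\<^sup>+x. ennreal (avg radius z) \<partial>M)"
    using assms by (intro nn_integral_mono) (auto simp: indicator_def intro!: ennreal_leI avg_radius_antimono)
  then show ?thesis by (simp add: emeasure_space_1)
qed

text \<open>
Let \<open>A\<close> and \<open>L\<close> be the tail means of \<open>avg radius\<close> and \<open>radius\<close>, and \<open>B\<close> the integral of
\<open>radius * height_pdf\<close> at \<open>max t z\<close>. Then \<open>(k + 1) L = k B\<close> and \<open>A = B + z p(z) \<delta>(z)\<close>, so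
\<open>(k + 1) (A - L) = A + k (A - B)\<close> is the claim. Everything is finite because \<open>avg radius\<close> is
decreasing, hence bounded on the tail.
\<close>

lemma excess_tail:
  assumes z: "0 < z"
  shows "ennreal (real k + 1) * (\<integral>\<^sup>+x. indicator {z<..} (S x) * ennreal (excess (S x)) \<partial>M) =
    (\<integral>\<^sup>+x. indicator {z<..} (S x) * ennreal (avg radius (S x)) \<partial>M) + ennreal (real k * (z * height_pdf z * excess z))"
proof -
  define A where "A = (\<integral>\<^sup>+x. indicator {z<..} (S x) * ennreal (avg radius (S x)) \<partial>M)"
  define D where "D = (\<integral>\<^sup>+x. indicator {z<..} (S x) * ennreal (excess (S x)) \<partial>M)"
  define L where "L = (\<integral>\<^sup>+x. indicator {z<..} (S x) * ennreal (radius (S x)) \<partial>M)"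
  define B where "B = (\<integral>\<^sup>+t. indicator {0<..} t * ennreal (radius (max t z) * height_pdf (max t z)) \<partial>lborel)"
  have AB: "A = B + ennreal (z * height_pdf z * excess z)"
    unfolding A_def B_def using z by (simp add: avg_radius_mean_tail avg_radius_diff_mean)
  have LB: "L = ennreal (real k / (real k + 1)) * B"
    unfolding L_def B_def using z by (intro radius_mean_tail) simp
  have "A = (\<integral>\<^sup>+x. indicator {z<..} (S x) * ennreal (radius (S x))
      + indicator {z<..} (S x) * ennreal (excess (S x)) \<partial>M)"
    unfolding A_def
  proof (intro nn_integral_cong)
    fix x
    have "ennreal (avg radius (S x)) = ennreal (radius (S x)) + ennreal (excess (S x))" if "z < S x"
      using that z radius_nonneg excess_nonneg[of "S x"] by (subst ennreal_plus[symmetric]) (auto simp: excess_def)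
    then show "indicator {z<..} (S x) * ennreal (avg radius (S x))
        = indicator {z<..} (S x) * ennreal (radius (S x)) + indicator {z<..} (S x) * ennreal (excess (S x))"
      by (simp add: indicator_def)
  qed
  also have "\<dots> = L + D"
    unfolding L_def D_def by (rule nn_integral_add) measurable
  finally have ALD: "A = L + D" .
  have "A < \<infinity>" using avg_radius_tail_le[OF z] unfolding A_def by (rule le_less_trans) simp
  then have "A \<noteq> top" by (auto simp: less_top)
  moreover then have "B \<noteq> top" using AB by (metis ennreal_add_eq_top)
  moreover have "D \<noteq> top" using ALD \<open>A \<noteq> top\<close> by (metis ennreal_add_eq_top)
  ultimately obtain a b d where abd: "A = ennreal a" "B = ennreal b" "D = ennreal d" "0 \<le> a" "0 \<le> b" "0 \<le> d"
    by (metis ennreal_cases)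
  have "0 \<le> z * height_pdf z * excess z" using z height_pdf_nonneg excess_nonneg by auto
  then have 1: "a = b + z * height_pdf z * excess z"
    using AB abd by (simp add: ennreal_plus[symmetric] del: ennreal_plus)
  have 2: "a = real k / (real k + 1) * b + d"
    using ALD LB abd by (simp add: ennreal_plus[symmetric] ennreal_mult[symmetric] del: ennreal_plus)
  have "(real k + 1) * (real k / (real k + 1) * b) = real k * b" by simp
  then have "(real k + 1) * d = (real k + 1) * a - real k * b" using 2 by (simp add: algebra_simps)
  also have "\<dots> = a + real k * (z * height_pdf z * excess z)" using 1 by (simp add: algebra_simps)
  finally have "(real k + 1) * d = a + real k * (z * height_pdf z * excess z)" .
  then show ?thesis
    unfolding A_def[symmetric] D_def[symmetric] using abd \<open>0 \<le> z * height_pdf z * excess z\<close>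
    by (simp add: ennreal_plus[symmetric] ennreal_mult[symmetric] del: ennreal_plus)
qed

lemma ex_height_pdf_pos: "\<exists>z>0. 0 < height_pdf z"
proof -
  have "AE x in M. \<exists>z>0. 0 < height_pdf z" using S_pos AE_height_pdf_pos by eventually_elim auto
  then show ?thesis by simp
qed

text \<open>
Below \<open>z\<close> the excess is bounded by its value at \<open>z\<close>, above \<open>z\<close> by \<open>avg radius\<close>, which is bounded there.
\<close>

lemma integrable_excess: "integrable M (\<lambda>x. excess (S x))"
proof -
  obtain z where z: "0 < z" "0 < height_pdf z" using ex_height_pdf_pos by auto
  have "(\<integral>\<^sup>+x. ennreal (excess (S x)) \<partial>M)
      \<le> (\<integral>\<^sup>+x. ennreal (excess z) + indicator {z<..} (S x) * ennreal (avg radius (S x)) \<partial>M)"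
  proof (rule nn_integral_mono_AE)
    show "AE x in M. ennreal (excess (S x))
        \<le> ennreal (excess z) + indicator {z<..} (S x) * ennreal (avg radius (S x))"
      using S_pos
    proof eventually_elim
      case (elim x)
      show ?case
      proof (cases "S x \<le> z")
        case True
        then show ?thesis using excess_mono[of "S x" z] z elim by (simp add: ennreal_leI indicator_def)
      next
        case False
        then have "ennreal (excess (S x)) \<le> ennreal (avg radius (S x))"
          using radius_nonneg by (intro ennreal_leI) (simp add: excess_def)
        then show ?thesis using False by (simp add: indicator_def add_increasing)
      qed
    qed
  qed
  also have "\<dots> \<le> ennreal (excess z) + ennreal (avg radius z)"
    using avg_radius_tail_le[OF z(1)] by (subst nn_integral_add) (auto simp: emeasure_space_1 intro!: add_left_mono)
  also have "\<dots> < \<infinity>" by simp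
  finally show ?thesis
    using S_pos excess_nonneg by (intro integrableI_nonneg) (auto elim!: eventually_mono)
qed

text \<open>
By \<open>excess_tail\<close> the means of \<open>avg radius\<close> above \<open>z\<close> are at most \<open>k + 1\<close> times the mean of the excess.
Letting \<open>z\<close> tend to \<open>0\<close> gives integrability without any estimate of the growth of the radius near \<open>0\<close>.
\<close>

lemma integrable_avg_radius: "integrable M (\<lambda>x. avg radius (S x))"
proof -
  let ?A = "\<lambda>n x. indicator {1 / real (Suc n)<..} (S x) * ennreal (avg radius (S x))"
  have "(\<integral>\<^sup>+x. ennreal (avg radius (S x)) \<partial>M) \<le> (\<integral>\<^sup>+x. (SUP n. ?A n x) \<partial>M)"
  proof (rule nn_integral_mono_AE)
    show "AE x in M. ennreal (avg radius (S x)) \<le> (SUP n. ?A n x)"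
      using S_pos
    proof eventually_elim
      case (elim x)
      then obtain n where "inverse (real (Suc n)) < S x" using reals_Archimedean by blast
      then show ?case by (intro SUP_upper2[of n]) (auto simp: inverse_eq_divide)
    qed
  qed
  also have "\<dots> = (SUP n. \<integral>\<^sup>+x. ?A n x \<partial>M)"
  proof (rule nn_integral_monotone_convergence_SUP)
    show "incseq ?A"
    proof (intro incseq_SucI le_funI mult_right_mono)
      fix n x
      have "1 / real (Suc (Suc n)) \<le> 1 / real (Suc n)" by (intro divide_left_mono) auto
      then show "indicator {1 / real (Suc n)<..} (S x)
          \<le> (indicator {1 / real (Suc (Suc n))<..} (S x) :: ennreal)"
        by (auto simp: indicator_def)
    qed simp
  qed measurable
  also have "\<dots> \<le> ennreal (real k + 1) * (\<integral>\<^sup>+x. ennreal (excess (S x)) \<partial>M)"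
  proof (rule SUP_least)
    fix n
    have "(\<integral>\<^sup>+x. ?A n x \<partial>M) \<le> ennreal (real k + 1)
        * (\<integral>\<^sup>+x. indicator {1 / real (Suc n)<..} (S x) * ennreal (excess (S x)) \<partial>M)"
      by (subst excess_tail) auto
    also have "\<dots> \<le> ennreal (real k + 1) * (\<integral>\<^sup>+x. ennreal (excess (S x)) \<partial>M)"
      by (intro mult_left_mono nn_integral_mono) (auto simp: indicator_def)
    finally show "(\<integral>\<^sup>+x. ?A n x \<partial>M) \<le> ennreal (real k + 1) * (\<integral>\<^sup>+x. ennreal (excess (S x)) \<partial>M)" .
  qed
  also have "\<dots> < \<infinity>"
  proof -
    have "(\<integral>\<^sup>+x. ennreal (excess (S x)) \<partial>M) = ennreal (\<integral>x. excess (S x) \<partial>M)"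
      using S_pos excess_nonneg by (intro nn_integral_eq_integral integrable_excess) (auto elim!: eventually_mono)
    then show ?thesis by (simp add: ennreal_mult_less_top)
  qed
  finally show ?thesis
    using S_pos avg_radius_nonneg by (intro integrableI_nonneg) (auto elim!: eventually_mono)
qed

lemma integrable_radius: "integrable M (\<lambda>x. radius (S x))"
  using Bochner_Integration.integrable_diff[OF integrable_avg_radius integrable_excess] by (simp add: excess_def)

text \<open>
This is \<open>excess_tail\<close> at \<open>z = 0\<close>, where the correction term vanishes.
\<close>

lemma mean_excess: "(real k + 1) * (\<integral>x. excess (S x) \<partial>M) = (\<integral>x. avg radius (S x) \<partial>M)"
proof -
  have ind: "(\<integral>\<^sup>+x. indicator {0<..} (S x) * ennreal (f (S x)) \<partial>M)
      = (\<integral>\<^sup>+x. ennreal (f (S x)) \<partial>M)" for f :: "real \<Rightarrow> real"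
    using S_pos by (intro nn_integral_cong_AE) (auto elim!: eventually_mono)
  have "ennreal (\<integral>x. radius (S x) \<partial>M) = (\<integral>\<^sup>+x. indicator {0<..} (S x) * ennreal (radius (S x)) \<partial>M)"
    unfolding ind using radius_nonneg by (intro nn_integral_eq_integral[symmetric] integrable_radius) auto
  also have "\<dots> = ennreal (real k / (real k + 1))
      * (\<integral>\<^sup>+t. indicator {0<..} t * ennreal (radius t * height_pdf (max t 0)) \<partial>lborel)"
  proof -
    have "(\<integral>\<^sup>+t. indicator {0<..} t * ennreal (radius (max t 0) * height_pdf (max t 0)) \<partial>lborel) =
      (\<integral>\<^sup>+t. indicator {0<..} t * ennreal (radius t * height_pdf (max t 0)) \<partial>lborel)"
      by (rule nn_integral_cong) (simp add: indicator_def max_def)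
    then show ?thesis using radius_mean_tail[of 0] by simp
  qed
  also have "(\<integral>\<^sup>+t. indicator {0<..} t * ennreal (radius t * height_pdf (max t 0)) \<partial>lborel)
      = (\<integral>\<^sup>+x. indicator {0<..} (S x) * ennreal (avg radius (S x)) \<partial>M)"
    by (simp add: avg_radius_mean_tail)
  also have "(\<integral>\<^sup>+x. indicator {0<..} (S x) * ennreal (avg radius (S x)) \<partial>M) = ennreal (\<integral>x. avg radius (S x) \<partial>M)"
    unfolding ind using S_pos avg_radius_nonneg
    by (intro nn_integral_eq_integral integrable_avg_radius) (auto elim!: eventually_mono)
  finally have eq: "ennreal (\<integral>x. radius (S x) \<partial>M)
      = ennreal (real k / (real k + 1)) * ennreal (\<integral>x. avg radius (S x) \<partial>M)" .
  have nn: "0 \<le> (\<integral>x. radius (S x) \<partial>M)" "0 \<le> (\<integral>x. avg radius (S x) \<partial>M)"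
    using radius_nonneg S_pos avg_radius_nonneg by (auto elim!: eventually_mono intro!: integral_nonneg_AE)
  have "ennreal (\<integral>x. radius (S x) \<partial>M) = ennreal (real k / (real k + 1) * (\<integral>x. avg radius (S x) \<partial>M))"
    unfolding eq by (rule ennreal_mult'[symmetric]) simp
  then have "(\<integral>x. radius (S x) \<partial>M) = real k / (real k + 1) * (\<integral>x. avg radius (S x) \<partial>M)"
    using nn by (subst (asm) ennreal_inj) auto
  then have "(real k + 1) * (\<integral>x. radius (S x) \<partial>M) = real k * (\<integral>x. avg radius (S x) \<partial>M)" by simp
  moreover have "(\<integral>x. excess (S x) \<partial>M) = (\<integral>x. avg radius (S x) \<partial>M) - (\<integral>x. radius (S x) \<partial>M)"
    unfolding excess_def by (rule Bochner_Integration.integral_diff[OF integrable_avg_radius integrable_radius])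
  ultimately have "(real k + 1) * (\<integral>x. excess (S x) \<partial>M) =
      (real k + 1) * (\<integral>x. avg radius (S x) \<partial>M) - real k * (\<integral>x. avg radius (S x) \<partial>M)"
    by (simp only: right_diff_distrib)
  then show ?thesis by (simp add: distrib_right)
qed

lemma integral_split_at:
  fixes f :: "real \<Rightarrow> real"
  assumes [measurable]: "f \<in> borel_measurable borel" and i: "integrable M (\<lambda>x. f (S x))"
  shows "integrable M (\<lambda>x. indicator {z<..} (S x) * f (S x))"
    and "integrable M (\<lambda>x. indicator {..z} (S x) * f (S x))"
    and "(\<integral>x. indicator {..z} (S x) * f (S x) \<partial>M) + (\<integral>x. indicator {z<..} (S x) * f (S x) \<partial>M)
        = (\<integral>x. f (S x) \<partial>M)"
proof -
  show a: "integrable M (\<lambda>x. indicator {z<..} (S x) * f (S x))"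
    by (rule Bochner_Integration.integrable_bound[OF i]) (auto simp: indicator_def)
  show b: "integrable M (\<lambda>x. indicator {..z} (S x) * f (S x))"
    by (rule Bochner_Integration.integrable_bound[OF i]) (auto simp: indicator_def)
  show "(\<integral>x. indicator {..z} (S x) * f (S x) \<partial>M) + (\<integral>x. indicator {z<..} (S x) * f (S x) \<partial>M) = (\<integral>x. f (S x) \<partial>M)"
    by (subst Bochner_Integration.integral_add[OF b a, symmetric])
       (auto intro!: Bochner_Integration.integral_cong simp: indicator_def)
qed

text \<open>
With \<open>q\<close> the probability of \<open>S > z\<close>, \<open>a = 1 - q\<close>, and \<open>Az\<close>, \<open>Al\<close> the means of \<open>avg radius\<close> above and
below \<open>z\<close>, the left-hand side is \<open>q Al - a Az = q (Al + Az) - Az\<close>. By \<open>mean_excess\<close> and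
\<open>excess_tail\<close> the claim becomes \<open>q (Dl + Dz) \<le> Dz\<close> for the corresponding means of the excess.
This holds because the increasing function \<open>excess\<close> is at least \<open>excess z\<close> above \<open>z\<close> and at most that below.
\<close>

lemma crossing_bound:
  assumes z: "0 < z" "0 < height_pdf z"
  shows "(\<integral>\<^sup>+x. (\<integral>\<^sup>+y. indicator {z<..} (S x) * indicator {..z} (S y) * ennreal (avg radius (S y) - avg radius (S x)) \<partial>M) \<partial>M)
    \<le> ennreal (real k * (z * height_pdf z * excess z))"
proof -
  define q :: real where "q = (\<integral>x. indicator {z<..} (S x) \<partial>M)"
  define a :: real where "a = (\<integral>x. indicator {..z} (S x) \<partial>M)"
  define Az where "Az = (\<integral>x. indicator {z<..} (S x) * avg radius (S x) \<partial>M)"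
  define Al where "Al = (\<integral>x. indicator {..z} (S x) * avg radius (S x) \<partial>M)"
  define Dz where "Dz = (\<integral>x. indicator {z<..} (S x) * excess (S x) \<partial>M)"
  define Dl where "Dl = (\<integral>x. indicator {..z} (S x) * excess (S x) \<partial>M)"
  note iA = integral_split_at[OF avg_measurable[OF radius_measurable] integrable_avg_radius, of z]
  note iD = integral_split_at[OF excess_measurable integrable_excess, of z]
  note i1 = integral_split_at[of "\<lambda>_. 1 :: real" z, OF borel_measurable_const integrable_const, unfolded mult_1_right]
  have qa: "a + q = 1" using i1(3) by (simp add: q_def a_def prob_space)
  have q0: "0 \<le> q" "0 \<le> a" unfolding q_def a_def by (auto intro!: integral_nonneg_AE)
  have sum: "(real k + 1) * (Dl + Dz) = Al + Az"
    using mean_excess iA(3) iD(3) by (simp add: Al_def Az_def Dl_def Dz_def)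
  have DA: "(real k + 1) * Dz = Az + real k * (z * height_pdf z * excess z)"
  proof -
    have 1: "(\<integral>\<^sup>+x. indicator {z<..} (S x) * ennreal (excess (S x)) \<partial>M) = ennreal Dz"
      unfolding Dz_def using z excess_nonneg
      by (subst nn_integral_eq_integral[OF iD(1), symmetric]) (auto intro!: nn_integral_cong simp: indicator_def)
    have 2: "(\<integral>\<^sup>+x. indicator {z<..} (S x) * ennreal (avg radius (S x)) \<partial>M) = ennreal Az"
      unfolding Az_def using z avg_radius_nonneg
      by (subst nn_integral_eq_integral[OF iA(1), symmetric]) (auto intro!: nn_integral_cong simp: indicator_def)
    have "0 \<le> Dz" "0 \<le> Az" "0 \<le> real k * (z * height_pdf z * excess z)"
      unfolding Dz_def Az_def using z excess_nonneg avg_radius_nonneg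
      by (auto intro!: integral_nonneg_AE simp: indicator_def)
    then show ?thesis
      using excess_tail[OF z(1)] unfolding 1 2
      by (simp add: ennreal_plus[symmetric] ennreal_mult[symmetric] del: ennreal_plus)
  qed
  have Dz_ge: "q * excess z \<le> Dz"
  proof -
    have "q * excess z = (\<integral>x. indicator {z<..} (S x) * excess z \<partial>M)" unfolding q_def by simp
    also have "\<dots> \<le> Dz"
      unfolding Dz_def
    proof (rule integral_mono_AE)
      show "AE x in M. indicator {z<..} (S x) * excess z \<le> indicator {z<..} (S x) * excess (S x)"
        using AE_height_pdf_pos by eventually_elim (use z excess_mono in \<open>auto simp: indicator_def\<close>)
    qed (use iD i1 in auto)
    finally show ?thesis .
  qed
  have Dl_le: "Dl \<le> a * excess z"
  proof -
    have "Dl \<le> (\<integral>x. indicator {..z} (S x) * excess z \<partial>M)"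
      unfolding Dl_def
    proof (rule integral_mono_AE)
      show "AE x in M. indicator {..z} (S x) * excess (S x) \<le> indicator {..z} (S x) * excess z"
        using S_pos by eventually_elim (use z excess_mono in \<open>auto simp: indicator_def\<close>)
    qed (use iD i1 in auto)
    also have "\<dots> = a * excess z" unfolding a_def by simp
    finally show ?thesis .
  qed
  have "q * Dl \<le> q * (a * excess z)" using Dl_le q0 by (intro mult_left_mono)
  also have "\<dots> = a * (q * excess z)" by simp
  also have "\<dots> \<le> a * Dz" using Dz_ge q0 by (intro mult_left_mono)
  finally have "q * Dl \<le> a * Dz" .
  moreover have "Dz = a * Dz + q * Dz" using qa by (metis distrib_right mult_1)
  ultimately have "q * (Dl + Dz) \<le> Dz" unfolding distrib_left by linarith
  then have "(real k + 1) * (q * (Dl + Dz)) \<le> (real k + 1) * Dz" by (intro mult_left_mono) auto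
  then have "q * (Al + Az) \<le> Az + real k * (z * height_pdf z * excess z)"
    using sum DA by (simp add: mult.left_commute)
  moreover have "Az = a * Az + q * Az" using qa by (metis distrib_right mult_1)
  ultimately have bound: "q * Al - a * Az \<le> real k * (z * height_pdf z * excess z)"
    unfolding distrib_left by linarith
  have inner: "(\<integral>\<^sup>+y. indicator {z<..} (S x) * indicator {..z} (S y) * ennreal (avg radius (S y) - avg radius (S x)) \<partial>M)
     = ennreal (indicator {z<..} (S x) * (Al - a * avg radius (S x)))" for x
  proof (cases "z < S x")
    case True
    have i: "integrable M (\<lambda>y. indicator {..z} (S y) * avg radius (S y)
        - indicator {..z} (S y) * avg radius (S x))"
      using iA i1 by auto
    have "(\<integral>\<^sup>+y. indicator {z<..} (S x) * indicator {..z} (S y) * ennreal (avg radius (S y) - avg radius (S x)) \<partial>M)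
      = (\<integral>\<^sup>+y. ennreal (indicator {..z} (S y) * avg radius (S y) - indicator {..z} (S y) * avg radius (S x)) \<partial>M)"
      using True by (intro nn_integral_cong) (auto simp: indicator_def)
    also have "\<dots> = ennreal (\<integral>y. indicator {..z} (S y) * avg radius (S y)
        - indicator {..z} (S y) * avg radius (S x) \<partial>M)"
    proof (rule nn_integral_eq_integral[OF i])
      show "AE y in M. 0 \<le> indicator {..z} (S y) * avg radius (S y) - indicator {..z} (S y) * avg radius (S x)"
        using S_pos by eventually_elim (use True avg_radius_antimono in \<open>auto simp: indicator_def\<close>)
    qed
    also have "(\<integral>y. indicator {..z} (S y) * avg radius (S y) - indicator {..z} (S y) * avg radius (S x) \<partial>M)
        = Al - a * avg radius (S x)"
      unfolding Al_def a_def using iA i1 by (subst Bochner_Integration.integral_diff) auto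
    finally show ?thesis using True by simp
  qed simp
  have "(\<integral>\<^sup>+x. (\<integral>\<^sup>+y. indicator {z<..} (S x) * indicator {..z} (S y) * ennreal (avg radius (S y) - avg radius (S x)) \<partial>M) \<partial>M)
    = (\<integral>\<^sup>+x. ennreal (indicator {z<..} (S x) * Al - a * (indicator {z<..} (S x) * avg radius (S x))) \<partial>M)"
    unfolding inner by (intro nn_integral_cong) (auto simp: indicator_def)
  also have "\<dots> = ennreal (\<integral>x. indicator {z<..} (S x) * Al - a * (indicator {z<..} (S x) * avg radius (S x)) \<partial>M)"
  proof (rule nn_integral_eq_integral)
    show "integrable M (\<lambda>x. indicator {z<..} (S x) * Al - a * (indicator {z<..} (S x) * avg radius (S x)))"
      using iA i1 by auto
    have "a * avg radius s \<le> Al" if "z < s" for s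
    proof -
      have "a * avg radius s = (\<integral>x. indicator {..z} (S x) * avg radius s \<partial>M)" unfolding a_def by simp
      also have "\<dots> \<le> Al"
        unfolding Al_def
      proof (rule integral_mono_AE)
        show "AE x in M. indicator {..z} (S x) * avg radius s \<le> indicator {..z} (S x) * avg radius (S x)"
          using S_pos by eventually_elim (use that avg_radius_antimono in \<open>auto simp: indicator_def\<close>)
      qed (use iA i1 in auto)
      finally show ?thesis .
    qed
    then show "AE x in M. 0 \<le> indicator {z<..} (S x) * Al - a * (indicator {z<..} (S x) * avg radius (S x))"
      by (auto simp: indicator_def)
  qed
  also have "(\<integral>x. indicator {z<..} (S x) * Al - a * (indicator {z<..} (S x) * avg radius (S x)) \<partial>M)
      = q * Al - a * Az"
    unfolding q_def Az_def using iA i1 by (subst Bochner_Integration.integral_diff) auto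
  finally show ?thesis using bound by (simp add: ennreal_leI)
qed

section \<open>A weighted Poincare inequality\<close>

text \<open>
The Cauchy-Schwarz inequality applied to \<open>F(x) - F(y) = \<integral>\<^sub>y\<^sup>x (h - F) / s ds\<close>, splitting the integrand as
\<open>(h - F) / sqrt (s \<delta>)\<close> times \<open>sqrt (\<delta> / s)\<close>; the squared second factor integrates to
\<open>avg \<lambda> y - avg \<lambda> x\<close>.
\<close>

lemma avg_increment_le:
  assumes cont: "continuous_on {0<..} h" and [measurable]: "h \<in> borel_measurable borel"
    and int: "\<And>s. 0 < s \<Longrightarrow> integrable lborel (\<lambda>t. indicator {0<..<s} t * h t)"
    and xy: "0 < y" "y < x" "0 < height_pdf x"
  shows "ennreal ((avg h x - avg h y)\<^sup>2) \<le>
    (\<integral>\<^sup>+s. indicator {y..<x} s * ennreal ((h s - avg h s)\<^sup>2 / (s * excess s)) \<partial>lborel) * ennreal (avg radius y - avg radius x)"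
proof -
  define f where "f s = indicator {y..<x} s * ennreal (\<bar>h s - avg h s\<bar> / sqrt (s * excess s))" for s
  define g where "g s = indicator {y..<x} s * ennreal (sqrt (excess s / s))" for s
  have [measurable]: "f \<in> borel_measurable borel" "g \<in> borel_measurable borel"
    unfolding f_def[abs_def] g_def[abs_def] by measurable
  have dp: "0 < excess s" "0 < s" if "s \<in> {y..<x}" for s
    using that xy height_pdf_antimono[of s x] by (auto intro!: excess_pos)
  have "ennreal \<bar>avg h x - avg h y\<bar> = ennreal \<bar>\<integral>s. indicator {y..x} s * ((h s - avg h s) / s) \<partial>lborel\<bar>"
    using avg_diff[OF cont int, of y x] xy by (simp add: has_bochner_integral_iff)
  also have "\<dots> \<le> (\<integral>\<^sup>+s. ennreal (norm (indicator {y..x} s * ((h s - avg h s) / s))) \<partial>lborel)"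
    using integral_norm_bound_ennreal[of lborel "\<lambda>s. indicator {y..x} s * ((h s - avg h s) / s)"]
      avg_diff[OF cont int, of y x] xy by (simp add: has_bochner_integral_iff)
  also have "\<dots> = (\<integral>\<^sup>+s. f s * g s \<partial>lborel)"
  proof (rule nn_integral_cong_AE)
    show "AE s in lborel. ennreal (norm (indicator {y..x} s * ((h s - avg h s) / s))) = f s * g s"
      using AE_lborel_singleton[of x]
    proof eventually_elim
      case (elim s)
      show ?case
      proof (cases "s \<in> {y..<x}")
        case True
        have "sqrt (s * excess s) * s = sqrt (s * excess s) * (sqrt s * sqrt s)" using dp[OF True] by simp
        then have "\<bar>h s - avg h s\<bar> / s = \<bar>h s - avg h s\<bar> / sqrt (s * excess s) * sqrt (excess s / s)"
          using dp[OF True] by (simp add: real_sqrt_mult real_sqrt_divide field_simps)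
        then show ?thesis
          using True dp[OF True] by (simp add: f_def g_def ennreal_mult[symmetric] indicator_def)
      qed (use elim in \<open>auto simp: f_def g_def indicator_def\<close>)
    qed
  qed
  finally have "(ennreal \<bar>avg h x - avg h y\<bar>)\<^sup>2 \<le> (\<integral>\<^sup>+s. f s * g s \<partial>lborel)\<^sup>2"
    by (rule power_mono) simp
  also have "\<dots> \<le> (\<integral>\<^sup>+s. (f s)\<^sup>2 \<partial>lborel) * (\<integral>\<^sup>+s. (g s)\<^sup>2 \<partial>lborel)"
    by (rule Cauchy_Schwarz_nn_integral) measurable
  also have "(\<integral>\<^sup>+s. (f s)\<^sup>2 \<partial>lborel)
      = (\<integral>\<^sup>+s. indicator {y..<x} s * ennreal ((h s - avg h s)\<^sup>2 / (s * excess s)) \<partial>lborel)"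
  proof (rule nn_integral_cong)
    fix s show "(f s)\<^sup>2 = indicator {y..<x} s * ennreal ((h s - avg h s)\<^sup>2 / (s * excess s))"
      by (cases "s \<in> {y..<x}") (use dp[of s] in \<open>auto simp: f_def ennreal_power power_divide\<close>)
  qed
  also have "(\<integral>\<^sup>+s. (g s)\<^sup>2 \<partial>lborel) = (\<integral>\<^sup>+s. ennreal (indicator {y..x} s * (excess s / s)) \<partial>lborel)"
  proof (rule nn_integral_cong_AE)
    show "AE s in lborel. (g s)\<^sup>2 = ennreal (indicator {y..x} s * (excess s / s))"
      using AE_lborel_singleton[of x]
    proof eventually_elim
      case (elim s)
      show ?case
        by (cases "s \<in> {y..<x}") (use elim dp[of s] in \<open>auto simp: g_def ennreal_power indicator_def\<close>)
    qed
  qed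
  also have "\<dots> = ennreal (avg radius y - avg radius x)"
  proof -
    have "has_bochner_integral lborel (\<lambda>s.
        - (indicator {y..x} s * ((radius s - avg radius s) / s))) (- (avg radius x - avg radius y))"
      using xy by (intro has_bochner_integral_minus avg_diff radius_cont radius_integrable) auto
    moreover have "(\<lambda>s. - (indicator {y..x} s * ((radius s - avg radius s) / s)))
        = (\<lambda>s. indicator {y..x} s * (excess s / s))"
      by (auto simp: excess_def fun_eq_iff field_simps diff_divide_distrib)
    ultimately have hb: "has_bochner_integral lborel (\<lambda>s. indicator {y..x} s * (excess s / s)) (avg radius y
        - avg radius x)"
      by simp
    have "(\<integral>\<^sup>+s. ennreal (indicator {y..x} s * (excess s / s)) \<partial>lborel)
        = ennreal (\<integral>s. indicator {y..x} s * (excess s / s) \<partial>lborel)"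
      using hb xy excess_nonneg
      by (intro nn_integral_eq_integral AE_I2) (auto simp: has_bochner_integral_iff indicator_def)
    then show ?thesis using hb by (simp add: has_bochner_integral_iff)
  qed
  finally show ?thesis by (simp add: ennreal_power)
qed

text \<open>
The increment bound is integrated over all pairs \<open>y < x\<close>. Exchanging integrals, the weight at height \<open>s\<close>
is multiplied by the mean of \<open>avg \<lambda> y - avg \<lambda> x\<close> over pairs that \<open>s\<close> separates, and the bound
\<open>k s p(s) \<delta>(s)\<close> on this mean cancels the denominator \<open>s \<delta>(s)\<close>.
\<close>

lemma pair_crossing_bound:
  assumes cont: "continuous_on {0<..} h" and [measurable]: "h \<in> borel_measurable borel"
    and int: "\<And>s. 0 < s \<Longrightarrow> integrable lborel (\<lambda>t. indicator {0<..<s} t * h t)"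
  shows "(\<integral>\<^sup>+x. \<integral>\<^sup>+y. (if S y < S x then ennreal ((avg h (S x) - avg h (S y))\<^sup>2) else 0) \<partial>M \<partial>M)
    \<le> ennreal (real k) * (\<integral>\<^sup>+s. indicator {0<..} s * (ennreal ((h s - avg h s)\<^sup>2) * ennreal (height_pdf s)) \<partial>lborel)"
proof -
  interpret P: pair_sigma_finite M lborel ..
  \<comment> \<open>On the null set of \<open>y\<close> with \<open>S y \<le> 0\<close> the integral over \<open>s\<close> reaches below \<open>0\<close>, where the weight has to vanish.\<close>
  define w where "w s = (if 0 < s then ennreal ((h s - avg h s)\<^sup>2 / (s * excess s)) else 0)" for s
  have [measurable]: "w \<in> borel_measurable borel" unfolding w_def[abs_def] by measurable
  define G where "G x y s = (if S y
      \<le> s \<and> s < S x then w s * ennreal (avg radius (S y) - avg radius (S x)) else 0)" for x y s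
  have mG: "(\<lambda>(x, y, s). G x y s) \<in> borel_measurable (M \<Otimes>\<^sub>M M \<Otimes>\<^sub>M borel)"
    unfolding G_def by measurable
  have mG' [measurable]: "(\<lambda>(x, y, s). G x y s) \<in> borel_measurable (M \<Otimes>\<^sub>M M \<Otimes>\<^sub>M lborel)"
    using mG by (simp cong: measurable_cong_sets)
  have "(\<integral>\<^sup>+x. \<integral>\<^sup>+y. (if S y < S x then ennreal ((avg h (S x) - avg h (S y))\<^sup>2) else 0) \<partial>M \<partial>M)
     \<le> (\<integral>\<^sup>+x. \<integral>\<^sup>+y. \<integral>\<^sup>+s. G x y s \<partial>lborel \<partial>M \<partial>M)"
  proof (rule nn_integral_mono_AE)
    show "AE x in M. (\<integral>\<^sup>+y. (if S y < S x then ennreal ((avg h (S x) - avg h (S y))\<^sup>2) else 0) \<partial>M)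
      \<le> (\<integral>\<^sup>+y. \<integral>\<^sup>+s. G x y s \<partial>lborel \<partial>M)"
      using AE_height_pdf_pos
    proof eventually_elim
      case (elim x)
      show ?case
      proof (rule nn_integral_mono_AE)
        show "AE y in M. (if S y < S x then ennreal ((avg h (S x) - avg h (S y))\<^sup>2) else 0)
            \<le> (\<integral>\<^sup>+s. G x y s \<partial>lborel)"
          using S_pos
        proof eventually_elim
          case (elim y)
          note y = elim
          show ?case
          proof (cases "S y < S x")
            case True
            have "ennreal ((avg h (S x) - avg h (S y))\<^sup>2) \<le>
              (\<integral>\<^sup>+s. indicator {S y..<S x} s * ennreal ((h s - avg h s)\<^sup>2 / (s * excess s)) \<partial>lborel) * ennreal (avg radius (S y) - avg radius (S x))"
              by (rule avg_increment_le[OF cont _ int y True \<open>0 < height_pdf (S x)\<close>]) auto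
            also have "\<dots> = (\<integral>\<^sup>+s. indicator {S y..<S x} s * ennreal ((h s - avg h s)\<^sup>2 / (s * excess s))
                * ennreal (avg radius (S y) - avg radius (S x)) \<partial>lborel)"
              by (rule nn_integral_multc[symmetric]) measurable
            also have "\<dots> = (\<integral>\<^sup>+s. G x y s \<partial>lborel)"
              using y by (intro nn_integral_cong) (auto simp: G_def w_def indicator_def)
            finally show ?thesis using True by simp
          qed simp
        qed
      qed
    qed
  qed
  also have "\<dots> = (\<integral>\<^sup>+x. \<integral>\<^sup>+s. \<integral>\<^sup>+y. G x y s \<partial>M \<partial>lborel \<partial>M)"
  proof (rule nn_integral_cong)
    fix x assume [simp]: "x \<in> space M"
    have "(\<lambda>(y, s). G x y s) \<in> borel_measurable (M \<Otimes>\<^sub>M lborel)" by measurable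
    from P.Fubini'[OF this] show "(\<integral>\<^sup>+y. \<integral>\<^sup>+s. G x y s \<partial>lborel \<partial>M) = (\<integral>\<^sup>+s. \<integral>\<^sup>+y. G x y s \<partial>M \<partial>lborel)"
      by simp
  qed
  also have "\<dots> = (\<integral>\<^sup>+s. \<integral>\<^sup>+x. \<integral>\<^sup>+y. G x y s \<partial>M \<partial>M \<partial>lborel)"
  proof -
    have "(\<lambda>(x, s). \<integral>\<^sup>+y. G x y s \<partial>M) \<in> borel_measurable (M \<Otimes>\<^sub>M borel)"
      unfolding G_def by measurable
    then have "(\<lambda>(x, s). \<integral>\<^sup>+y. G x y s \<partial>M) \<in> borel_measurable (M \<Otimes>\<^sub>M lborel)"
      by (simp cong: measurable_cong_sets)
    from P.Fubini'[OF this] show ?thesis by simp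
  qed
  also have "\<dots> \<le> (\<integral>\<^sup>+s. ennreal (real k)
      * (indicator {0<..} s * (ennreal ((h s - avg h s)\<^sup>2) * ennreal (height_pdf s))) \<partial>lborel)"
  proof (rule nn_integral_mono)
    fix s :: real
    show "(\<integral>\<^sup>+x. \<integral>\<^sup>+y. G x y s \<partial>M \<partial>M)
        \<le> ennreal (real k) * (indicator {0<..} s * (ennreal ((h s - avg h s)\<^sup>2) * ennreal (height_pdf s)))"
    proof (cases "0 < s")
      case False
      then have "G x y s = 0" for x y by (simp add: G_def w_def)
      then show ?thesis by simp
    next
      case s: True
      show ?thesis
      proof (cases "0 < height_pdf s")
        case False
        have "(\<integral>\<^sup>+x. \<integral>\<^sup>+y. G x y s \<partial>M \<partial>M) = (\<integral>\<^sup>+x. 0 \<partial>M)"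
        proof (rule nn_integral_cong_AE)
          show "AE x in M. (\<integral>\<^sup>+y. G x y s \<partial>M) = 0"
            using AE_height_pdf_pos
          proof eventually_elim
            case (elim x)
            then have "\<not> s < S x" using False height_pdf_antimono[of s "S x"] s by force
            then show ?case by (simp add: G_def)
          qed
        qed
        then show ?thesis by simp
      next
        case True
        have "(\<integral>\<^sup>+x. \<integral>\<^sup>+y. G x y s \<partial>M \<partial>M)
            = (\<integral>\<^sup>+x. w s * (\<integral>\<^sup>+y. indicator {s<..} (S x) * indicator {..s} (S y)
            * ennreal (avg radius (S y) - avg radius (S x)) \<partial>M) \<partial>M)"
        proof (intro nn_integral_cong)
          fix x assume [simp]: "x \<in> space M"
          have "(\<integral>\<^sup>+y. G x y s \<partial>M) = (\<integral>\<^sup>+y. w s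
              * (indicator {s<..} (S x) * indicator {..s} (S y)
              * ennreal (avg radius (S y) - avg radius (S x))) \<partial>M)"
            by (intro nn_integral_cong) (auto simp: G_def indicator_def)
          also have "\<dots> = w s * (\<integral>\<^sup>+y. indicator {s<..} (S x) * indicator {..s} (S y)
              * ennreal (avg radius (S y) - avg radius (S x)) \<partial>M)"
            by (rule nn_integral_cmult) measurable
          finally show "(\<integral>\<^sup>+y. G x y s \<partial>M)
              = w s * (\<integral>\<^sup>+y. indicator {s<..} (S x) * indicator {..s} (S y)
              * ennreal (avg radius (S y) - avg radius (S x)) \<partial>M)" .
        qed
        also have "\<dots> = w s * (\<integral>\<^sup>+x. \<integral>\<^sup>+y. indicator {s<..} (S x) * indicator {..s} (S y)
            * ennreal (avg radius (S y) - avg radius (S x)) \<partial>M \<partial>M)"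
          by (rule nn_integral_cmult) measurable
        also have "\<dots> \<le> w s * ennreal (real k * (s * height_pdf s * excess s))"
          by (intro mult_left_mono crossing_bound s True) simp
        also have "\<dots> = ennreal (real k)
            * (indicator {0<..} s * (ennreal ((h s - avg h s)\<^sup>2) * ennreal (height_pdf s)))"
          using s True excess_pos[OF s True] by (simp add: w_def ennreal_mult[symmetric] field_simps)
        finally show ?thesis .
      qed
    qed
  qed
  also have "\<dots> = ennreal (real k)
      * (\<integral>\<^sup>+s. indicator {0<..} s * (ennreal ((h s - avg h s)\<^sup>2) * ennreal (height_pdf s)) \<partial>lborel)"
    by (rule nn_integral_cmult) measurable
  finally show ?thesis .
qed

section \<open>Averaging contracts the variance\<close>

abbreviation rate :: real where "rate \<equiv> real k / (real k + 1)"

text \<open>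
Let \<open>V\<close>, \<open>E\<close> and \<open>I\<close> be the means of \<open>(h - F)(T)\<^sup>2\<close>, \<open>F(S)\<^sup>2\<close> and \<open>h(T)\<^sup>2\<close>, where \<open>F = avg h\<close>, and
\<open>m\<close> the common mean of \<open>F(S)\<close> and \<open>h(T)\<close>. The Poincare inequality is
\<open>E - m\<^sup>2 \<le> k V\<close>, and averaging loses at least the conditional variance: \<open>V + E \<le> I\<close>. Eliminating \<open>V\<close> gives the claim,
in a form with \<open>m\<close> on the right-hand side that passes to limits by Fatou's lemma.
\<close>

lemma variance_contraction_continuous:
  assumes cont: "continuous_on UNIV h" and K: "\<And>t. \<bar>h t\<bar> \<le> K"
  shows "(\<integral>\<^sup>+x. ennreal ((avg h (S x))\<^sup>2) \<partial>M) \<le>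
    ennreal (rate * (\<integral>t. (h t)\<^sup>2 \<partial>height_law) + (1 - rate) * (\<integral>t. h t \<partial>height_law)\<^sup>2)"
proof -
  interpret T: prob_space height_law by (rule prob_space_height_law)
  have hm [measurable]: "h \<in> borel_measurable borel"
    using cont by (rule borel_measurable_continuous_onI)
  have hc: "continuous_on {0<..} h" using cont by (rule continuous_on_subset) simp
  have hi: "integrable lborel (\<lambda>t. indicator {0<..<s} t * h t)" if "0 < s" for s
    by (rule bounded_integrable_Ioo[OF hm K that])
  define V where "V = (\<integral>\<^sup>+s. indicator {0<..} s
      * (ennreal ((h s - avg h s)\<^sup>2) * ennreal (height_pdf s)) \<partial>lborel)"
  define E where "E = (\<integral>x. (avg h (S x))\<^sup>2 \<partial>M)"
  define I where "I = (\<integral>t. (h t)\<^sup>2 \<partial>height_law)"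
  define m where "m = (\<integral>t. h t \<partial>height_law)"
  have K2: "(h t)\<^sup>2 \<le> K\<^sup>2" for t using K[of t] by (simp add: abs_le_square_iff[symmetric])
  have ih: "integrable height_law h" using K by (intro T.integrable_const_bound[where B = K]) auto
  have ih2: "integrable height_law (\<lambda>t. (h t)\<^sup>2)"
    using K2 by (intro T.integrable_const_bound[where B = "K\<^sup>2"]) auto
  have bF: "AE x in M. \<bar>avg h (S x)\<bar> \<le> K"
    using S_pos by eventually_elim (rule avg_bounded[OF K])
  have iF2: "integrable M (\<lambda>x. (avg h (S x))\<^sup>2)"
  proof (rule integrable_const_bound[where B = "K\<^sup>2"])
    show "AE x in M. norm ((avg h (S x))\<^sup>2) \<le> K\<^sup>2"
      using bF by eventually_elim (simp add: abs_le_square_iff[symmetric])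
  qed simp
  have m: "(\<integral>x. avg h (S x) \<partial>M) = m" unfolding m_def by (rule mean_avg[OF hm ih])
  have I: "(\<integral>\<^sup>+t. ennreal ((h t)\<^sup>2) \<partial>height_law) = ennreal I"
    unfolding I_def using ih2 by (intro nn_integral_eq_integral) auto
  have E: "(\<integral>\<^sup>+x. ennreal ((avg h (S x))\<^sup>2) \<partial>M) = ennreal E"
    unfolding E_def using iF2 by (intro nn_integral_eq_integral) auto
  have poincare: "ennreal (E - m\<^sup>2) \<le> ennreal (real k) * V"
  proof -
    have "ennreal (E - m\<^sup>2) = (\<integral>\<^sup>+x. \<integral>\<^sup>+y. (if S y < S x then ennreal ((avg h (S x)
        - avg h (S y))\<^sup>2) else 0) \<partial>M \<partial>M)"
      unfolding E_def m[symmetric] by (rule nn_integral_pairs_diff_square[OF _ bF]) auto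
    also have "\<dots> \<le> ennreal (real k) * V"
      unfolding V_def by (rule pair_crossing_bound[OF hc hm hi])
    finally show ?thesis .
  qed
  have "V + ennreal E \<le> ennreal I"
  proof -
    have V_eq: "V = (\<integral>\<^sup>+x. (\<integral>\<^sup>+t. indicator {0<..<S x} t * ennreal ((h t - avg h t)\<^sup>2) \<partial>lborel)
        * ennreal (1 / S x) \<partial>M)"
      unfolding V_def by (subst joint_law_height_law) (auto simp: nn_integral_height_law)
    have "V + ennreal E = (\<integral>\<^sup>+x. (\<integral>\<^sup>+t. indicator {0<..<S x} t * ennreal ((h t - avg h t)\<^sup>2) \<partial>lborel) * ennreal (1 / S x)
        + ennreal ((avg h (S x))\<^sup>2) \<partial>M)"
      unfolding V_eq E[symmetric] by (rule nn_integral_add[symmetric]) measurable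
    also have "\<dots> \<le> (\<integral>\<^sup>+x. (\<integral>\<^sup>+t. indicator {0<..<S x} t * ennreal ((h t)\<^sup>2) \<partial>lborel) * ennreal (1 / S x) \<partial>M)"
    proof (rule nn_integral_mono_AE)
      show "AE x in M. (\<integral>\<^sup>+t. indicator {0<..<S x} t * ennreal ((h t - avg h t)\<^sup>2) \<partial>lborel) * ennreal (1 / S x)
        + ennreal ((avg h (S x))\<^sup>2) \<le> (\<integral>\<^sup>+t. indicator {0<..<S x} t * ennreal ((h t)\<^sup>2) \<partial>lborel) * ennreal (1 / S x)"
        using S_pos
      proof eventually_elim
        case (elim x)
        have "ennreal ((avg h (S x))\<^sup>2) = ennreal (S x * (avg h (S x))\<^sup>2) * ennreal (1 / S x)"
          using elim by (simp add: ennreal_mult[symmetric])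
        then show ?case
          using mult_right_mono[OF avg_variance_le[OF hc hm hi elim], of "ennreal (1 / S x)"]
          by (simp add: distrib_right)
      qed
    qed
    also have "\<dots> = ennreal I"
      by (subst joint_law_height_law) (auto simp: I)
    finally show ?thesis .
  qed
  moreover have "0 \<le> E" "0 \<le> I" unfolding E_def I_def by auto
  moreover obtain v where v: "V = ennreal v" "0 \<le> v"
  proof -
    have "V \<noteq> top" using \<open>V + ennreal E \<le> ennreal I\<close> by (auto simp: top_unique)
    then show ?thesis using that by (metis ennreal_cases)
  qed
  ultimately have 1: "v + E \<le> I"
    by (simp add: ennreal_plus[symmetric] del: ennreal_plus)
  have "E - m\<^sup>2 \<le> real k * v"
    using poincare v by (simp add: ennreal_mult[symmetric] ennreal_le_iff)
  also have "\<dots> \<le> real k * (I - E)" using 1 by (intro mult_left_mono) auto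
  finally have "(real k + 1) * E \<le> real k * I + m\<^sup>2" by (simp add: algebra_simps)
  then have "E \<le> (real k * I + m\<^sup>2) / (real k + 1)" by (simp add: pos_le_divide_eq mult.commute)
  also have "\<dots> = rate * I + (1 - rate) * m\<^sup>2"
  proof -
    have "1 - rate = 1 / (real k + 1)" by (simp add: field_simps)
    then show ?thesis by (simp add: add_divide_distrib)
  qed
  finally show ?thesis unfolding E I_def m_def by (rule ennreal_leI)
qed

text \<open>
Dominated convergence on the right-hand side and Fatou's lemma on the left.
It is used twice, to pass from continuous to bounded functions and from bounded to square integrable ones.
\<close>

lemma variance_contraction_limit:
  assumes hm [measurable]: "\<And>n. hn n \<in> borel_measurable borel" "h \<in> borel_measurable borel" "w
      \<in> borel_measurable borel"
    and dom: "\<And>n t. \<bar>hn n t\<bar> \<le> w t"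
    and w: "integrable height_law (\<lambda>t. (w t)\<^sup>2)"
    and lim: "AE t in lborel. (\<lambda>n. hn n t) \<longlonglongrightarrow> h t"
    and le: "\<And>n. (\<integral>\<^sup>+x. ennreal ((avg (hn n) (S x))\<^sup>2) \<partial>M) \<le>
      ennreal (rate * (\<integral>t. (hn n t)\<^sup>2 \<partial>height_law) + (1 - rate) * (\<integral>t. hn n t \<partial>height_law)\<^sup>2)"
  shows "(\<integral>\<^sup>+x. ennreal ((avg h (S x))\<^sup>2) \<partial>M) \<le>
    ennreal (rate * (\<integral>t. (h t)\<^sup>2 \<partial>height_law) + (1 - rate) * (\<integral>t. h t \<partial>height_law)\<^sup>2)"
proof -
  interpret T: prob_space height_law by (rule prob_space_height_law)
  have w0: "0 \<le> w t" for t using dom[of 0 t] by simp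
  have w1: "integrable height_law w"
    using w by (rule T.square_integrable_imp_integrable[rotated]) simp
  have limT: "AE t in height_law. (\<lambda>n. hn n t) \<longlonglongrightarrow> h t"
    unfolding height_law_def using lim by (subst AE_density) (auto elim!: eventually_mono)
  have l1: "(\<lambda>n. \<integral>t. hn n t \<partial>height_law) \<longlonglongrightarrow> (\<integral>t. h t \<partial>height_law)"
    by (rule integral_dominated_convergence[OF _ _ w1 limT]) (use dom in auto)
  have l2: "(\<lambda>n. \<integral>t. (hn n t)\<^sup>2 \<partial>height_law) \<longlonglongrightarrow> (\<integral>t. (h t)\<^sup>2 \<partial>height_law)"
  proof (rule integral_dominated_convergence[OF _ _ w])
    show "AE t in height_law. (\<lambda>n. (hn n t)\<^sup>2) \<longlonglongrightarrow> (h t)\<^sup>2"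
      using limT by eventually_elim (intro tendsto_intros)
    show "AE t in height_law. norm ((hn n t)\<^sup>2) \<le> (w t)\<^sup>2" for n
      using dom[of n] w0 abs_le_square_iff[of "hn n _" "w _"] by (intro AE_I2) simp
  qed measurable
  have pw: "AE x in M. (\<lambda>n. avg (hn n) (S x)) \<longlonglongrightarrow> avg h (S x)"
    using AE_finite_average[OF hm(3) w1] S_pos
  proof eventually_elim
    case (elim x)
    have "(\<lambda>n. \<integral>t. indicator {0<..<S x} t * hn n t \<partial>lborel) \<longlonglongrightarrow> (\<integral>t. indicator {0<..<S x} t * h t \<partial>lborel)"
    proof (rule integral_dominated_convergence[OF _ _ elim(1)])
      show "AE t in lborel. (\<lambda>n. indicator {0<..<S x} t * hn n t) \<longlonglongrightarrow> indicator {0<..<S x} t * h t"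
        using lim by eventually_elim (intro tendsto_intros)
      show "AE t in lborel. norm (indicator {0<..<S x} t * hn n t) \<le> indicator {0<..<S x} t * w t" for n
        using dom[of n] by (intro AE_I2) (auto simp: indicator_def)
    qed measurable
    then show ?case unfolding avg_def using elim by (intro tendsto_intros) auto
  qed
  have "(\<integral>\<^sup>+x. ennreal ((avg h (S x))\<^sup>2) \<partial>M) = (\<integral>\<^sup>+x. liminf (\<lambda>n. ennreal ((avg (hn n) (S x))\<^sup>2)) \<partial>M)"
  proof (rule nn_integral_cong_AE)
    show "AE x in M. ennreal ((avg h (S x))\<^sup>2) = liminf (\<lambda>n. ennreal ((avg (hn n) (S x))\<^sup>2))"
      using pw
    proof eventually_elim
      case (elim x)
      then have "(\<lambda>n. ennreal ((avg (hn n) (S x))\<^sup>2)) \<longlonglongrightarrow> ennreal ((avg h (S x))\<^sup>2)"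
        by (intro tendsto_intros)
      then show ?case by (intro lim_imp_Liminf[symmetric]) auto
    qed
  qed
  also have "\<dots> \<le> liminf (\<lambda>n. \<integral>\<^sup>+x. ennreal ((avg (hn n) (S x))\<^sup>2) \<partial>M)"
    by (rule nn_integral_liminf) measurable
  also have "\<dots> \<le> liminf (\<lambda>n. ennreal (rate * (\<integral>t. (hn n t)\<^sup>2 \<partial>height_law)
      + (1 - rate) * (\<integral>t. hn n t \<partial>height_law)\<^sup>2))"
    using le by (intro Liminf_mono) auto
  also have "\<dots> = ennreal (rate * (\<integral>t. (h t)\<^sup>2 \<partial>height_law) + (1 - rate) * (\<integral>t. h t \<partial>height_law)\<^sup>2)"
    by (intro lim_imp_Liminf tendsto_ennrealI tendsto_intros l1 l2) auto
  finally show ?thesis .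
qed

lemma variance_contraction_bounded:
  assumes hm [measurable]: "h \<in> borel_measurable borel" and K: "\<And>t. \<bar>h t\<bar> \<le> K"
  shows "(\<integral>\<^sup>+x. ennreal ((avg h (S x))\<^sup>2) \<partial>M) \<le>
    ennreal (rate * (\<integral>t. (h t)\<^sup>2 \<partial>height_law) + (1 - rate) * (\<integral>t. h t \<partial>height_law)\<^sup>2)"
proof -
  interpret T: prob_space height_law by (rule prob_space_height_law)
  obtain g :: "nat \<Rightarrow> real \<Rightarrow> real" where g: "\<And>n. continuous_on UNIV (g n)" "\<And>n t. \<bar>g n t\<bar> \<le> K"
    "AE t in lborel. (\<lambda>n. g n t) \<longlonglongrightarrow> h t"
    using bounded_limit_of_continuous[OF assms] by metis
  show ?thesis
  proof (rule variance_contraction_limit[of g h "\<lambda>_. K"])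
    show "g n \<in> borel_measurable borel" for n
      using g(1) by (rule borel_measurable_continuous_onI)
    show "(\<integral>\<^sup>+x. ennreal ((avg (g n) (S x))\<^sup>2) \<partial>M) \<le>
      ennreal (rate * (\<integral>t. (g n t)\<^sup>2 \<partial>height_law) + (1 - rate) * (\<integral>t. g n t \<partial>height_law)\<^sup>2)" for n
      by (rule variance_contraction_continuous[OF g(1,2)])
  qed (use g in auto)
qed

lemma variance_contraction:
  assumes hm [measurable]: "h \<in> borel_measurable borel" and h2: "integrable height_law (\<lambda>t. (h t)\<^sup>2)"
  shows "(\<integral>\<^sup>+x. ennreal ((avg h (S x))\<^sup>2) \<partial>M) \<le>
    ennreal (rate * (\<integral>t. (h t)\<^sup>2 \<partial>height_law) + (1 - rate) * (\<integral>t. h t \<partial>height_law)\<^sup>2)"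
proof (rule variance_contraction_limit[of "\<lambda>n t. max (- real n) (min (real n) (h t))" h "\<lambda>t. \<bar>h t\<bar>"])
  show "AE t in lborel. (\<lambda>n. max (- real n) (min (real n) (h t))) \<longlonglongrightarrow> h t"
  proof (intro AE_I2 tendsto_eventually)
    fix t
    show "eventually (\<lambda>n. max (- real n) (min (real n) (h t)) = h t) sequentially"
      using eventually_ge_at_top[of "nat \<lceil>\<bar>h t\<bar>\<rceil>"]
    proof eventually_elim
      case (elim n)
      then have "\<bar>h t\<bar> \<le> real n" by linarith
      then show ?case by (auto simp: max_def min_def abs_if split: if_splits)
    qed
  qed
  show "(\<integral>\<^sup>+x. ennreal ((avg (\<lambda>t. max (- real n) (min (real n) (h t))) (S x))\<^sup>2) \<partial>M) \<le>
      ennreal (rate * (\<integral>t. (max (- real n) (min (real n) (h t)))\<^sup>2 \<partial>height_law) +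
        (1 - rate) * (\<integral>t. max (- real n) (min (real n) (h t)) \<partial>height_law)\<^sup>2)" for n
    by (rule variance_contraction_bounded[where K = "real n"]) auto
  show "integrable height_law (\<lambda>t. \<bar>h t\<bar>\<^sup>2)" using h2 by simp
qed (auto simp: max_def min_def abs_if)

text \<open>
The factor \<open>rate\<close> enters twice, since the kernel is the averaging operator composed with its adjoint.
For the variances \<open>a\<close> of \<open>F\<close> and \<open>c\<close> of \<open>g\<close>, and \<open>b\<close> of the conditional mean, \<open>variance_contraction\<close> gives
\<open>a \<le> rate b\<close>. By adjointness \<open>b\<close> is the covariance of \<open>g\<close> and \<open>F\<close>, so that
\<open>2 rate b \<le> rate\<^sup>2 c + a\<close>. Together these give \<open>a \<le> rate\<^sup>2 c\<close>.
\<close>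

theorem slice_operator_contracts:
  assumes gm [measurable]: "g \<in> borel_measurable M" and g2: "integrable M (\<lambda>x. (g x)\<^sup>2)"
  defines "m \<equiv> \<integral>x. g x \<partial>M"
  defines "F \<equiv> \<lambda>x. avg (cond_mean g) (S x)"
  shows "integrable M (\<lambda>x. (F x - m)\<^sup>2)"
    and "(\<integral>x. (F x - m)\<^sup>2 \<partial>M) \<le> rate\<^sup>2 * (\<integral>x. (g x)\<^sup>2 \<partial>M)"
    and "integrable height_law (cond_mean g)"
proof -
  interpret T: prob_space height_law by (rule prob_space_height_law)
  let ?h = "cond_mean g"
  have [measurable]: "F \<in> borel_measurable M" unfolding F_def by measurable
  have r: "0 < rate" using k by simp
  have h2: "integrable height_law (\<lambda>t. (?h t)\<^sup>2)"
    using cond_mean_contracts[OF gm] g2 by (auto simp: integrable_iff_bounded intro: le_less_trans)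
  then show h1: "integrable height_law ?h"
    by (rule T.square_integrable_imp_integrable[rotated]) simp
  have g1: "integrable M g"
    using g2 by (rule square_integrable_imp_integrable[rotated]) simp
  have mean: "m = (\<integral>t. ?h t \<partial>height_law)"
  proof -
    have "(\<integral>x. g x * avg (\<lambda>_. 1) (S x) \<partial>M) = (\<integral>t. 1 * ?h t \<partial>height_law)"
      by (rule cond_mean_adjoint) (auto simp: g2)
    moreover have "(\<integral>x. g x * avg (\<lambda>_. 1) (S x) \<partial>M) = m"
      unfolding m_def
    proof (rule integral_cong_AE)
      show "AE x in M. g x * avg (\<lambda>_. 1) (S x) = g x"
        using S_pos by eventually_elim (simp add: avg_def)
    qed measurable
    ultimately show ?thesis by simp
  qed
  define H where "H = (\<integral>t. (?h t)\<^sup>2 \<partial>height_law)"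
  have gap: "(\<integral>\<^sup>+x. ennreal ((F x)\<^sup>2) \<partial>M) \<le> ennreal (rate * H + (1 - rate) * m\<^sup>2)"
    unfolding F_def H_def mean by (rule variance_contraction[OF _ h2]) simp
  have F2: "integrable M (\<lambda>x. (F x)\<^sup>2)"
    using gap by (auto simp: integrable_iff_bounded intro: le_less_trans)
  have F1: "integrable M F"
    using F2 by (rule square_integrable_imp_integrable[rotated]) simp
  have FM: "(\<integral>x. F x \<partial>M) = m"
    unfolding F_def mean by (rule mean_avg[OF _ h1]) simp
  have gF: "(\<integral>x. g x * F x \<partial>M) = H"
    unfolding F_def H_def power2_eq_square by (rule cond_mean_adjoint) (auto simp: g2 h2)
  have igF: "integrable M (\<lambda>x. g x * F x)"
  proof (rule Bochner_Integration.integrable_bound)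
    show "integrable M (\<lambda>x. (g x)\<^sup>2 + (F x)\<^sup>2)" using g2 F2 by simp
    show "AE x in M. norm (g x * F x) \<le> norm ((g x)\<^sup>2 + (F x)\<^sup>2)"
    proof (rule AE_I2)
      fix x
      have "0 \<le> (\<bar>g x\<bar> - \<bar>F x\<bar>)\<^sup>2" by simp
      then have "2 * \<bar>g x * F x\<bar> \<le> (g x)\<^sup>2 + (F x)\<^sup>2" by (simp add: power2_diff abs_mult)
      then show "norm (g x * F x) \<le> norm ((g x)\<^sup>2 + (F x)\<^sup>2)" by simp
    qed
  qed measurable
  define a where "a = (\<integral>x. (F x - m)\<^sup>2 \<partial>M)"
  define c where "c = (\<integral>x. (g x - m)\<^sup>2 \<partial>M)"
  define b where "b = (\<integral>x. (g x - m) * (F x - m) \<partial>M)"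
  have exp_ab: "(F x - m)\<^sup>2 = (F x)\<^sup>2 - 2 * m * F x + m\<^sup>2" "(g x - m)\<^sup>2 = (g x)\<^sup>2 - 2 * m * g x + m\<^sup>2"
    "(g x - m) * (F x - m) = g x * F x - m * g x - m * F x + m\<^sup>2" for x
    by (simp_all add: power2_eq_square algebra_simps)
  show iF: "integrable M (\<lambda>x. (F x - m)\<^sup>2)"
    unfolding exp_ab using F1 F2 by simp
  have ig: "integrable M (\<lambda>x. (g x - m)\<^sup>2)"
    unfolding exp_ab using g1 g2 by simp
  have igF': "integrable M (\<lambda>x. (g x - m) * (F x - m))"
    unfolding exp_ab using g1 igF F1 by simp
  have a: "a = (\<integral>x. (F x)\<^sup>2 \<partial>M) - m\<^sup>2"
    unfolding a_def exp_ab using F1 F2 FM by (simp add: prob_space power2_eq_square)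
  have c: "c = (\<integral>x. (g x)\<^sup>2 \<partial>M) - m\<^sup>2"
    unfolding c_def exp_ab using g1 g2 m_def by (simp add: prob_space power2_eq_square)
  have b: "b = H - m\<^sup>2"
    unfolding b_def exp_ab using g1 igF F1 FM m_def gF by (simp add: prob_space power2_eq_square)
  have "m\<^sup>2 \<le> H"
    using T.variance_positive[of ?h] T.variance_eq[OF h1 h2] unfolding H_def mean by simp
  then have "0 \<le> rate * H + (1 - rate) * m\<^sup>2" using r
    by (intro add_nonneg_nonneg mult_nonneg_nonneg) (auto intro: order_trans[OF zero_le_power2])
  moreover have "(\<integral>\<^sup>+x. ennreal ((F x)\<^sup>2) \<partial>M) = ennreal (\<integral>x. (F x)\<^sup>2 \<partial>M)"
    using F2 by (intro nn_integral_eq_integral) auto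
  ultimately have "(\<integral>x. (F x)\<^sup>2 \<partial>M) \<le> rate * H + (1 - rate) * m\<^sup>2"
    using gap by (simp add: ennreal_le_iff)
  then have ab: "a \<le> rate * b"
    unfolding a b right_diff_distrib left_diff_distrib mult_1 by linarith
  have "2 * rate * b = (\<integral>x. 2 * rate * ((g x - m) * (F x - m)) \<partial>M)" by (simp add: b_def)
  also have "\<dots> \<le> (\<integral>x. rate\<^sup>2 * (g x - m)\<^sup>2 + (F x - m)\<^sup>2 \<partial>M)"
  proof (rule integral_mono)
    fix x
    have "0 \<le> (rate * (g x - m) - (F x - m))\<^sup>2" by simp
    then show "2 * rate * ((g x - m) * (F x - m)) \<le> rate\<^sup>2 * (g x - m)\<^sup>2 + (F x - m)\<^sup>2"
      unfolding power2_diff[of "rate * (g x - m)"] power_mult_distrib by (simp add: mult.assoc)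
  qed (use ig iF igF' in simp_all)
  also have "\<dots> = rate\<^sup>2 * c + a" using ig iF by (simp add: a_def c_def)
  finally have "2 * (rate * b) \<le> rate\<^sup>2 * c + a" by (simp only: mult.assoc)
  moreover have "a \<le> y" if "2 * x \<le> y + a" "a \<le> x" for x y using that by linarith
  ultimately have "a \<le> rate\<^sup>2 * c" using ab by blast
  also have "\<dots> \<le> rate\<^sup>2 * (\<integral>x. (g x)\<^sup>2 \<partial>M)" unfolding c by (intro mult_left_mono) auto
  finally show "(\<integral>x. (F x - m)\<^sup>2 \<partial>M) \<le> rate\<^sup>2 * (\<integral>x. (g x)\<^sup>2 \<partial>M)" unfolding a_def .
qed

end

section \<open>Log-concavity as a contraction property\<close>

text \<open>
By monotonicity the set where \<open>l\<close> is positive is an initial segment, and by continuity its supremum is not attained.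
\<close>

lemma open_supp_eq:
  assumes cont: "continuous_on {0<..} l" and anti: "\<And>s t. 0 < s \<Longrightarrow> s \<le> t \<Longrightarrow> l t \<le> l s"
  shows "open_supp l = {t. 0 < t \<and> 0 < l t}"
proof (intro equalityI subsetI)
  fix t assume "t \<in> open_supp l"
  then obtain s where "0 < t" "0 < s" "0 < l s" "t < s"
    by (auto simp: open_supp_def less_SUP_iff)
  then show "t \<in> {t. 0 < t \<and> 0 < l t}" using anti[of t s] by auto
next
  fix t assume "t \<in> {t. 0 < t \<and> 0 < l t}"
  then have t: "0 < t" "0 < l t" by auto
  have "isCont l t" using cont t by (simp add: continuous_on_eq_continuous_at)
  then have "(l \<longlongrightarrow> l t) (at_right t)"
    unfolding isCont_def by (rule filterlim_mono) (auto simp: at_le)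
  then have "eventually (\<lambda>s. 0 < l s) (at_right t)"
    using t by (intro order_tendstoD)
  moreover have "eventually (\<lambda>s. t < s) (at_right t)" by (simp add: eventually_at_filter)
  ultimately have "eventually (\<lambda>s. 0 < l s \<and> t < s) (at_right t)" by (rule eventually_conj)
  then have "\<exists>s. 0 < l s \<and> t < s" by (rule eventually_happens'[rotated]) simp
  then obtain s where "0 < l s" "t < s" by blast
  then show "t \<in> open_supp l" using t by (auto simp: open_supp_def less_SUP_iff intro!: exI[of _ s])
qed

text \<open>
Let \<open>f = ln g\<close>, a concave decreasing function of the radius with \<open>f (a x) = ln x\<close> for \<open>a x = l(x)\<^sup>1\<^sup>/\<^sup>k\<close>. Going
from \<open>s\<close> to \<open>u s\<close> and from \<open>t\<close> to \<open>u t\<close> both lower \<open>f\<close> by \<open>- ln u\<close>. As \<open>f\<close> decreases faster at larger radii,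
the larger radius \<open>a s\<close> increases by at most as much as the smaller radius \<open>a t\<close>.
\<close>

lemma Lambda_class_contraction:
  assumes l: "l \<in> Lambda_class k" and k: "1 \<le> k"
    and anti: "\<And>s t. 0 < s \<Longrightarrow> s \<le> t \<Longrightarrow> l t \<le> l s"
  shows "continuous_on {0<..} l"
    and "\<And>s t. 0 < s \<Longrightarrow> s < t \<Longrightarrow> 0 < l s \<Longrightarrow> l t < l s"
    and "\<And>u s t. 0 < u \<Longrightarrow> u < 1 \<Longrightarrow> 0 < s \<Longrightarrow> s < t \<Longrightarrow> 0 < l t \<Longrightarrow>
      root k (l (u * s)) - root k (l (u * t)) \<le> root k (l s) - root k (l t)"
proof -
  show cont: "continuous_on {0<..} l" using l by (simp add: Lambda_class_def)
  have nonneg: "0 \<le> l t" if "0 < t" for t using l that by (simp add: Lambda_class_def)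
  have supp: "open_supp l = {t. 0 < t \<and> 0 < l t}" by (rule open_supp_eq[OF cont anti])
  have anti_on: "strict_antimono_on (open_supp l) l" using l by (simp add: Lambda_class_def)
  show strict: "l t < l s" if "0 < s" "s < t" "0 < l s" for s t
  proof (cases "0 < l t")
    case True
    then show ?thesis
      using anti_on that by (auto simp: monotone_on_def supp)
  next
    case False
    then show ?thesis using that nonneg[of t] by simp
  qed
  have inj: "inj_on l (open_supp l)"
    unfolding supp using strict by (auto simp: inj_on_def) (metis less_irrefl linorder_neqE_linordered_idom)
  obtain L where L: "0 < L" "((\<lambda>t. ereal (l t)) \<longlongrightarrow> L) (at_right 0)"
    and conc: "log_concave_on {r. 0 < r \<and> ereal r < eroot k L} (\<lambda>r. the_inv_into (open_supp l) l (r ^ k))"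
    using l by (auto simp: Lambda_class_def)
  define R where "R = {r. 0 < r \<and> ereal r < eroot k L}"
  define f where "f r = ln (the_inv_into (open_supp l) l (r ^ k))" for r
  define a where "a x = root k (l x)" for x
  have concave: "concave_on R f" using conc by (simp add: log_concave_on_def R_def f_def[abs_def])
  have f_a: "f (a x) = ln x" if "0 < x" "0 < l x" for x
    using that k the_inv_into_f_f[OF inj, of x] by (simp add: f_def a_def supp)
  have a_R: "a x \<in> R" if "0 < x" "0 < l x" for x
  proof -
    have "l x < l (x / 2)" using that anti[of "x / 2" x] by (intro strict) auto
    moreover have "ereal (l (x / 2)) \<le> L"
    proof (rule tendsto_lowerbound[OF L(2)])
      show "eventually (\<lambda>t. ereal (l (x / 2)) \<le> ereal (l t)) (at_right 0)"
        using eventually_at_right_real[of 0 "x / 2"] that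
        by (auto elim!: eventually_mono intro: anti)
    qed simp
    ultimately have lt: "ereal (l x) < L" by (metis ereal_less_eq(3) less_ereal.simps(1) order_less_le_trans)
    show ?thesis
    proof (cases L)
      case (real c)
      then show ?thesis using lt that k by (simp add: R_def a_def eroot_def)
    qed (use that k L lt in \<open>auto simp: R_def a_def eroot_def\<close>)
  qed
  have a_less: "a t < a s" if "0 < s" "s < t" "0 < l s" for s t
    using strict[OF that] k by (simp add: a_def)
  show "root k (l (u * s)) - root k (l (u * t)) \<le> root k (l s) - root k (l t)"
    if u: "0 < u" "u < 1" and st: "0 < s" "s < t" and lt: "0 < l t" for u s t
  proof (rule ccontr)
    assume "\<not> ?thesis"
    then have neg: "a s - a t < a (u * s) - a (u * t)" by (simp add: a_def)
    have us: "0 < u * s" "u * s < s" "0 < u * t" "u * t < t" using u st by auto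
    have ls: "0 < l s" using anti[of s t] st lt by simp
    have lus: "0 < l (u * s)" "0 < l (u * t)" using anti[of "u * s" s] anti[of "u
        * t" t] us(2,4)[THEN less_imp_le] us(1,3) ls lt by linarith+
    \<comment> \<open>The points \<open>a t < a (u * t)\<close> and \<open>a s < a s + e\<close> span intervals of equal length \<open>e\<close>, the first of them
      further to the left. By concavity \<open>f\<close> drops at least as much on the second, but \<open>a s + e < a (u * s)\<close>
      bounds that drop strictly by \<open>- ln u\<close>, the drop on the first.\<close>
    define e where "e = a (u * t) - a t"
    have e: "0 < e" using a_less[OF us(3,4) lus(2)] by (simp add: e_def)
    have ab: "a t < a s" using a_less[OF st ls] .
    have lt': "a s + e < a (u * s)" using neg by (simp add: e_def)
    have "continuous_on {u * s..s} a"
      unfolding a_def by (intro continuous_intros continuous_on_subset[OF cont]) (use us in auto)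
    then have "\<exists>y\<ge>u * s. y \<le> s \<and> a y = a s + e"
      using lt' e us by (intro IVT2') linarith+
    then obtain y where y: "u * s \<le> y" "y \<le> s" "a y = a s + e" by blast
    have ly: "0 < l y" using anti[of y s] y us ls by auto
    have "y \<noteq> u * s" using y lt' by auto
    with y have y2: "u * s < y" by simp
    define D where "D = a s + e - a t"
    define \<theta> where "\<theta> = (a s - a t) / D"
    have D: "0 < D" using ab e by (simp add: D_def)
    have th: "0 \<le> \<theta>" "\<theta> \<le> 1" using D ab e by (auto simp: \<theta>_def D_def)
    have thD: "\<theta> * D = a s - a t" using D by (simp add: \<theta>_def)
    have mem: "a t \<in> R" "a s + e \<in> R"
      using a_R[of t] a_R[of y] y ly us st lt by auto
    have "(1 - \<theta>) * f (a t) + \<theta> * f (a s + e) \<le> f ((1 - \<theta>) * a t + \<theta> * (a s + e))"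
      using concave_onD[OF concave th mem] by simp
    also have "(1 - \<theta>) * a t + \<theta> * (a s + e) = a t + \<theta> * D" by (simp add: D_def algebra_simps)
    also have "\<dots> = a s" using thD by simp
    finally have c1: "(1 - \<theta>) * f (a t) + \<theta> * f (a s + e) \<le> f (a s)" .
    have "(1 - (1 - \<theta>)) * f (a t) + (1 - \<theta>) * f (a s + e) \<le> f ((1 - (1 - \<theta>)) * a t + (1 - \<theta>) * (a s + e))"
      using concave_onD[OF concave, of "1 - \<theta>" "a t" "a s + e"] th mem by simp
    also have "(1 - (1 - \<theta>)) * a t + (1 - \<theta>) * (a s + e) = a s + e - \<theta> * D" by (simp add: D_def algebra_simps)
    also have "\<dots> = a (u * t)" using thD by (simp add: e_def)
    finally have c2: "\<theta> * f (a t) + (1 - \<theta>) * f (a s + e) \<le> f (a (u * t))" by simp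
    have "f (a t) + f (a s + e) \<le> f (a s) + f (a (u * t))"
      using c1 c2 by (simp add: algebra_simps)
    moreover have "f (a s + e) = ln y" using f_a[of y] y ly us by simp
    moreover have "f (a t) = ln t" "f (a s) = ln s" "f (a (u * t)) = ln u + ln t"
      using f_a[of t] f_a[of s] f_a[of "u * t"] st lt ls us lus u by (simp_all add: ln_mult)
    moreover have "ln u + ln s < ln y"
    proof -
      have "ln (u * s) < ln y" using y2 us(1) by (subst ln_less_cancel_iff) linarith+
      then show ?thesis using u st by (simp add: ln_mult)
    qed
    ultimately show False by simp
  qed
qed

section \<open>The slice sampling kernel\<close>

(* Its hypotheses mention measures that do not occur in its conclusion, so as a rule
   for automatic measurability proofs it does not terminate. *)
declare level_set_borel [measurable del]

lemma nn_integral_kernel_UT: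
  assumes "0 < \<rho>1 x" and "f \<in> borel_measurable pos_borel"
  shows "(\<integral>\<^sup>+t. f t \<partial>kernel_UT \<nu>T \<rho>1 x) = (\<integral>\<^sup>+t. indicator {0<..<\<rho>1 x} t * f t \<partial>lborel) * ennreal (1 / \<rho>1 x)"
proof -
  let ?R = "restrict_space lborel {0<..} :: real measure"
  have I: "{0<..<\<rho>1 x} \<in> sets ?R" by (auto simp: sets_restrict_space_iff)
  have sub: "{0<..<\<rho>1 x} \<subseteq> {0<..}" by auto
  have fm: "f \<in> borel_measurable ?R"
    using assms(2) by (simp cong: measurable_cong_sets add: sets_restrict_space)
  have "(\<integral>\<^sup>+t. f t \<partial>kernel_UT \<nu>T \<rho>1 x) = (\<integral>\<^sup>+t. f t * indicator {0<..<\<rho>1 x} t \<partial>?R) / emeasure ?R {0<..<\<rho>1 x}"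
    using assms(1) unfolding kernel_UT_def by (simp add: nn_integral_uniform_measure[OF fm I])
  also have "emeasure ?R {0<..<\<rho>1 x} = ennreal (\<rho>1 x)"
    using assms(1) sub by (simp add: emeasure_restrict_space)
  also have "(\<integral>\<^sup>+t. f t * indicator {0<..<\<rho>1 x} t \<partial>?R) = (\<integral>\<^sup>+t. indicator {0<..<\<rho>1 x} t * f t \<partial>lborel)"
    by (subst nn_integral_restrict_space) (auto intro!: nn_integral_cong simp: indicator_def)
  also have "\<dots> / ennreal (\<rho>1 x) = \<dots> * ennreal (1 / \<rho>1 x)"
    using assms(1) by (simp add: divide_ennreal_def inverse_ennreal inverse_eq_divide)
  finally show ?thesis .
qed

locale slice_sampling =
  fixes \<rho>0 \<rho>1 \<rho> :: "'a::euclidean_space \<Rightarrow> real" and \<nu>T :: "real measure" and \<nu>X :: "'a measure"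
  assumes meas [measurable]: "\<rho>0 \<in> borel_measurable borel" "\<rho>1 \<in> borel_measurable borel" "\<rho>
      \<in> borel_measurable borel"
    and nonneg: "\<And>x. 0 \<le> \<rho>0 x" "\<And>x. 0 \<le> \<rho>1 x" "\<And>x. 0 \<le> \<rho> x"
    and factor: "AE x in lborel. \<rho> x = \<rho>0 x * \<rho>1 x"
    and int: "integrable lborel \<rho>" and pos: "0 < (\<integral>x. \<rho> x \<partial>lborel)"
    and nuT: "prob_space \<nu>T" "sets \<nu>T = sets pos_borel"
    and nuX: "prob_space \<nu>X" "sets \<nu>X = sets borel"
begin

definition mass :: real where "mass = (\<integral>x. \<rho> x \<partial>lborel)"

abbreviation \<pi> :: "'a measure" where "\<pi> \<equiv> target_measure \<rho>"

abbreviation P :: "'a \<Rightarrow> 'a measure" where "P \<equiv> slice_kernel \<nu>T \<nu>X \<rho>0 \<rho>1"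

lemma mass_pos: "0 < mass" using pos by (simp add: mass_def)

lemma int_product: "integrable lborel (\<lambda>x. \<rho>0 x * \<rho>1 x)"
  using int factor by (subst integrable_cong_AE[of _ _ \<rho>]) (auto elim!: eventually_mono)

lemma target_eq: "\<pi> = density lborel (\<lambda>x. ennreal (\<rho>0 x * \<rho>1 x / mass))"
  unfolding target_measure_def mass_def[symmetric]
  by (rule density_cong) (use factor in \<open>auto elim!: eventually_mono\<close>)

lemma sets_target [measurable_cong, simp]: "sets \<pi> = sets borel"
  by (simp add: target_measure_def)

lemma space_target [simp]: "space \<pi> = UNIV"
  by (simp add: target_measure_def)

lemma prob_space_target: "prob_space \<pi>"
proof (rule prob_spaceI)
  have "emeasure \<pi> (space \<pi>) = (\<integral>\<^sup>+x. ennreal (\<rho> x / mass) \<partial>lborel)"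
    by (simp add: target_measure_def mass_def emeasure_density)
  also have "\<dots> = ennreal (\<integral>x. \<rho> x / mass \<partial>lborel)"
    using int nonneg mass_pos by (intro nn_integral_eq_integral) auto
  also have "(\<integral>x. \<rho> x / mass \<partial>lborel) = 1" using mass_pos by (simp add: mass_def)
  finally show "emeasure \<pi> (space \<pi>) = 1" by simp
qed

lemma AE_target_pos: "AE x in \<pi>. 0 < \<rho>1 x"
proof -
  have "0 < \<rho>1 x" if "0 < \<rho>0 x * \<rho>1 x / mass" for x
    using that nonneg(2)[of x] by (cases "\<rho>1 x = 0") auto
  then show ?thesis
    unfolding target_eq by (subst AE_density) (auto simp: ennreal_less_zero_iff)
qed

sublocale slice_pair \<pi> \<rho>1
proof (intro slice_pair.intro prob_space_target slice_pair_axioms.intro)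
  show "\<rho>1 \<in> borel_measurable \<pi>" by measurable
  show "AE x in \<pi>. 0 < \<rho>1 x" by (rule AE_target_pos)
qed

text \<open>
Dividing the density \<open>\<rho>0 \<rho>1 / mass\<close> of the target by \<open>\<rho>1\<close> leaves \<open>\<rho>0\<close>, so conditioning on the height
in the pair \<open>(\<rho>1(X), T)\<close> amounts to restricting \<open>\<rho>0\<close> to a level set.
\<close>

lemma level_integral_target:
  assumes "0 < t" and [measurable]: "G \<in> borel_measurable borel"
  shows "(\<integral>\<^sup>+x. indicator {t<..} (\<rho>1 x) * ennreal (G x) * ennreal (1 / \<rho>1 x) \<partial>\<pi>) =
    ennreal (1 / mass) * (\<integral>\<^sup>+x. indicator (level_set t \<rho>1) x * (ennreal (\<rho>0 x) * ennreal (G x)) \<partial>lborel)"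
proof -
  have "(\<integral>\<^sup>+x. indicator {t<..} (\<rho>1 x) * ennreal (G x) * ennreal (1 / \<rho>1 x) \<partial>\<pi>) =
    (\<integral>\<^sup>+x. ennreal (\<rho>0 x * \<rho>1 x / mass) * (indicator {t<..} (\<rho>1 x) * ennreal (G x) * ennreal (1 / \<rho>1 x)) \<partial>lborel)"
    unfolding target_eq by (rule nn_integral_density) measurable
  also have "\<dots> = (\<integral>\<^sup>+x. ennreal (1 / mass)
      * (indicator (level_set t \<rho>1) x * (ennreal (\<rho>0 x) * ennreal (G x))) \<partial>lborel)"
  proof (rule nn_integral_cong)
    fix x
    have "ennreal (\<rho>0 x * \<rho>1 x / mass) * ennreal (1 / \<rho>1 x) = ennreal (1 / mass) * ennreal (\<rho>0 x)" if "t < \<rho>1 x"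
      using that assms(1) mass_pos nonneg by (simp add: ennreal_mult[symmetric])
    then show "ennreal (\<rho>0 x * \<rho>1 x / mass) * (indicator {t<..} (\<rho>1 x) * ennreal (G x) * ennreal (1 / \<rho>1 x)) =
      ennreal (1 / mass) * (indicator (level_set t \<rho>1) x * (ennreal (\<rho>0 x) * ennreal (G x)))"
      by (simp add: indicator_def level_set_def) (metis (no_types, lifting) mult.assoc mult.commute)
  qed
  also have "\<dots> = ennreal (1 / mass)
      * (\<integral>\<^sup>+x. indicator (level_set t \<rho>1) x * (ennreal (\<rho>0 x) * ennreal (G x)) \<partial>lborel)"
    using meas(2) by (intro nn_integral_cmult) (simp add: level_set_def)
  finally show ?thesis .
qed

lemma p_eq_level_fun:
  assumes t: "0 < t" shows "height_pdf t = level_fun \<rho>0 \<rho>1 t / mass"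
proof -
  have "ennreal (height_pdf t) = (\<integral>\<^sup>+x. indicator {t<..} (\<rho>1 x) * ennreal 1 * ennreal (1 / \<rho>1 x) \<partial>\<pi>)"
    by (simp add: ennreal_height_pdf[OF t])
  also have "\<dots> = ennreal (1 / mass)
      * (\<integral>\<^sup>+x. indicator (level_set t \<rho>1) x * (ennreal (\<rho>0 x) * ennreal 1) \<partial>lborel)"
    by (rule level_integral_target[OF t]) simp
  also have "(\<integral>\<^sup>+x. indicator (level_set t \<rho>1) x * (ennreal (\<rho>0 x) * ennreal 1) \<partial>lborel)
      = ennreal (level_fun \<rho>0 \<rho>1 t)"
    using nn_integral_level_set[OF meas(1,2) nonneg(1,2) int_product nuX nuT t] by (simp add: mult.commute)
  finally have "ennreal (height_pdf t) = ennreal (level_fun \<rho>0 \<rho>1 t / mass)"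
    using mass_pos by (simp add: ennreal_mult'[symmetric])
  moreover have "0 \<le> level_fun \<rho>0 \<rho>1 t"
    unfolding level_fun_def set_lebesgue_integral_def using nonneg by (intro Bochner_Integration.integral_nonneg) auto
  ultimately show ?thesis using height_pdf_nonneg mass_pos by (simp add: ennreal_inj)
qed

lemma measurable_UX: "kernel_UX \<nu>X \<rho>0 \<rho>1 \<in> pos_borel \<rightarrow>\<^sub>M subprob_algebra borel"
  by (rule measurable_prob_algebraD[OF measurable_kernel_UX[OF meas(1,2) nonneg(1,2) int_product nuX nuT]])

lemma sets_UT: "sets (kernel_UT \<nu>T \<rho>1 x) = sets pos_borel"
  by (simp add: kernel_UT_def nuT sets_restrict_space)

lemma measurable_UT: "kernel_UT \<nu>T \<rho>1 \<in> borel \<rightarrow>\<^sub>M subprob_algebra pos_borel"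
proof (rule measurable_subprob_algebra)
  fix x :: 'a
  show "sets (kernel_UT \<nu>T \<rho>1 x) = sets pos_borel" by (rule sets_UT)
  show "subprob_space (kernel_UT \<nu>T \<rho>1 x)"
  proof (cases "\<rho>1 x = 0")
    case True
    then show ?thesis using nuT by (simp add: kernel_UT_def prob_space_imp_subprob_space)
  next
    case False
    then have "0 < \<rho>1 x" using nonneg(2)[of x] by simp
    moreover have "{0<..<\<rho>1 x} \<subseteq> {0<..}" by auto
    ultimately have "prob_space (uniform_measure (restrict_space lborel {0<..}) {0<..<\<rho>1 x})"
      by (intro prob_space_uniform_measure) (auto simp: emeasure_restrict_space)
    then show ?thesis using False by (simp add: kernel_UT_def prob_space_imp_subprob_space)
  qed
next
  fix A assume A: "A \<in> sets pos_borel"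
  then have Ab: "A \<in> sets borel" by (auto simp: sets_restrict_space)
  have "(\<lambda>x. if \<rho>1 x = 0 then emeasure \<nu>T A
      else (\<integral>\<^sup>+t. (if 0 < t \<and> t < \<rho>1 x then 1 else 0) * indicator A t \<partial>lborel) * ennreal (1 / \<rho>1 x)) \<in> borel_measurable borel"
    using Ab by measurable
  also have "?this \<longleftrightarrow> (\<lambda>x. emeasure (kernel_UT \<nu>T \<rho>1 x) A) \<in> borel_measurable borel"
  proof (rule measurable_cong)
    fix x :: 'a
    show "(if \<rho>1 x = 0 then emeasure \<nu>T A
      else (\<integral>\<^sup>+t. (if 0 < t \<and> t < \<rho>1 x then 1 else 0) * indicator A t \<partial>lborel) * ennreal (1 / \<rho>1 x)) = emeasure (kernel_UT \<nu>T \<rho>1 x) A"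
    proof (cases "\<rho>1 x = 0")
      case False
      then have x: "0 < \<rho>1 x" using nonneg(2)[of x] by simp
      have "emeasure (kernel_UT \<nu>T \<rho>1 x) A = (\<integral>\<^sup>+t. indicator A t \<partial>kernel_UT \<nu>T \<rho>1 x)"
        using A by (simp add: sets_UT)
      then show ?thesis
        using nn_integral_kernel_UT[of \<rho>1 x "indicator A" \<nu>T] x A False by (simp add: indicator_def[of "{0<..<\<rho>1 x}"] of_bool_def)
    qed (simp add: kernel_UT_def)
  qed
  finally show "(\<lambda>x. emeasure (kernel_UT \<nu>T \<rho>1 x) A) \<in> borel_measurable borel" .
qed

lemma measurable_P: "P \<in> borel \<rightarrow>\<^sub>M subprob_algebra borel"
  unfolding slice_kernel_def[abs_def] by (rule measurable_bind2[OF measurable_UT measurable_UX])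

lemma kernel_op_measurable:
  assumes "g \<in> borel_measurable borel"
  shows "kernel_op P g \<in> borel_measurable borel"
  unfolding kernel_op_def[abs_def]
  by (rule measurable_compose[OF measurable_P integral_measurable_subprob_algebra[OF assms]])

lemma nn_integral_UX:
  assumes t: "0 < t" "0 < height_pdf t" and [measurable]: "G \<in> borel_measurable borel" and G0: "\<And>x. 0 \<le> G x"
    and G: "integrable \<pi> G"
  shows "(\<integral>\<^sup>+y. ennreal (G y) \<partial>kernel_UX \<nu>X \<rho>0 \<rho>1 t) = ennreal (cond_mean G t)"
proof -
  have lev [measurable]: "level_set t \<rho>1 \<in> sets borel"
    using meas(2) by (simp add: level_set_def)
  have l: "level_fun \<rho>0 \<rho>1 t = mass * height_pdf t" "0 < level_fun \<rho>0 \<rho>1 t"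
    using p_eq_level_fun[OF t(1)] t mass_pos by (auto simp: zero_less_divide_iff)
  let ?I = "\<integral>\<^sup>+x. indicator (level_set t \<rho>1) x * (ennreal (\<rho>0 x) * ennreal (G x)) \<partial>lborel"
  have "(\<integral>\<^sup>+y. ennreal (G y) \<partial>kernel_UX \<nu>X \<rho>0 \<rho>1 t) =
    (\<integral>\<^sup>+y. ennreal (G y) * indicator (level_set t \<rho>1) y \<partial>density lborel (\<lambda>x. ennreal (\<rho>0 x))) /
      emeasure (density lborel (\<lambda>x. ennreal (\<rho>0 x))) (level_set t \<rho>1)"
  proof -
    have UX: "kernel_UX \<nu>X \<rho>0 \<rho>1 t = uniform_measure (density lborel (\<lambda>x. ennreal (\<rho>0 x))) (level_set t \<rho>1)"
      unfolding kernel_UX_def by (rule if_not_P) (use l(2) in linarith)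
    have mG: "(\<lambda>y. ennreal (G y)) \<in> borel_measurable (density lborel (\<lambda>x. ennreal (\<rho>0 x)))"
      by simp
    have mL: "level_set t \<rho>1 \<in> sets (density lborel (\<lambda>x. ennreal (\<rho>0 x)))"
      unfolding sets_density sets_lborel by (rule lev)
    show ?thesis unfolding UX by (rule nn_integral_uniform_measure[OF mG mL])
  qed
  also have "emeasure (density lborel (\<lambda>x. ennreal (\<rho>0 x))) (level_set t \<rho>1) = ennreal (level_fun \<rho>0 \<rho>1 t)"
    using nn_integral_level_set[OF meas(1,2) nonneg(1,2) int_product nuX nuT t(1)]
    by (simp add: emeasure_density)
  also have "(\<integral>\<^sup>+y. ennreal (G y) * indicator (level_set t \<rho>1) y \<partial>density lborel (\<lambda>x. ennreal (\<rho>0 x))) = ?I"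
    by (subst nn_integral_density) (auto intro!: nn_integral_cong simp: ac_simps)
  also have "?I = ennreal (mass * (height_pdf t * cond_mean G t))"
  proof -
    have i: "integrable \<pi> (\<lambda>x. indicator {t<..} (\<rho>1 x) * G x / \<rho>1 x)"
    proof (rule Bochner_Integration.integrable_bound)
      show "integrable \<pi> (\<lambda>x. G x / t)" using G by simp
      show "AE x in \<pi>. norm (indicator {t<..} (\<rho>1 x) * G x / \<rho>1 x) \<le> norm (G x / t)"
        using t(1) G0 by (intro AE_I2) (auto simp: indicator_def intro!: divide_left_mono)
    qed measurable
    have "ennreal (height_pdf t * cond_mean G t) = ennreal (\<integral>x. indicator {t<..} (\<rho>1 x) * G x / \<rho>1 x \<partial>\<pi>)"
      by (subst mult.commute, subst cond_mean_times_height_pdf[OF t(1)]) auto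
    also have "\<dots> = (\<integral>\<^sup>+x. ennreal (indicator {t<..} (\<rho>1 x) * G x / \<rho>1 x) \<partial>\<pi>)"
      using i G0 nonneg by (intro nn_integral_eq_integral[symmetric]) auto
    also have "\<dots> = (\<integral>\<^sup>+x. indicator {t<..} (\<rho>1 x) * ennreal (G x) * ennreal (1 / \<rho>1 x) \<partial>\<pi>)"
      using G0 nonneg by (intro nn_integral_cong) (auto simp: indicator_def ennreal_mult[symmetric])
    also have "\<dots> = ennreal (1 / mass) * ?I"
      by (rule level_integral_target[OF t(1)]) simp
    finally have "ennreal mass * ennreal (height_pdf t * cond_mean G t)
        = ennreal mass * ennreal (1 / mass) * ?I"
      by (simp only: mult.assoc)
    also have "ennreal mass * ennreal (1 / mass) = 1"
      using mass_pos by (subst ennreal_mult[symmetric]) simp_all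
    finally show ?thesis using mass_pos by (simp only: ennreal_mult' less_imp_le mult_1)
  qed
  also have "\<dots> / ennreal (level_fun \<rho>0 \<rho>1 t) = ennreal (cond_mean G t)"
  proof -
    have "0 \<le> cond_mean G t"
      unfolding cond_mean_def using G0 nonneg height_pdf_nonneg
      by (intro divide_nonneg_nonneg Bochner_Integration.integral_nonneg mult_nonneg_nonneg) simp_all
    then show ?thesis using l t mass_pos by (simp add: divide_ennreal)
  qed
  finally show ?thesis .
qed

end

locale slice_sampling_Lambda = slice_sampling \<rho>0 \<rho>1 \<rho> \<nu>T \<nu>X
  for \<rho>0 \<rho>1 \<rho> :: "'a::euclidean_space \<Rightarrow> real" and \<nu>T :: "real measure" and \<nu>X :: "'a measure" +
  fixes k :: nat
  assumes k_pos: "1 \<le> k" and Lambda: "level_fun \<rho>0 \<rho>1 \<in> Lambda_class k"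
begin

lemma level_fun_antimono: "0 < s \<Longrightarrow> s \<le> t \<Longrightarrow> level_fun \<rho>0 \<rho>1 t \<le> level_fun \<rho>0 \<rho>1 s"
  using height_pdf_antimono[of s t] mass_pos by (simp add: p_eq_level_fun divide_le_cancel)

sublocale contractive_slice \<pi> \<rho>1 k
proof
  note anti = level_fun_antimono
  have l_cont: "continuous_on {0<..} (level_fun \<rho>0 \<rho>1)"
    by (rule Lambda_class_contraction(1)[OF Lambda k_pos]) (rule anti)
  have l_strict: "level_fun \<rho>0 \<rho>1 t < level_fun \<rho>0 \<rho>1 s"
    if "0 < s" "s < t" "0 < level_fun \<rho>0 \<rho>1 s" for s t
    by (rule Lambda_class_contraction(2)[OF Lambda k_pos _ that]) (rule anti)
  have l_contr: "root k (level_fun \<rho>0 \<rho>1 (u * s)) - root k (level_fun \<rho>0 \<rho>1 (u * t))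
      \<le> root k (level_fun \<rho>0 \<rho>1 s) - root k (level_fun \<rho>0 \<rho>1 t)"
    if "0 < u" "u < 1" "0 < s" "s < t" "0 < level_fun \<rho>0 \<rho>1 t" for u s t
    by (rule Lambda_class_contraction(3)[OF Lambda k_pos _ that]) (rule anti)
  show "1 \<le> k" by (rule k_pos)
  have "continuous_on {0<..} (\<lambda>t. level_fun \<rho>0 \<rho>1 t / mass)"
    using l_cont mass_pos by (intro continuous_intros) auto
  then show "continuous_on {0<..} height_pdf"
    by (rule continuous_on_cong[THEN iffD1, rotated 2]) (auto simp: p_eq_level_fun)
  show "height_pdf t < height_pdf s" if "0 < s" "s < t" "0 < height_pdf s" for s t
    using l_strict[of s t] that mass_pos by (auto simp: p_eq_level_fun divide_strict_right_mono zero_less_divide_iff)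
  show "root k (height_pdf (u * s)) - root k (height_pdf (u * t))
      \<le> root k (height_pdf s) - root k (height_pdf t)"
    if u: "0 < u" "u < 1" and st: "0 < s" "s < t" and pt: "0 < height_pdf t" for u s t
  proof -
    have pos: "0 < u * s" "0 < u * t" "0 < t" using u st by auto
    have "0 < level_fun \<rho>0 \<rho>1 t" using pt p_eq_level_fun[OF pos(3)] mass_pos by (simp add: zero_less_divide_iff)
    from l_contr[OF u st this]
    have "(root k (level_fun \<rho>0 \<rho>1 (u * s)) - root k (level_fun \<rho>0 \<rho>1 (u * t))) / root k mass
        \<le> (root k (level_fun \<rho>0 \<rho>1 s) - root k (level_fun \<rho>0 \<rho>1 t)) / root k mass"
      using mass_pos k_pos by (intro divide_right_mono) auto
    then show ?thesis
      unfolding p_eq_level_fun[OF pos(1)] p_eq_level_fun[OF pos(2)] p_eq_level_fun[OF pos(3)] p_eq_level_fun[OF st(1)]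
      by (simp only: real_root_divide diff_divide_distrib)
  qed
qed

lemma integrable_cond_mean:
  assumes "g \<in> borel_measurable borel" "integrable \<pi> (\<lambda>x. (g x)\<^sup>2)"
  shows "integrable height_law (cond_mean g)"
  by (rule slice_operator_contracts(3)) (use assms in auto)

text \<open>
Almost surely \<open>\<rho>1 x\<close> is positive and every height below it has positive density, so that both
kernels are normalised restrictions.
\<close>

lemma AE_nn_integral_P:
  assumes [measurable]: "G \<in> borel_measurable borel" and G0: "\<And>x. 0 \<le> G x" and G2: "integrable \<pi> (\<lambda>x. (G x)\<^sup>2)"
  shows "AE x in \<pi>. (\<integral>\<^sup>+y. ennreal (G y) \<partial>P x) = ennreal (avg (cond_mean G) (\<rho>1 x)) \<and> 0
      \<le> avg (cond_mean G) (\<rho>1 x)"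
proof -
  have G1: "integrable \<pi> G"
    using G2 by (rule square_integrable_imp_integrable[rotated]) simp
  have c0: "0 \<le> cond_mean G t" for t
    unfolding cond_mean_def using G0 nonneg height_pdf_nonneg
    by (intro divide_nonneg_nonneg Bochner_Integration.integral_nonneg mult_nonneg_nonneg) simp_all
  have cm: "cond_mean G \<in> borel_measurable borel" by (rule cond_mean_measurable) simp
  show ?thesis
    using AE_target_pos AE_height_pdf_pos AE_finite_average[OF cm integrable_cond_mean[OF assms(1) G2]]
  proof eventually_elim
    case (elim x)
    have UXm: "(\<lambda>t. \<integral>\<^sup>+y. ennreal (G y) \<partial>kernel_UX \<nu>X \<rho>0 \<rho>1 t) \<in> borel_measurable pos_borel"
      by (rule measurable_compose[OF measurable_UX nn_integral_measurable_subprob_algebra]) simp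
    have "(\<integral>\<^sup>+y. ennreal (G y) \<partial>P x) = (\<integral>\<^sup>+t. (\<integral>\<^sup>+y. ennreal (G y) \<partial>kernel_UX \<nu>X \<rho>0 \<rho>1 t) \<partial>kernel_UT \<nu>T \<rho>1 x)"
      unfolding slice_kernel_def
    proof (rule nn_integral_bind)
      show "kernel_UX \<nu>X \<rho>0 \<rho>1 \<in> kernel_UT \<nu>T \<rho>1 x \<rightarrow>\<^sub>M subprob_algebra borel"
        using measurable_UX by (simp only: measurable_cong_sets[OF sets_UT refl])
    qed simp
    also have "\<dots> = (\<integral>\<^sup>+t. indicator {0<..<\<rho>1 x} t * (\<integral>\<^sup>+y. ennreal (G y) \<partial>kernel_UX \<nu>X \<rho>0 \<rho>1 t) \<partial>lborel)
        * ennreal (1 / \<rho>1 x)"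
      by (rule nn_integral_kernel_UT[of \<rho>1 x, OF elim(1) UXm])
    also have "(\<integral>\<^sup>+t. indicator {0<..<\<rho>1 x} t * (\<integral>\<^sup>+y. ennreal (G y) \<partial>kernel_UX \<nu>X \<rho>0 \<rho>1 t) \<partial>lborel)
      = (\<integral>\<^sup>+t. ennreal (indicator {0<..<\<rho>1 x} t * cond_mean G t) \<partial>lborel)"
    proof (rule nn_integral_cong)
      fix t
      show "indicator {0<..<\<rho>1 x} t * (\<integral>\<^sup>+y. ennreal (G y) \<partial>kernel_UX \<nu>X \<rho>0 \<rho>1 t)
          = ennreal (indicator {0<..<\<rho>1 x} t * cond_mean G t)"
      proof (cases "0 < t \<and> t < \<rho>1 x")
        case True
        then have "0 < height_pdf t" using height_pdf_antimono[of t "\<rho>1 x"] elim by linarith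
        then show ?thesis using nn_integral_UX[of t G] True G0 G1 by simp
      qed auto
    qed
    also have "\<dots> = ennreal (\<integral>t. indicator {0<..<\<rho>1 x} t * cond_mean G t \<partial>lborel)"
      using elim(3) c0 by (intro nn_integral_eq_integral) auto
    also have "\<dots> * ennreal (1 / \<rho>1 x) = ennreal (avg (cond_mean G) (\<rho>1 x))"
      using elim(1) by (simp add: avg_def ennreal_mult''[symmetric])
    moreover have "0 \<le> avg (cond_mean G) (\<rho>1 x)"
      unfolding avg_def using elim(1) c0 by (intro divide_nonneg_nonneg Bochner_Integration.integral_nonneg) auto
    ultimately show ?case by simp
  qed
qed

text \<open>
The formula is transferred from nonnegative functions to the positive and the negative part of \<open>g\<close>. Both
parts have finite integrals under the kernel for almost every \<open>x\<close>, because their conditional means are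
integrable.
\<close>

lemma kernel_op_eq_avg:
  assumes gm [measurable]: "g \<in> borel_measurable borel" and g2: "integrable \<pi> (\<lambda>x. (g x)\<^sup>2)"
  shows "AE x in \<pi>. kernel_op P g x = avg (cond_mean g) (\<rho>1 x)"
proof -
  define gp gn where "gp x = max 0 (g x)" and "gn x = max 0 (- g x)" for x
  have m [measurable]: "gp \<in> borel_measurable borel" "gn \<in> borel_measurable borel"
    unfolding gp_def[abs_def] gn_def[abs_def] by measurable
  have nn: "0 \<le> gp x" "0 \<le> gn x" and g_eq: "g x = gp x - gn x" and abs_eq: "\<bar>g x\<bar> = gp x + gn x" for x
    by (auto simp: gp_def gn_def)
  have sq: "integrable \<pi> (\<lambda>x. (gp x)\<^sup>2)" "integrable \<pi> (\<lambda>x. (gn x)\<^sup>2)"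
    by (rule Bochner_Integration.integrable_bound[OF g2]; auto simp: gp_def gn_def max_def)+
  have i1: "integrable \<pi> gp" "integrable \<pi> gn"
    using sq by (auto intro: square_integrable_imp_integrable[rotated])
  have cm: "cond_mean gp \<in> borel_measurable borel" "cond_mean gn \<in> borel_measurable borel"
    by (auto intro!: cond_mean_measurable)
  have cond_diff: "cond_mean g t = cond_mean gp t - cond_mean gn t" if t: "0 < t" for t
  proof -
    have i: "integrable \<pi> (\<lambda>x. indicator {t<..} (\<rho>1 x) * f x / \<rho>1 x)"
      if [measurable]: "f \<in> borel_measurable borel" and "integrable \<pi> f" for f
    proof (rule Bochner_Integration.integrable_bound)
      show "integrable \<pi> (\<lambda>x. f x / t)" using that by simp
      show "AE x in \<pi>. norm (indicator {t<..} (\<rho>1 x) * f x / \<rho>1 x) \<le> norm (f x / t)"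
        using t by (intro AE_I2) (auto simp: indicator_def abs_divide intro!: divide_left_mono)
    qed measurable
    have "(\<integral>x. indicator {t<..} (\<rho>1 x) * g x / \<rho>1 x \<partial>\<pi>) =
      (\<integral>x. indicator {t<..} (\<rho>1 x) * gp x / \<rho>1 x - indicator {t<..} (\<rho>1 x) * gn x / \<rho>1 x \<partial>\<pi>)"
      by (simp add: g_eq right_diff_distrib diff_divide_distrib)
    also have "\<dots> = (\<integral>x. indicator {t<..} (\<rho>1 x) * gp x / \<rho>1 x \<partial>\<pi>)
        - (\<integral>x. indicator {t<..} (\<rho>1 x) * gn x / \<rho>1 x \<partial>\<pi>)"
      by (rule Bochner_Integration.integral_diff[OF i[OF m(1) i1(1)] i[OF m(2) i1(2)]])
    finally show ?thesis by (simp add: cond_mean_def diff_divide_distrib)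
  qed
  show ?thesis
    using AE_target_pos AE_nn_integral_P[OF m(1) nn(1) sq(1)] AE_nn_integral_P[OF m(2) nn(2) sq(2)]
      AE_finite_average[OF cm(1) integrable_cond_mean[OF m(1) sq(1)]]
      AE_finite_average[OF cm(2) integrable_cond_mean[OF m(2) sq(2)]]
  proof eventually_elim
    case (elim x)
    have sP: "sets (P x) = sets borel"
      by (rule subprob_measurableD(2)[OF measurable_P]) simp
    have mP: "gp \<in> borel_measurable (P x)" "gn \<in> borel_measurable (P x)" "g \<in> borel_measurable (P x)"
      using m gm by (simp_all only: measurable_cong_sets[OF sP refl])
    have "(\<integral>\<^sup>+y. ennreal (norm (g y)) \<partial>P x) = (\<integral>\<^sup>+y. ennreal (gp y) + ennreal (gn y) \<partial>P x)"
      using nn by (intro nn_integral_cong) (simp add: abs_eq)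
    also have "\<dots> = (\<integral>\<^sup>+y. ennreal (gp y) \<partial>P x) + (\<integral>\<^sup>+y. ennreal (gn y) \<partial>P x)"
      using mP by (intro nn_integral_add) auto
    also have "\<dots> < \<infinity>" using elim by simp
    finally have "integrable (P x) g" by (intro integrableI_bounded mP)
    then have "kernel_op P g x = enn2real (\<integral>\<^sup>+y. ennreal (g y) \<partial>P x) - enn2real (\<integral>\<^sup>+y. ennreal (- g y) \<partial>P x)"
      unfolding kernel_op_def by (rule real_lebesgue_integral_def)
    also have "(\<integral>\<^sup>+y. ennreal (g y) \<partial>P x) = (\<integral>\<^sup>+y. ennreal (gp y) \<partial>P x)"
      by (intro nn_integral_cong) (auto simp: gp_def max_def ennreal_neg)
    also have "(\<integral>\<^sup>+y. ennreal (- g y) \<partial>P x) = (\<integral>\<^sup>+y. ennreal (gn y) \<partial>P x)"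
      by (intro nn_integral_cong) (auto simp: gn_def max_def ennreal_neg)
    finally have "kernel_op P g x = avg (cond_mean gp) (\<rho>1 x) - avg (cond_mean gn) (\<rho>1 x)"
      using elim by simp
    also have "\<dots> = (\<integral>t. indicator {0<..<\<rho>1 x} t * cond_mean gp t
        - indicator {0<..<\<rho>1 x} t * cond_mean gn t \<partial>lborel) / \<rho>1 x"
      unfolding avg_def using elim by (subst Bochner_Integration.integral_diff) (auto simp: diff_divide_distrib)
    also have "\<dots> = avg (cond_mean g) (\<rho>1 x)"
      unfolding avg_def
      by (intro arg_cong2[where f = "(/)"] Bochner_Integration.integral_cong) (auto simp: indicator_def cond_diff)
    finally show ?case .
  qed
qed

lemma opnorm_le: "L2_opnorm \<pi> (\<lambda>g x. kernel_op P g x - mean_op \<pi> g x) \<le> ereal rate"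
  unfolding L2_opnorm_def
proof (rule SUP_least)
  fix g assume g: "g \<in> {f \<in> L2_space \<pi>. L2_norm \<pi> f \<le> 1}"
  then have gm: "g \<in> borel_measurable borel" and g2: "integrable \<pi> (\<lambda>x. (g x)\<^sup>2)"
    by (auto simp: L2_space_def cong: measurable_cong_sets)
  have "L2_norm \<pi> g = ereal (sqrt (\<integral>x. (g x)\<^sup>2 \<partial>\<pi>))"
    using g by (simp add: L2_norm_def)
  then have g1: "(\<integral>x. (g x)\<^sup>2 \<partial>\<pi>) \<le> 1" using g by simp
  have gm': "g \<in> borel_measurable \<pi>" using gm by simp
  define m where "m = (\<integral>x. g x \<partial>\<pi>)"
  let ?T = "\<lambda>x. kernel_op P g x - m"
  note contr = slice_operator_contracts[OF gm' g2, folded m_def]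
  have Tm: "?T \<in> borel_measurable \<pi>"
    using kernel_op_measurable[OF gm] by simp
  have ae: "AE x in \<pi>. (?T x)\<^sup>2 = (avg (cond_mean g) (\<rho>1 x) - m)\<^sup>2"
    using kernel_op_eq_avg[OF gm g2] by eventually_elim simp
  have cm: "cond_mean g \<in> borel_measurable borel" using gm' by (rule cond_mean_measurable)
  have Fm: "(\<lambda>x. (avg (cond_mean g) (\<rho>1 x) - m)\<^sup>2) \<in> borel_measurable \<pi>"
    using avg_measurable[OF cm] by measurable
  have T2m: "(\<lambda>x. (?T x)\<^sup>2) \<in> borel_measurable \<pi>" using Tm by measurable
  have Ti: "integrable \<pi> (\<lambda>x. (?T x)\<^sup>2)"
    using contr(1) integrable_cong_AE[OF T2m Fm ae] by simp
  have "(\<integral>x. (?T x)\<^sup>2 \<partial>\<pi>) = (\<integral>x. (avg (cond_mean g) (\<rho>1 x) - m)\<^sup>2 \<partial>\<pi>)"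
    by (rule integral_cong_AE[OF T2m Fm ae])
  also have "\<dots> \<le> rate\<^sup>2 * (\<integral>x. (g x)\<^sup>2 \<partial>\<pi>)" by (rule contr(2))
  also have "\<dots> \<le> rate\<^sup>2 * 1" using g1 by (intro mult_left_mono) auto
  finally have "sqrt (\<integral>x. (?T x)\<^sup>2 \<partial>\<pi>) \<le> rate"
    by (intro real_le_lsqrt) auto
  moreover have "?T \<in> L2_space \<pi>" using Tm Ti by (simp add: L2_space_def)
  ultimately show "L2_norm \<pi> (\<lambda>x. kernel_op P g x - mean_op \<pi> g x) \<le> ereal rate"
    by (simp add: L2_norm_def mean_op_def m_def)
qed

lemma spectral_gap_ge: "ereal (1 / (real k + 1)) \<le> spectral_gap \<pi> P"
proof -
  have "ereal (1 / (real k + 1)) = 1 - ereal rate"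
    by (simp add: one_ereal_def field_simps)
  also have "\<dots> \<le> spectral_gap \<pi> P"
    unfolding spectral_gap_def by (intro ereal_minus_mono opnorm_le) simp
  finally show ?thesis .
qed

end

theorem theorem3p9:
  fixes \<rho>0 \<rho>1 \<rho> :: "real ^ 'd \<Rightarrow> real"
    and \<nu>T :: "real measure" and \<nu>X :: "(real ^ 'd) measure"
  assumes "\<rho>0 \<in> borel_measurable borel" and "\<rho>1 \<in> borel_measurable borel"
    and "\<rho> \<in> borel_measurable borel"
    and "\<And>x. 0 \<le> \<rho>0 x" and "\<And>x. 0 \<le> \<rho>1 x" and "\<And>x. 0 \<le> \<rho> x"
    and "AE x in lborel. \<rho> x = \<rho>0 x * \<rho>1 x"
    and "integrable lborel \<rho>" and "0 < (\<integral>x. \<rho> x \<partial>lborel)"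
    and "prob_space \<nu>T" and "sets \<nu>T = sets pos_borel"
    and "prob_space \<nu>X" and "sets \<nu>X = sets borel"
  shows "\<forall>k::nat. 1 \<le> k \<longrightarrow> level_fun \<rho>0 \<rho>1 \<in> Lambda_class k \<longrightarrow>
    spectral_gap (target_measure \<rho>) (slice_kernel \<nu>T \<nu>X \<rho>0 \<rho>1) \<ge> ereal (1 / (real k + 1))"
proof (intro allI impI)
  fix k :: nat assume k: "1 \<le> k" "level_fun \<rho>0 \<rho>1 \<in> Lambda_class k"
  interpret slice_sampling_Lambda \<rho>0 \<rho>1 \<rho> \<nu>T \<nu>X k
    by (intro slice_sampling_Lambda.intro slice_sampling.intro slice_sampling_Lambda_axioms.intro assms k)
  show "spectral_gap (target_measure \<rho>) (slice_kernel \<nu>T \<nu>X \<rho>0 \<rho>1) \<ge> ereal (1 / (real k + 1))"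
    by (rule spectral_gap_ge)
qed

end
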